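(* Consider a function $h:\mathbb{R}^m\to\overline{\mathbb{R}}$, and a map $c:\mathbb{R}^n\to\mathbb{R}^m$ that is $\mathcal{C}^2$ around the point $\bar x\in\mathbb{R}^n$. Suppose that $h$ is prox-regular at the point $\bar c=c(\bar x)$, and partly smooth there relative to the manifold $\mathcal{M}$. Suppose further that the constraint qualification $$\mathrm{par}\,\partial h(\bar c)\cap\mathrm{Null}\big(\nabla c(\bar x)^*\big)=\{0\}$$ and the strict criticality condition $$\mathrm{ri}\big(\partial h(\bar c)\big)\cap\mathrm{Null}\big(\nabla c(\bar x)^*\big)\ne\emptyset$$ both hold. Then there exist nonnegative constants $\hat\mu$ and $\gamma$ with the following property. Given any sequence $\{\mu_r\}$ with $\mu_r>\hat\mu$ for all $r$, and any sequence $x_r\to\bar x$ such that $\mu_r|x_r-\bar x|\to0$, the small local minimizer $d_r$ of $h_{x_r,\mu_r}$ (as specified in the context) satisfies, for all large $r$, the condition $$c(x_r)+\nabla c(x_r)d_r\in\mathcal{M},$$ and also the inequalities $$|x_r^{\mathrm{new}}-(x_r+d_r)|\le\gamma|d_r|^2\quad\text{and}\quad h\big(c(x_r^{\mathrm{new}})\big)\le h\big(c(x_r)+\nabla c(x_r)d_r\big)+\gamma|d_r|^2$$ hold for some point $x_r^{\mathrm{new}}$ with $c(x_r^{\mathrm{new}})\in\mathcal{M}$. In the special case when $h:\mathbb{R}^m\to(-\infty,+\infty]$ is convex and lower semicontinuous, the result holds with $\hat\mu=0$.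
   Context: $\overline{\mathbb{R}}=[-\infty,+\infty]$; $|\cdot|$ is the Euclidean norm; $\nabla c(x):\mathbb{R}^n\to\mathbb{R}^m$ is the derivative of $c$ at $x$, $^*$ denotes the adjoint, $\mathrm{Null}$ the null space; $\mathrm{par}\,C$ is the linear subspace parallel to the affine span of $C$; $\mathrm{ri}$ is the relative interior of a convex set. Proximal linearized objective: $h_{x,\mu}(d):=h\big(c(x)+\nabla c(x)d\big)+\frac{\mu}{2}|d|^2$ for $d\in\mathbb{R}^n$. The small local minimizer $d_r$: for all large $r$, $d_r$ is the (existing and, for all large $r$, uniquely defined) local minimizer of $h_{x_r,\mu_r}$ such that $0\in\partial h_{x_r,\mu_r}(d_r)$, $d_r=O(|x_r-\bar x|)$, $h(c(x_r)+\nabla c(x_r)d_r)\to h(\bar c)$ as $r\to\infty$, and for which there are multipliers $v_r\in\partial h(c(x_r)+\nabla c(x_r)d_r)$ with $\nabla c(x_r)^*v_r+\mu_rd_r=0$ and $v_r\to\bar v$, where $\bar v$ is the unique element of $\partial h(\bar c)\cap\mathrm{Null}(\nabla c(\bar x)^* )$. Epigraph: $\mathrm{epi}\,h=\{(c,r)\in\mathbb{R}^m\times\mathbb{R}:r\ge h(c)\}$. For a locally closed set $S$ and $s\in S$, the normal cone $N_S(s)$ (set of normal vectors) consists of all limits of sequences $\lambda_k(u_k-v_k)$ where $\lambda_k>0$, $u_k\to s$, $v_k\to s$, and $v_k$ is a closest point to $u_k$ in $S$; tangent vectors to $S$ at $s$ are limits of sequences $\lambda_k(u_k-s)$ with $u_k\in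 S$, $u_k\to s$, $\lambda_k>0$. $S$ is Clarke regular at $s$ if the inner product of any normal vector with any tangent vector is nonpositive. At a point $\bar c$ where $h$ is finite and near which $h$ is lower semicontinuous, $\partial h(\bar c)=\{v:(v,-1)\in N_{\mathrm{epi}\,h}(\bar c,h(\bar c))\}$ (likewise for functions on $\mathbb{R}^n$), and $h$ is subdifferentially regular at $\bar c$ if $\mathrm{epi}\,h$ is Clarke regular at $(\bar c,h(\bar c))$. $h$ is prox-regular at $\bar c$ for a subgradient $\bar v\in\partial h(\bar c)$ if $h$ is finite at $\bar c$, locally lower semicontinuous around $\bar c$, and there exists $\rho>0$ such that $h(c')\ge h(c)+\langle v,c'-c\rangle-\frac{\rho}{2}|c'-c|^2$ whenever $c,c'$ are near $\bar c$ with $h(c)$ near $h(\bar c)$, and for every $v\in\partial h(c)$ near $\bar v$. $h$ is prox-regular at $\bar c$ if it is so for every $\bar v\in\partial h(\bar c)$. A set $\mathcal{M}\subset\mathbb{R}^m$ is a manifold about $\bar c\in\mathcal{M}$ if there is a map $F:\mathbb{R}^m\to\mathbb{R}^k$ that is $\mathcal{C}^2$ around $\bar c$, with $\nabla F(\bar c)$ surjective, such that points $c$ near $\bar c$ lie in $\mathcal{M}$ iff $F(c)=0$; its normal space is $N_{\mathcal{M}}(\bar c)=\mathrm{Range}(\nabla F(\bar c)^* )$. Given a manifold $\mathcal{M}$ about $\bar c$, $h$ is partly smooth at $\bar c$ relative to $\mathcal{M}$ if $h$ is subdifferentially regular at all points $c\in\mathcal{M}$ near $\bar c$, the dependence of the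 value $h(c)$ and of the (nonempty) subdifferential $\partial h(c)$ on $c\in\mathcal{M}$ near $\bar c$ are $\mathcal{C}^2$ and continuous (as a set-valued mapping) respectively, and the affine span of $\partial h(\bar c)$ is a translate of $N_{\mathcal{M}}(\bar c)$.
   Formalization: In the convex case with μ̂=0, existence of the small local minimizers d_r is asserted only for μ_r bounded away from 0, since d_r=O(|x_r−x̄|) can fail as μ_r→0 (h(c)=c₂, c(x)=(x,x²), μ_r=x_r=1/r); uniqueness and all conclusions are stated for every μ_r>0. *)

theory Defs
  imports "HOL-Analysis.Analysis" "HOL-Library.Landau_Symbols"
begin

section \<open>Smooth maps and manifolds\<close>

abbreviation derivative_at ::
    "('a::real_normed_vector \<Rightarrow> 'b::real_normed_vector) \<Rightarrow> 'a \<Rightarrow> 'a \<Rightarrow> 'b"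
  (\<open>\<nabla>\<close>) where
  "\<nabla> f x \<equiv> frechet_derivative f (at x)"

definition C2_around ::
    "('a::real_normed_vector \<Rightarrow> 'b::real_normed_vector) \<Rightarrow> 'a \<Rightarrow> bool" where
  "C2_around f x \<longleftrightarrow>
     (\<exists>U (f' :: 'a \<Rightarrow> 'a \<Rightarrow>\<^sub>L 'b) (f'' :: 'a \<Rightarrow> 'a \<Rightarrow>\<^sub>L 'a \<Rightarrow>\<^sub>L 'b).
        open U \<and> x \<in> U \<and>
        (\<forall>y\<in>U. (f has_derivative blinfun_apply (f' y)) (at y)) \<and>
        (\<forall>y\<in>U. (f' has_derivative blinfun_apply (f'' y)) (at y)) \<and>
        continuous_on U f'')"

definition null_space :: "('a \<Rightarrow> 'b::zero) \<Rightarrow> 'a set" where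
  "null_space A = {x. A x = 0}"

text \<open>
  The target space of a defining map is \<open>\<real>\<^sup>k\<close> for some \<open>k\<close> that depends on the manifold and so
  cannot be a type. Surjectivity of the derivative forces \<open>k\<close> to be at most the dimension of the
  domain, so \<open>\<real>\<^sup>k\<close> is realised as a \<open>k\<close>-dimensional linear subspace \<open>Y\<close> of the domain
  (\<open>k = 0\<close>, that is \<open>Y = {0}\<close>, is allowed). Since the adjoint of a map into \<open>Y\<close> vanishes on the
  orthogonal complement of \<open>Y\<close>, its range is the same whether it is taken with respect to \<open>Y\<close> or
  to the whole space.
\<close>

definition defining_map ::
    "'a::euclidean_space set \<Rightarrow> 'a \<Rightarrow> ('a \<Rightarrow> 'a) \<Rightarrow> bool" where
  "defining_map M c F \<longleftrightarrow>
     (\<exists>Y. subspace Y \<and> range F \<subseteq> Y \<and> C2_around F c \<and> range (\<nabla> F c) = Y \<and>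
          (\<forall>\<^sub>F z in nhds c. z \<in> M \<longleftrightarrow> F z = 0))"

definition manifold_about :: "'a::euclidean_space set \<Rightarrow> 'a \<Rightarrow> bool" where
  "manifold_about M c \<longleftrightarrow> c \<in> M \<and> (\<exists>F. defining_map M c F)"

text \<open>The normal space does not depend on the choice of the defining map.\<close>

definition normal_space :: "'a::euclidean_space set \<Rightarrow> 'a \<Rightarrow> 'a set" where
  "normal_space M c = range (adjoint (\<nabla> (SOME F. defining_map M c F) c))"

section \<open>Variational analysis\<close>

definition parallel_subspace :: "'a::euclidean_space set \<Rightarrow> 'a set" where
  "parallel_subspace C = (THE L. subspace L \<and> affine_parallel (affine hull C) L)"

definition normal_cone :: "'a::euclidean_space set \<Rightarrow> 'a \<Rightarrow> 'a set" where
  "normal_cone S s =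
     {w. \<exists>(l :: nat \<Rightarrow> real) u v.
           (\<forall>k. 0 < l k) \<and> u \<longlonglongrightarrow> s \<and> v \<longlonglongrightarrow> s \<and>
           (\<forall>k. v k \<in> S \<and> (\<forall>y\<in>S. dist (u k) (v k) \<le> dist (u k) y)) \<and>
           (\<lambda>k. l k *\<^sub>R (u k - v k)) \<longlonglongrightarrow> w}"

definition tangent_cone :: "'a::euclidean_space set \<Rightarrow> 'a \<Rightarrow> 'a set" where
  "tangent_cone S s =
     {w. \<exists>(l :: nat \<Rightarrow> real) u.
           (\<forall>k. 0 < l k) \<and> (\<forall>k. u k \<in> S) \<and> u \<longlonglongrightarrow> s \<and>
           (\<lambda>k. l k *\<^sub>R (u k - s)) \<longlonglongrightarrow> w}"

definition clarke_regular :: "'a::euclidean_space set \<Rightarrow> 'a \<Rightarrow> bool" where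
  "clarke_regular S s \<longleftrightarrow> (\<forall>w\<in>normal_cone S s. \<forall>t\<in>tangent_cone S s. w \<bullet> t \<le> 0)"

definition epi :: "('a \<Rightarrow> ereal) \<Rightarrow> ('a \<times> real) set" where
  "epi h = {(c, r). h c \<le> ereal r}"

definition lsc_at :: "('a::topological_space \<Rightarrow> ereal) \<Rightarrow> 'a \<Rightarrow> bool" where
  "lsc_at h c \<longleftrightarrow> h c \<le> Liminf (at c) h"

text \<open>At points where \<open>h\<close> is not finite the subdifferential is empty by convention.\<close>

definition subdifferential :: "('a::euclidean_space \<Rightarrow> ereal) \<Rightarrow> 'a \<Rightarrow> 'a set" where
  "subdifferential h c =
     {v. \<bar>h c\<bar> \<noteq> \<infinity> \<and> (v, -1) \<in> normal_cone (epi h) (c, real_of_ereal (h c))}"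

definition subdifferentially_regular :: "('a::euclidean_space \<Rightarrow> ereal) \<Rightarrow> 'a \<Rightarrow> bool" where
  "subdifferentially_regular h c \<longleftrightarrow>
     \<bar>h c\<bar> \<noteq> \<infinity> \<and> clarke_regular (epi h) (c, real_of_ereal (h c))"

definition prox_regular_for ::
    "('a::euclidean_space \<Rightarrow> ereal) \<Rightarrow> 'a \<Rightarrow> 'a \<Rightarrow> bool" where
  "prox_regular_for h cbar vbar \<longleftrightarrow>
     \<bar>h cbar\<bar> \<noteq> \<infinity> \<and> (\<forall>\<^sub>F c in nhds cbar. lsc_at h c) \<and>
     (\<exists>\<rho>>0. \<exists>\<epsilon>>0. \<forall>c c' v.
        dist c cbar < \<epsilon> \<longrightarrow> dist c' cbar < \<epsilon> \<longrightarrow> \<bar>h c - h cbar\<bar> < ereal \<epsilon> \<longrightarrow>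
        v \<in> subdifferential h c \<longrightarrow> dist v vbar < \<epsilon> \<longrightarrow>
        h c' \<ge> h c + ereal (v \<bullet> (c' - c) - \<rho> / 2 * (norm (c' - c))\<^sup>2))"

definition prox_regular :: "('a::euclidean_space \<Rightarrow> ereal) \<Rightarrow> 'a \<Rightarrow> bool" where
  "prox_regular h cbar \<longleftrightarrow> (\<forall>vbar\<in>subdifferential h cbar. prox_regular_for h cbar vbar)"

text \<open>
  Continuity of a set-valued mapping relative to a set, in the sense of Painleve and Kuratowski:
  outer and inner semicontinuity.
\<close>

definition set_valued_continuous_within ::
    "('a::metric_space \<Rightarrow> 'b::metric_space set) \<Rightarrow> 'a \<Rightarrow> 'a set \<Rightarrow> bool" where
  "set_valued_continuous_within S x M \<longleftrightarrow>
     (\<forall>y v w. (\<forall>k::nat. y k \<in> M \<and> v k \<in> S (y k)) \<longrightarrow> y \<longlonglongrightarrow> x \<longrightarrow> v \<longlonglongrightarrow> w \<longrightarrow> w \<in> S x) \<and>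
     (\<forall>w\<in>S x. \<forall>y. (\<forall>k::nat. y k \<in> M) \<longrightarrow> y \<longlonglongrightarrow> x \<longrightarrow>
        (\<exists>v. v \<longlonglongrightarrow> w \<and> (\<forall>\<^sub>F k in sequentially. v k \<in> S (y k))))"

text \<open>
  The restriction of \<open>h\<close> to the manifold is \<open>C\<^sup>2\<close> when it agrees, near the point, with a
  \<open>C\<^sup>2\<close> function on the ambient space.
\<close>

definition partly_smooth ::
    "('a::euclidean_space \<Rightarrow> ereal) \<Rightarrow> 'a \<Rightarrow> 'a set \<Rightarrow> bool" where
  "partly_smooth h cbar M \<longleftrightarrow>
     manifold_about M cbar \<and>
     (\<forall>\<^sub>F c in nhds cbar. c \<in> M \<longrightarrow> subdifferentially_regular h c) \<and>
     (\<exists>g :: 'a \<Rightarrow> real. C2_around g cbar \<and>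
        (\<forall>\<^sub>F c in nhds cbar. c \<in> M \<longrightarrow> h c = ereal (g c))) \<and>
     (\<forall>\<^sub>F c in nhds cbar. c \<in> M \<longrightarrow>
        subdifferential h c \<noteq> {} \<and> set_valued_continuous_within (subdifferential h) c M) \<and>
     affine_parallel (normal_space M cbar) (affine hull (subdifferential h cbar))"

section \<open>The proximal linearized subproblem\<close>

definition linearization ::
    "('a::real_normed_vector \<Rightarrow> 'b::real_normed_vector) \<Rightarrow> 'a \<Rightarrow> 'a \<Rightarrow> 'b" where
  "linearization c x d = c x + \<nabla> c x d"

definition prox_linear_objective ::
    "('b::real_normed_vector \<Rightarrow> ereal) \<Rightarrow> ('a::real_normed_vector \<Rightarrow> 'b) \<Rightarrow> 'a \<Rightarrow> real \<Rightarrow> 'a \<Rightarrow> ereal"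
  where
  "prox_linear_objective h c x \<mu> d = h (linearization c x d) + ereal (\<mu> / 2 * (norm d)\<^sup>2)"

definition local_minimizer :: "('a::topological_space \<Rightarrow> ereal) \<Rightarrow> 'a \<Rightarrow> bool" where
  "local_minimizer f d \<longleftrightarrow> (\<forall>\<^sub>F e in nhds d. f d \<le> f e)"

definition small_local_minimizers ::
    "('b::euclidean_space \<Rightarrow> ereal) \<Rightarrow> ('a::euclidean_space \<Rightarrow> 'b) \<Rightarrow> 'a \<Rightarrow>
     (nat \<Rightarrow> real) \<Rightarrow> (nat \<Rightarrow> 'a) \<Rightarrow> (nat \<Rightarrow> 'a) \<Rightarrow> bool" where
  "small_local_minimizers h c xbar \<mu> x d \<longleftrightarrow>
     (\<forall>\<^sub>F r in sequentially.
        local_minimizer (prox_linear_objective h c (x r) (\<mu> r)) (d r) \<and>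
        0 \<in> subdifferential (prox_linear_objective h c (x r) (\<mu> r)) (d r)) \<and>
     (\<lambda>r. norm (d r)) \<in> O(\<lambda>r. norm (x r - xbar)) \<and>
     (\<lambda>r. h (linearization c (x r) (d r))) \<longlonglongrightarrow> h (c xbar) \<and>
     (\<exists>v vbar.
        subdifferential h (c xbar) \<inter> null_space (adjoint (\<nabla> c xbar)) = {vbar} \<and>
        (\<forall>\<^sub>F r in sequentially.
           v r \<in> subdifferential h (linearization c (x r) (d r)) \<and>
           adjoint (\<nabla> c (x r)) (v r) + \<mu> r *\<^sub>R d r = 0) \<and>
        v \<longlonglongrightarrow> vbar)"

text \<open>The two conclusions about the steps \<open>d r\<close>, with constant \<open>\<gamma>\<close>.\<close>

definition identifies_manifold ::
    "('b::real_normed_vector \<Rightarrow> ereal) \<Rightarrow> ('a::real_normed_vector \<Rightarrow> 'b) \<Rightarrow> 'b set \<Rightarrow> real \<Rightarrow>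
     (nat \<Rightarrow> 'a) \<Rightarrow> (nat \<Rightarrow> 'a) \<Rightarrow> bool" where
  "identifies_manifold h c M \<gamma> x d \<longleftrightarrow>
     (\<forall>\<^sub>F r in sequentially.
        linearization c (x r) (d r) \<in> M \<and>
        (\<exists>xnew. c xnew \<in> M \<and>
           norm (xnew - (x r + d r)) \<le> \<gamma> * (norm (d r))\<^sup>2 \<and>
           h (c xnew) \<le> h (linearization c (x r) (d r)) + ereal (\<gamma> * (norm (d r))\<^sup>2)))"

end

theory Submission
  imports Defs
begin

text \<open>
  Near \<open>c xbar\<close> the manifold is \<open>{F = 0}\<close>, on it \<open>h\<close> agrees with a smooth \<open>g\<close>, and the constraint
  qualification makes the derivative of \<open>F \<circ> c\<close> at \<open>xbar\<close> surjective onto the range space of \<open>F\<close>. Hence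
  a point where \<open>F \<circ> c\<close>, or its linearized version, is small can be corrected to a zero at a distance
  proportional to that value; for \<open>F \<circ> c\<close> at \<open>x + d\<close> the value is \<open>O(|d|^2)\<close>, which yields \<open>xnew\<close>.

  Existence: minimise the smooth function \<open>g (c x + c' x d) + \<mu>/2 |d|^2\<close> over small \<open>d\<close> with
  \<open>F (c x + c' x d) = 0\<close>. The prox-regularity inequality at the critical subgradient \<open>vbar\<close>, compared
  with a feasible \<open>d\<close> close to \<open>xbar - x\<close>, gives \<open>d = O(|x - xbar|)\<close>; the Lagrange multiplier \<open>v\<close> tends
  to \<open>vbar\<close>. Because \<open>vbar\<close> is relatively interior and the subdifferential is inner semicontinuous
  along the manifold, \<open>v\<close> is a genuine subgradient there, and the quadratic term absorbs the defect \<open>\<rho>\<close>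
  of the prox-regularity inequality, so \<open>d\<close> is a local minimizer for the full objective.

  Uniqueness adds the two prox-regularity inequalities at two candidate steps. Identification adds
  those at a point off the manifold and at its normal projection, whose subdifferential contains
  subgradients tilted towards that point. In the convex case all inequalities hold with \<open>\<rho> = 0\<close>.
\<close>

section \<open>Calculus and linear algebra\<close>

text \<open>The subdifferential is defined by limits of proximal normals, so neither nearest points
  nor separation are directly at hand. The arguments therefore run through the set
  \<open>P z\<close> of vectors that satisfy the prox-regularity inequality at \<open>z\<close> on
  one fixed ball: an intersection of half-spaces. At manifold points near \<open>c xbar\<close> it
  contains every subgradient close to \<open>vbar\<close>, and all its members are subgradients.

  The parameters \<mu> may be unbounded, so the constants must not depend on them; only the product
  of \<mu> and \<open>|x - xbar|\<close> tends to 0. The threshold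
  \<open>4 * \<rho> * K^2 + \<eta>\<close> comes from comparing values: the defect \<rho> costs
  \<open>\<rho> * K^2 * |d|^2\<close>, half of the proximal term pays for it, the other half bounds
  \<open>d\<close>, and \<eta> keeps that bound finite. Since \<rho> is a parameter that may be 0,
  one development serves the prox-regular and the convex case.\<close>

text \<open>One radius and one constant serve for the derivative and for its Lipschitz modulus, so
  that several maps can share both after shrinking \<open>R\<close> and enlarging \<open>K\<close>.
  Nothing else is kept of the C2 hypotheses.\<close>

definition lipschitz_derivative_on ::
    "('a::real_normed_vector \<Rightarrow> 'b::real_normed_vector) \<Rightarrow> ('a \<Rightarrow> 'a \<Rightarrow>\<^sub>L 'b) \<Rightarrow> 'a \<Rightarrow> real \<Rightarrow> real \<Rightarrow> bool" where
  "lipschitz_derivative_on f f' x R K \<longleftrightarrow> 0 < R \<and>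
     (\<forall>y\<in>ball x R. (f has_derivative blinfun_apply (f' y)) (at y) \<and> norm (f' y) \<le> K) \<and>
     (\<forall>y\<in>ball x R. \<forall>z\<in>ball x R. norm (f' y - f' z) \<le> K * norm (y - z))"

text \<open>Mean value inequality for \<open>f - L\<close>. The choice of \<open>L\<close> yields
  the later estimates: 0 for the Lipschitz bound, the derivative at a centre for strict
  differentiability, the derivative at an end point for the Taylor bound.\<close>

lemma blinfun_mean_value:
  fixes f :: "'a::real_normed_vector \<Rightarrow> 'b::real_normed_vector"
  assumes "convex S" "\<And>y. y \<in> S \<Longrightarrow> (f has_derivative blinfun_apply (f' y)) (at y)"
    and "\<And>y. y \<in> S \<Longrightarrow> norm (f' y - L) \<le> B" "a \<in> S" "b \<in> S"
  shows "norm (f a - f b - blinfun_apply L (a - b)) \<le> B * norm (a - b)"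
proof -
  have "norm ((\<lambda>y. f y - blinfun_apply L y) a - (\<lambda>y. f y - blinfun_apply L y) b) \<le> B * norm (a - b)"
  proof (rule differentiable_bound[OF assms(1) _ _ assms(4,5)])
    fix y assume y: "y \<in> S"
    have "((\<lambda>y. f y - blinfun_apply L y) has_derivative blinfun_apply (f' y - L)) (at y)"
      using assms(2)[OF y]
      by (auto intro!: derivative_eq_intros bounded_linear_imp_has_derivative blinfun.bounded_linear_right
            simp: blinfun.diff_left)
    then show "((\<lambda>y. f y - blinfun_apply L y) has_derivative blinfun_apply (f' y - L)) (at y within S)"
      using has_derivative_at_withinI by blast
    show "onorm (blinfun_apply (f' y - L)) \<le> B"
      using assms(3)[OF y] by (simp add: norm_blinfun.rep_eq)
  qed
  then show ?thesis by (simp add: blinfun.diff_right algebra_simps)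
qed

text \<open>Continuity of \<open>f''\<close> at \<open>x\<close> bounds it by
  \<open>norm (f'' x) + 1\<close> on a ball; the mean value inequality for \<open>f'\<close> does
  the rest.\<close>

lemma C2_around_lipschitz_derivative:
  fixes f :: "'a::euclidean_space \<Rightarrow> 'b::real_normed_vector"
  assumes "C2_around f x"
  obtains f' R K where "lipschitz_derivative_on f f' x R K"
proof -
  obtain U f' f'' where U: "open U" "x \<in> U"
    and d1: "\<forall>y\<in>U. (f has_derivative blinfun_apply (f' y)) (at y)"
    and d2: "\<forall>y\<in>U. (f' has_derivative blinfun_apply (f'' y)) (at y)"
    and cont: "continuous_on U f''"
    using assms unfolding C2_around_def by blast
  have "isCont f'' x" using cont U continuous_on_eq_continuous_at by blast
  then have "(f'' \<longlongrightarrow> f'' x) (nhds x)"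
    by (simp add: isCont_def tendsto_at_iff_tendsto_nhds)
  then have "\<forall>\<^sub>F y in nhds x. dist (f'' y) (f'' x) < 1"
    by (rule tendstoD) simp
  moreover have "\<forall>\<^sub>F y in nhds x. y \<in> U" using U by (simp add: eventually_nhds_in_open)
  ultimately have "\<forall>\<^sub>F y in nhds x. dist (f'' y) (f'' x) < 1 \<and> y \<in> U"
    by (rule eventually_conj)
  then obtain R where R: "R > 0" "\<And>y. dist y x < R \<Longrightarrow> dist (f'' y) (f'' x) < 1 \<and> y \<in> U"
    by (auto simp: eventually_nhds_metric)
  have lip: "norm (f' y - f' z) \<le> (norm (f'' x) + 1) * norm (y - z)"
    if "y \<in> ball x R" "z \<in> ball x R" for y z
  proof (rule differentiable_bound[OF convex_ball[of x R] _ _ that])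
    fix w assume w: "w \<in> ball x R"
    then show "(f' has_derivative blinfun_apply (f'' w)) (at w within ball x R)"
      using R(2) d2 has_derivative_at_withinI by (metis dist_commute mem_ball)
    show "onorm (blinfun_apply (f'' w)) \<le> norm (f'' x) + 1"
      using R(2)[of w] w norm_triangle_ineq2[of "f'' w" "f'' x"]
      by (auto simp: norm_blinfun.rep_eq[symmetric] dist_norm norm_minus_commute)
  qed
  \<comment> \<open>The first entry is the Lipschitz modulus of \<open>f'\<close>, the second bounds
    \<open>f'\<close> itself on the ball.\<close>
  define K where "K = max (norm (f'' x) + 1) (norm (f' x) + (norm (f'' x) + 1) * R)"
  have "norm (f' y) \<le> K" if y: "y \<in> ball x R" for y
  proof -
    have "norm (f' y) \<le> norm (f' x) + norm (f' y - f' x)"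
      using norm_triangle_sub by blast
    also have "\<dots> \<le> norm (f' x) + (norm (f'' x) + 1) * norm (y - x)"
      using lip[OF y] R by auto
    also have "\<dots> \<le> norm (f' x) + (norm (f'' x) + 1) * R"
      using y by (auto simp: dist_norm norm_minus_commute intro!: mult_left_mono)
    finally show ?thesis by (simp add: K_def)
  qed
  moreover have "norm (f' y - f' z) \<le> K * norm (y - z)" if "y \<in> ball x R" "z \<in> ball x R" for y z
    by (rule order_trans[OF lip[OF that]], rule mult_right_mono) (auto simp: K_def)
  ultimately have "lipschitz_derivative_on f f' x R K"
    using R d1 by (auto simp: lipschitz_derivative_on_def dist_commute)
  then show ?thesis by (rule that)
qed

lemma lipschitz_derivative_on_mono:
  assumes "lipschitz_derivative_on f f' x R K" "0 < R'" "R' \<le> R" "K \<le> K'"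
  shows "lipschitz_derivative_on f f' x R' K'"
  unfolding lipschitz_derivative_on_def
proof (intro conjI ballI)
  fix y z assume yz: "y \<in> ball x R'" "z \<in> ball x R'"
  then have yz': "y \<in> ball x R" "z \<in> ball x R" using assms(3) by auto
  then have "norm (f' y - f' z) \<le> K * norm (y - z)"
    using assms(1) unfolding lipschitz_derivative_on_def by blast
  also have "\<dots> \<le> K' * norm (y - z)" using assms(4) by (intro mult_right_mono) auto
  finally show "norm (f' y - f' z) \<le> K' * norm (y - z)" .
  show "(f has_derivative blinfun_apply (f' y)) (at y)" "norm (f' y) \<le> K'"
    using assms(1,4) yz' unfolding lipschitz_derivative_on_def by (blast, meson order_trans)
qed (fact assms(2))

context
  fixes f :: "'a::real_normed_vector \<Rightarrow> 'b::real_normed_vector" and f' x R K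
  assumes L: "lipschitz_derivative_on f f' x R K"
begin

lemma lipschitz_derivative_pos: "0 < R"
  using L unfolding lipschitz_derivative_on_def by blast

lemma lipschitz_derivative_has_derivative:
  "y \<in> ball x R \<Longrightarrow> (f has_derivative blinfun_apply (f' y)) (at y)"
  using L unfolding lipschitz_derivative_on_def by blast

lemma lipschitz_derivative_nabla: "y \<in> ball x R \<Longrightarrow> \<nabla> f y = blinfun_apply (f' y)"
  using lipschitz_derivative_has_derivative frechet_derivative_at by metis

lemma lipschitz_derivative_norm: "y \<in> ball x R \<Longrightarrow> norm (f' y) \<le> K"
  using L unfolding lipschitz_derivative_on_def by blast

lemma lipschitz_derivative_nonneg: "0 \<le> K"
  using order_trans[OF norm_ge_zero lipschitz_derivative_norm[of x]] lipschitz_derivative_pos by simp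

lemma lipschitz_derivative_apply: "y \<in> ball x R \<Longrightarrow> norm (f' y t) \<le> K * norm t"
  by (rule order_trans[OF norm_blinfun mult_right_mono[OF lipschitz_derivative_norm]]) auto

lemma lipschitz_derivative_diff:
  "y \<in> ball x R \<Longrightarrow> z \<in> ball x R \<Longrightarrow> norm (f' y - f' z) \<le> K * norm (y - z)"
  using L unfolding lipschitz_derivative_on_def by blast

lemma lipschitz_derivative_diff_apply:
  "y \<in> ball x R \<Longrightarrow> z \<in> ball x R \<Longrightarrow> norm (f' y t - f' z t) \<le> K * norm (y - z) * norm t"
  unfolding blinfun.diff_left[symmetric]
  by (rule order_trans[OF norm_blinfun mult_right_mono[OF lipschitz_derivative_diff]]) auto

lemma lipschitz_derivative_lipschitz:
  assumes "a \<in> ball x R" "b \<in> ball x R"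
  shows "norm (f a - f b) \<le> K * norm (a - b)"
  using blinfun_mean_value[OF convex_ball lipschitz_derivative_has_derivative, where L=0 and B=K and a=a and b=b]
    assms lipschitz_derivative_norm by simp

lemma lipschitz_derivative_strict:
  assumes "a \<in> cball p s" "b \<in> cball p s" "cball p s \<subseteq> ball x R" "p \<in> ball x R"
  shows "norm (f a - f b - f' p (a - b)) \<le> K * s * norm (a - b)"
proof (rule blinfun_mean_value[of "cball p s"])
  fix y assume y: "y \<in> cball p s"
  show "(f has_derivative blinfun_apply (f' y)) (at y)"
    using y assms lipschitz_derivative_has_derivative by blast
  have "norm (f' y - f' p) \<le> K * norm (y - p)"
    using lipschitz_derivative_diff y assms by blast
  also have "\<dots> \<le> K * s"
    using y lipschitz_derivative_nonneg by (auto simp: dist_norm norm_minus_commute intro!: mult_left_mono)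
  finally show "norm (f' y - f' p) \<le> K * s" .
qed (use assms in auto)

lemma lipschitz_derivative_taylor:
  assumes "a \<in> ball x R" "b \<in> ball x R"
  shows "norm (f a - f b - f' b (a - b)) \<le> K * (norm (a - b))\<^sup>2"
proof -
  have sub: "closed_segment b a \<subseteq> ball x R"
    using assms by (simp add: closed_segment_subset)
  have "norm (f a - f b - f' b (a - b)) \<le> K * norm (a - b) * norm (a - b)"
  proof (rule blinfun_mean_value[of "closed_segment b a"])
    fix y assume y: "y \<in> closed_segment b a"
    show "(f has_derivative blinfun_apply (f' y)) (at y)"
      using y sub lipschitz_derivative_has_derivative by blast
    have "norm (f' y - f' b) \<le> K * norm (y - b)"
      using lipschitz_derivative_diff y sub assms by blast
    also have "\<dots> \<le> K * norm (a - b)"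
      using segment_bound1[OF y] lipschitz_derivative_nonneg by (auto intro!: mult_left_mono)
    finally show "norm (f' y - f' b) \<le> K * norm (a - b)" .
  qed auto
  then show ?thesis by (simp add: power2_eq_square mult.assoc)
qed

end

section \<open>Adjoints and bounded right inverses\<close>

lemma norm_adjoint_le:
  fixes L :: "'a::euclidean_space \<Rightarrow>\<^sub>L 'b::euclidean_space"
  shows "norm (adjoint (blinfun_apply L) y) \<le> norm L * norm y"
proof -
  have l: "linear (blinfun_apply L)" by (simp add: bounded_linear.linear[OF blinfun.bounded_linear_right])
  let ?a = "adjoint (blinfun_apply L) y"
  have "?a \<bullet> ?a = L ?a \<bullet> y" by (rule adjoint_works[OF l])
  also have "\<dots> \<le> norm (L ?a) * norm y" by (rule norm_cauchy_schwarz)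
  also have "\<dots> \<le> norm L * norm ?a * norm y" by (intro mult_right_mono norm_blinfun) auto
  finally have "norm ?a * norm ?a \<le> norm ?a * (norm L * norm y)"
    by (simp add: power2_norm_eq_inner[symmetric] power2_eq_square algebra_simps)
  then show ?thesis by (cases "?a = 0") auto
qed

lemma adjoint_blinfun_diff:
  fixes L L' :: "'a::euclidean_space \<Rightarrow>\<^sub>L 'b::euclidean_space"
  shows "adjoint (blinfun_apply (L - L')) y = adjoint (blinfun_apply L) y - adjoint (blinfun_apply L') y"
proof -
  have l: "linear (blinfun_apply L)" for L :: "'a \<Rightarrow>\<^sub>L 'b" by (simp add: bounded_linear.linear[OF blinfun.bounded_linear_right])
  have "adjoint (blinfun_apply (L - L')) = (\<lambda>y. adjoint (blinfun_apply L) y - adjoint (blinfun_apply L') y)"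
    by (rule adjoint_unique) (simp add: adjoint_works[OF l] inner_diff_right inner_diff_left blinfun.diff_left)
  then show ?thesis by simp
qed

text \<open>In finite dimension the range of the adjoint is the orthogonal complement of the kernel.
  In this form a vector orthogonal to all tangent directions is at once a multiplier.\<close>

lemma range_adjoint_iff:
  fixes L :: "'a::euclidean_space \<Rightarrow> 'b::euclidean_space"
  assumes "linear L"
  shows "q \<in> range (adjoint L) \<longleftrightarrow> (\<forall>t. L t = 0 \<longrightarrow> q \<bullet> t = 0)"
proof -
  have "subspace (range (adjoint L))"
    by (simp add: adjoint_linear assms linear_subspace_image)
  then have "range (adjoint L) = (L -` {0})\<^sup>\<bottom>"
    by (simp add: ker_orthogonal_comp_adjoint[OF assms] orthogonal_comp_self)
  then show ?thesis
    by (auto simp: orthogonal_comp_def orthogonal_def inner_commute)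
qed

lemma linear_right_inverse_on:
  fixes L :: "'a::euclidean_space \<Rightarrow> 'b::euclidean_space"
  assumes "linear L" "subspace V"
  obtains A \<alpha> where "linear A" "range A \<subseteq> V" "\<And>y. y \<in> L ` V \<Longrightarrow> L (A y) = y"
    "0 < \<alpha>" "\<And>y. norm (A y) \<le> \<alpha> * norm y"
proof -
  obtain A where A: "range A \<subseteq> V" "linear A" "\<forall>v\<in>L ` V. L (A v) = v"
    using linear_exists_right_inverse_on[OF assms] by blast
  obtain \<alpha> where "0 < \<alpha>" "\<And>y. norm (A y) \<le> \<alpha> * norm y"
    using linear_bounded_pos[OF A(2)] by (metis mult.commute)
  with A that show ?thesis by blast
qed

section \<open>Correction to a zero, and Lagrange multipliers\<close>

text \<open>Simplified Newton iteration with the derivative frozen at \<open>L\<close>: the unknown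
  \<open>y\<close> lives in \<open>Y\<close>, where \<open>L\<close> undoes \<open>A\<close>, so
  \<open>y - G (p + A y)\<close> contracts by 1/2. The correction \<open>A y\<close> has length at
  most \<open>2 * \<alpha> * norm (G p)\<close>, the distance estimate behind all feasible
  corrections.\<close>

lemma solve_near:
  fixes G :: "'a::euclidean_space \<Rightarrow> 'b::euclidean_space"
  assumes Y: "subspace Y" and A: "linear A" "\<And>y. y \<in> Y \<Longrightarrow> L (A y) = y" "\<And>y. norm (A y) \<le> \<alpha> * norm y"
    and \<alpha>: "0 < \<alpha>"
    and GY: "range G \<subseteq> Y"
    and strict: "\<And>a b. a \<in> cball p R \<Longrightarrow> b \<in> cball p R \<Longrightarrow> norm (G a - G b - L (a - b)) \<le> \<eta> * norm (a - b)"
    and small: "0 \<le> \<eta>" "\<eta> * \<alpha> \<le> 1/2" "2 * \<alpha> * norm (G p) \<le> R"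
  obtains y where "y \<in> Y" "norm y \<le> 2 * norm (G p)" "G (p + A y) = 0"
proof -
  interpret A: linear A by fact
  \<comment> \<open>The map \<open>T\<close> moves 0 by \<open>norm (G p)\<close>; with contraction
    factor 1/2, a ball of twice that radius is mapped into itself.\<close>
  define S where "S = Y \<inter> cball 0 (2 * norm (G p))"
  define T where "T y = y - G (p + A y)" for y
  have G': "G z \<in> Y" for z using GY by auto
  have inR: "p + A y \<in> cball p R" if "y \<in> S" for y
  proof -
    have "norm (A y) \<le> \<alpha> * norm y" by (rule A)
    also have "\<dots> \<le> \<alpha> * (2 * norm (G p))" using that \<alpha> by (auto simp: S_def intro!: mult_left_mono)
    also have "\<dots> \<le> R" using small by (simp add: mult_ac)
    finally show ?thesis by (simp add: dist_norm)
  qed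
  have contr: "norm (T y - T z) \<le> 1/2 * norm (y - z)" if "y \<in> S" "z \<in> S" for y z
  proof -
    have "y - z \<in> Y" using that Y by (auto simp: S_def subspace_diff)
    then have L: "L (A (y - z)) = y - z" by (rule A)
    have "norm (T y - T z) = norm (G (p + A y) - G (p + A z) - L (A (y - z)))"
      unfolding T_def L by (simp add: norm_minus_commute algebra_simps)
    also have "\<dots> \<le> \<eta> * norm (A (y - z))"
      using strict[OF inR[OF that(1)] inR[OF that(2)]] by (simp add: A.diff)
    also have "\<dots> \<le> \<eta> * (\<alpha> * norm (y - z))" by (intro mult_left_mono A small)
    also have "\<dots> = (\<eta> * \<alpha>) * norm (y - z)" by simp
    also have "\<dots> \<le> 1/2 * norm (y - z)" by (intro mult_right_mono small) auto
    finally show ?thesis .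
  qed
  have 0: "0 \<in> S" using Y by (simp add: S_def subspace_0)
  have "T y \<in> S" if y: "y \<in> S" for y
  proof -
    have "norm (T y) \<le> norm (T y - T 0) + norm (T 0)" using norm_triangle_sub[of "T y" "T 0"] by simp
    also have "\<dots> \<le> 1/2 * norm y + norm (G p)"
      using contr[OF y 0] by (simp add: T_def)
    also have "\<dots> \<le> 2 * norm (G p)" using y by (simp add: S_def)
    finally show ?thesis using y Y G' by (auto simp: S_def T_def subspace_diff)
  qed
  moreover have "complete S"
    unfolding S_def using Y by (simp add: complete_eq_closed closed_Int closed_subspace)
  ultimately obtain y where "y \<in> S" "T y = y"
    using Banach_fix[of S "1/2" T] 0 contr by (auto simp: dist_norm)
  then show ?thesis using that by (auto simp: S_def T_def)
qed

lemma eventually_at_right_curve: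
  fixes z t :: "'e::euclidean_space"
  assumes "open U" "z \<in> U"
  shows "\<forall>\<^sub>F \<tau> in at_right (0::real). z + \<tau> *\<^sub>R t \<in> U"
proof -
  have "((\<lambda>\<tau>. z + \<tau> *\<^sub>R t) \<longlongrightarrow> z + 0 *\<^sub>R t) (at_right (0::real))"
    by (intro tendsto_intros)
  then show ?thesis using assms by (auto dest: topological_tendstoD)
qed

text \<open>The curves in \<open>S\<close> tangent to \<open>null_space W\<close> replace a constraint qualification.\<close>

lemma multiplier_exists:
  fixes \<phi> :: "'a::euclidean_space \<Rightarrow> real" and W :: "'a \<Rightarrow> 'b::euclidean_space"
  assumes der: "(\<phi> has_derivative (\<lambda>t. q \<bullet> t)) (at d)"
    and min: "\<forall>\<^sub>F z in nhds d. z \<in> S \<longrightarrow> \<phi> d - \<rho> * (norm (z - d))\<^sup>2 \<le> \<phi> z"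
    and W: "linear W"
    and curve: "\<And>t. W t = 0 \<Longrightarrow> \<exists>C. \<forall>\<^sub>F \<tau> in at_right 0. \<exists>z\<in>S. norm (z - (d + \<tau> *\<^sub>R t)) \<le> C * \<tau>\<^sup>2"
  shows "q \<in> range (adjoint W)"
proof -
  have ge: "0 \<le> q \<bullet> t" if t: "W t = 0" for t
  proof -
    obtain C where C: "\<forall>\<^sub>F \<tau> in at_right 0. \<exists>z\<in>S. norm (z - (d + \<tau> *\<^sub>R t)) \<le> C * \<tau>\<^sup>2"
      using curve[OF t] by blast
    define z where "z \<tau> = (SOME z. z \<in> S \<and> norm (z - (d + \<tau> *\<^sub>R t)) \<le> C * \<tau>\<^sup>2)" for \<tau>
    have z: "\<forall>\<^sub>F \<tau> in at_right 0. z \<tau> \<in> S \<and> norm (z \<tau> - (d + \<tau> *\<^sub>R t)) \<le> C * \<tau>\<^sup>2"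
      using C by eventually_elim (unfold z_def, rule someI_ex, blast)
    \<comment> \<open>The rescaled error of the curve:
      \<open>z \<tau> = d + \<tau> *\<^sub>R (t + e \<tau>)\<close>. The quadratic bound on the
      curve makes \<open>e\<close> tend to 0.\<close>
    define e where "e \<tau> = (1/\<tau>) *\<^sub>R (z \<tau> - d) - t" for \<tau>
    have e: "(e \<longlongrightarrow> 0) (at_right 0)"
    proof (rule Lim_null_comparison)
      show "\<forall>\<^sub>F \<tau> in at_right 0. norm (e \<tau>) \<le> C * \<tau>"
        using z eventually_at_right_less[of "0::real"]
      proof eventually_elim
        case (elim \<tau>)
        have "e \<tau> = (1/\<tau>) *\<^sub>R (z \<tau> - (d + \<tau> *\<^sub>R t))"
          using elim by (simp add: e_def algebra_simps)
        then have "norm (e \<tau>) = norm (z \<tau> - (d + \<tau> *\<^sub>R t)) / \<tau>" using elim by simp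
        also have "\<dots> \<le> C * \<tau>" using elim by (simp add: field_simps power2_eq_square)
        finally show ?case .
      qed
      show "((\<lambda>\<tau>. C * \<tau>) \<longlongrightarrow> 0) (at_right 0)" by (auto intro!: tendsto_eq_intros)
    qed
    have zeq: "\<forall>\<^sub>F \<tau> in at_right 0. z \<tau> = d + \<tau> *\<^sub>R (t + e \<tau>)"
      using eventually_at_right_less[of "0::real"] by eventually_elim (simp add: e_def)
    have "((\<lambda>\<tau>. d + \<tau> *\<^sub>R (t + e \<tau>)) \<longlongrightarrow> d) (at_right 0)"
      using e by (auto intro!: tendsto_eq_intros)
    then have zd: "(z \<longlongrightarrow> d) (at_right 0)"
      using zeq by (simp add: tendsto_cong)
    obtain r where r: "\<And>y. \<phi> y = \<phi> d + q \<bullet> (y - d) + r y * norm (y - d)" "(r \<longlongrightarrow> 0) (at d)" "r d = 0"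
    proof
      define r where "r y = (\<phi> y - \<phi> d - q \<bullet> (y - d)) / norm (y - d)" for y
      show "\<phi> y = \<phi> d + q \<bullet> (y - d) + r y * norm (y - d)" for y
        by (cases "y = d") (auto simp: r_def)
      show "(r \<longlongrightarrow> 0) (at d)"
        using der unfolding has_derivative_at_within r_def by (simp add: divide_inverse mult.commute diff_diff_eq)
      show "r d = 0" by (simp add: r_def)
    qed
    have rz: "((\<lambda>\<tau>. r (z \<tau>)) \<longlongrightarrow> 0) (at_right 0)"
    proof -
      have "(r \<longlongrightarrow> r d) (nhds d)" using tendsto_at_iff_tendsto_nhds[of r d] r(2) unfolding r(3) by blast
      then show ?thesis using zd r(3) by (simp add: filterlim_compose[OF _ zd])
    qed
    have minz: "\<forall>\<^sub>F \<tau> in at_right 0. z \<tau> \<in> S \<longrightarrow> \<phi> d - \<rho> * (norm (z \<tau> - d))\<^sup>2 \<le> \<phi> (z \<tau>)"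
      using filterlim_iff[THEN iffD1, rule_format, OF zd min] .
    \<comment> \<open>After division by \<tau> the slack with \<rho> still carries a factor \<tau>,
      so it vanishes in the limit together with the remainder \<open>r\<close>.\<close>
    have "\<forall>\<^sub>F \<tau> in at_right 0. 0 \<le> q \<bullet> (t + e \<tau>) + r (z \<tau>) * norm (t + e \<tau>) + \<bar>\<rho>\<bar> * \<tau> * (norm (t + e \<tau>))\<^sup>2"
      using minz z zeq eventually_at_right_less[of "0::real"]
    proof eventually_elim
      case (elim \<tau>)
      have zz: "z \<tau> - d = \<tau> *\<^sub>R (t + e \<tau>)" using elim by simp
      have "0 \<le> q \<bullet> (z \<tau> - d) + r (z \<tau>) * norm (z \<tau> - d) + \<rho> * (norm (z \<tau> - d))\<^sup>2"
        using elim r(1)[of "z \<tau>"] by auto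
      also have "\<dots> \<le> q \<bullet> (z \<tau> - d) + r (z \<tau>) * norm (z \<tau> - d) + \<bar>\<rho>\<bar> * (norm (z \<tau> - d))\<^sup>2"
        by (auto intro!: mult_right_mono)
      also have "\<dots> = \<tau> * (q \<bullet> (t + e \<tau>) + r (z \<tau>) * norm (t + e \<tau>) + \<bar>\<rho>\<bar> * \<tau> * (norm (t + e \<tau>))\<^sup>2)"
        unfolding zz norm_scaleR inner_scaleR_right using elim by (simp add: algebra_simps power2_eq_square)
      finally show ?case using elim by (simp add: zero_le_mult_iff)
    qed
    moreover have "((\<lambda>\<tau>. q \<bullet> (t + e \<tau>) + r (z \<tau>) * norm (t + e \<tau>) + \<bar>\<rho>\<bar> * \<tau> * (norm (t + e \<tau>))\<^sup>2)
        \<longlongrightarrow> q \<bullet> (t + 0) + 0 * norm (t + 0) + \<bar>\<rho>\<bar> * 0 * (norm (t + 0))\<^sup>2) (at_right 0)"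
      by (intro tendsto_intros e rz)
    ultimately have "0 \<le> q \<bullet> (t + 0) + 0 * norm (t + 0) + \<bar>\<rho>\<bar> * 0 * (norm (t + 0))\<^sup>2"
      by (intro tendsto_lowerbound[where F="at_right (0::real)"]) auto
    then show ?thesis by simp
  qed
  \<comment> \<open>The kernel is symmetric, so the one-sided inequality at \<open>t\<close> and
    \<open>- t\<close> gives orthogonality.\<close>
  have "q \<bullet> t = 0" if "W t = 0" for t
    using ge[OF that] ge[of "- t"] that linear_neg[OF W, of t] by simp
  then show ?thesis by (simp add: range_adjoint_iff[OF W])
qed

lemma mem_ball_norm: "z \<in> ball p r \<longleftrightarrow> norm (z - p) < r"
  by (simp add: dist_norm norm_minus_commute)

lemma exists_small:
  fixes b e C :: real
  assumes "0 < b" "0 < e"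
  obtains s where "0 < s" "s < b" "C * s < e"
proof
  \<comment> \<open>The halves make the inequalities strict; \<open>\<bar>C\<bar> + 1\<close> keeps
    the denominator positive for every \<open>C\<close>.\<close>
  let ?s = "min (b / 2) (e / (2 * (\<bar>C\<bar> + 1)))"
  show "0 < ?s" "?s < b" using assms by auto
  have "C * ?s \<le> (\<bar>C\<bar> + 1) * ?s" using assms by (intro mult_right_mono) auto
  also have "\<dots> \<le> (\<bar>C\<bar> + 1) * (e / (2 * (\<bar>C\<bar> + 1)))" by (intro mult_left_mono) auto
  also have "\<dots> = e / 2" by (simp add: field_simps)
  also have "\<dots> < e" using assms by simp
  finally show "C * ?s < e" .
qed

lemma linear_blinfun_apply: "linear (blinfun_apply f)"
  by (rule bounded_linear.linear[OF blinfun.bounded_linear_right])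

lemma adjoint_blinfun_inner:
  fixes f :: "'a::euclidean_space \<Rightarrow>\<^sub>L 'b::euclidean_space"
  shows "adjoint (blinfun_apply f) y \<bullet> t = y \<bullet> f t"
  using adjoint_works[OF linear_blinfun_apply, of t f y] by (simp add: inner_commute)

lemma adjoint_blinfun_simps:
  fixes f :: "'a::euclidean_space \<Rightarrow>\<^sub>L 'b::euclidean_space"
  shows "adjoint (blinfun_apply f) (y + z) = adjoint (blinfun_apply f) y + adjoint (blinfun_apply f) z"
    and "adjoint (blinfun_apply f) (y - z) = adjoint (blinfun_apply f) y - adjoint (blinfun_apply f) z"
    and "adjoint (blinfun_apply f) (- z) = - adjoint (blinfun_apply f) z"
    and "adjoint (blinfun_apply f) 0 = 0"
  using adjoint_linear[OF linear_blinfun_apply, of f]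
  by (simp_all add: linear_add linear_diff linear_neg linear_0)

lemma tendsto_of_dist_less_inverse:
  assumes "\<And>k. dist (z k) l < inverse (real (Suc k))"
  shows "z \<longlonglongrightarrow> l"
proof -
  have "(\<lambda>k. dist (z k) l) \<longlonglongrightarrow> 0"
    by (rule Lim_null_comparison[OF _ LIMSEQ_inverse_real_of_nat])
      (use assms in \<open>auto intro!: always_eventually simp: less_imp_le\<close>)
  then show ?thesis using tendsto_dist_iff by blast
qed

text \<open>If \<open>e \<le> t\<close>, the leading 1 suffices. Otherwise
  \<open>t * t \<le> t * e\<close>, so one factor \<open>e\<close> cancels, and the terms without a
  factor \<mu> acquire one through \<open>1 \<le> \<mu> / \<eta>\<close>. The point is that the
  resulting constant does not contain \<mu>.\<close>

lemma quadratic_growth_bound: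
  fixes t e :: real
  assumes nonneg: "0 \<le> t" "0 \<le> e" "0 \<le> A" "0 \<le> V" "0 \<le> B" and \<eta>: "0 < \<eta>" "\<eta> \<le> \<mu>"
    and le: "\<mu> / 4 * e\<^sup>2 \<le> A * t\<^sup>2 + V * t * e + \<mu> * B * t\<^sup>2"
  shows "e \<le> (1 + 4 * (A / \<eta> + B) + 4 * V / \<eta>) * t"
proof (cases "e \<le> t")
  case True
  have "e \<le> 1 * t" using True by simp
  also have "\<dots> \<le> (1 + 4 * (A / \<eta> + B) + 4 * V / \<eta>) * t"
    using nonneg \<eta> by (intro mult_right_mono) auto
  finally show ?thesis .
next
  case False
  then have te: "t * t \<le> t * e" "0 < e" using nonneg by (auto intro: mult_left_mono)
  have \<mu>: "0 < \<mu>" using \<eta> by simp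
  have "\<mu> * (e * e) \<le> 4 * A * (t * t) + 4 * V * (t * e) + \<mu> * (4 * B * (t * t))"
    using le by (simp add: power2_eq_square algebra_simps)
  also have "\<dots> \<le> 4 * A * (t * e) + 4 * V * (t * e) + \<mu> * (4 * B * (t * e))"
    using te(1) nonneg \<mu> by (intro add_mono mult_left_mono[OF te(1)] mult_left_mono[OF mult_left_mono[OF te(1)]]) auto
  also have "\<dots> \<le> \<mu> * (4 * (A / \<eta>) * (t * e)) + \<mu> * (4 * V / \<eta> * (t * e)) + \<mu> * (4 * B * (t * e))"
  proof (intro add_mono order_refl)
    have "A * \<eta> \<le> \<mu> * A" "V * \<eta> \<le> \<mu> * V" using \<eta> nonneg by (auto simp: mult.commute intro: mult_left_mono)
    then have "4 * A \<le> \<mu> * (4 * (A / \<eta>))" "4 * V \<le> \<mu> * (4 * V / \<eta>)"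
      using \<eta> by (auto simp: field_simps)
    then show "4 * A * (t * e) \<le> \<mu> * (4 * (A / \<eta>) * (t * e))" "4 * V * (t * e) \<le> \<mu> * (4 * V / \<eta> * (t * e))"
      using nonneg by (auto simp only: mult.assoc[symmetric] intro!: mult_right_mono)
  qed
  also have "\<dots> = \<mu> * ((4 * (A / \<eta> + B) + 4 * V / \<eta>) * t * e)" by (simp add: algebra_simps)
  finally have "e \<le> (4 * (A / \<eta> + B) + 4 * V / \<eta>) * t" using \<mu> te(2) by simp
  then show ?thesis using nonneg by (simp add: algebra_simps)
qed

lemma eventually_near_ereal:
  assumes "(f \<longlongrightarrow> ereal a) F" "0 < e"
  shows "\<forall>\<^sub>F r in F. \<bar>f r - ereal a\<bar> < ereal e"
proof -
  have "\<forall>\<^sub>F r in F. ereal (a - e) < f r" "\<forall>\<^sub>F r in F. f r < ereal (a + e)"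
    using assms by (auto intro: order_tendstoD)
  then show ?thesis
  proof eventually_elim
    case (elim r)
    then show ?case by (cases "f r") auto
  qed
qed

section \<open>Subgradients\<close>

text \<open>The inequality leaves room for a small ball touching the epigraph from outside at
  \<open>(z, \<alpha>)\<close>: for short steps along \<open>w = (v, -1)\<close> the base point is a
  nearest point of the epigraph. Hence \<open>w\<close> is a proximal normal.\<close>

lemma subdifferential_proximal:
  fixes h :: "'a::euclidean_space \<Rightarrow> ereal"
  assumes hz: "h z = ereal \<alpha>" and \<delta>: "\<delta> > 0"
    and ineq: "\<And>y t. y \<in> ball z \<delta> \<Longrightarrow> h y \<le> ereal t \<Longrightarrow> \<alpha> + v \<bullet> (y - z) - \<rho> / 2 * (norm (y - z))\<^sup>2 \<le> t"
  shows "v \<in> subdifferential h z"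
proof -
  define w where "w = (v, -1 :: real)"
  define s where "s = (z, \<alpha>)"
  \<comment> \<open>The first bound gives \<open>l * \<rho> \<le> 1\<close>, so the square of
    \<open>norm (a - z)\<close> outweighs the quadratic loss; the second gives
    \<open>2 * (l * norm w) \<le> \<delta>\<close>, so epigraph points over the outside of the ball
    are no closer than \<open>s\<close>.\<close>
  define m where "m = min (1 / (\<bar>\<rho>\<bar> + 1)) (\<delta> / (2 * norm w + 1))"
  have nw: "0 < 2 * norm w + 1" using norm_ge_zero[of w] by linarith
  have m: "m > 0" using \<delta> divide_pos_pos[OF \<delta> nw] unfolding m_def by (simp add: add_nonneg_pos)
  have closest: "dist (s + l *\<^sub>R w) s \<le> dist (s + l *\<^sub>R w) y" if l: "0 < l" "l \<le> m" and y: "y \<in> epi h" for l y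
  proof -
    obtain a t where y': "y = (a, t)" "h a \<le> ereal t" using y by (auto simp: epi_def)
    show ?thesis
    proof (cases "a \<in> ball z \<delta>")
      case True
      have "l * \<bar>\<rho>\<bar> \<le> l * (\<bar>\<rho>\<bar> + 1)" using l by simp
      also have "\<dots> \<le> 1 / (\<bar>\<rho>\<bar> + 1) * (\<bar>\<rho>\<bar> + 1)"
        using l by (intro mult_right_mono) (auto simp: m_def)
      also have "\<dots> = 1" by (simp add: add_nonneg_eq_0_iff)
      finally have "l * \<bar>\<rho>\<bar> \<le> 1" .
      then have "l * \<rho> \<le> 1" using l abs_le_D1[of "l * \<rho>" 1] by (simp add: abs_mult)
      then have "l * \<rho> * (norm (a - z))\<^sup>2 \<le> 1 * (norm (a - z))\<^sup>2" by (intro mult_right_mono) auto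
      moreover have "2 * l * (\<alpha> + v \<bullet> (a - z) - \<rho> / 2 * (norm (a - z))\<^sup>2) \<le> 2 * l * t"
        using ineq[OF True y'(2)] l by (intro mult_left_mono) auto
      then have "2 * l * (v \<bullet> (a - z)) - l * \<rho> * (norm (a - z))\<^sup>2 \<le> 2 * l * (t - \<alpha>)"
        by (simp add: algebra_simps)
      ultimately have "0 \<le> (norm (a - z))\<^sup>2 + (t - \<alpha>)\<^sup>2 - 2 * l * (v \<bullet> (a - z) - (t - \<alpha>))"
        unfolding right_diff_distrib using zero_le_power2[of "t - \<alpha>"] by linarith
      also have "\<dots> = (norm (y - s))\<^sup>2 - 2 * l * (w \<bullet> (y - s))"
        unfolding y' s_def w_def by (simp add: norm_Pair)
      also have "\<dots> = (dist (s + l *\<^sub>R w) y)\<^sup>2 - (dist (s + l *\<^sub>R w) s)\<^sup>2"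
      proof -
        have e: "s + l *\<^sub>R w - y = l *\<^sub>R w - (y - s)" by simp
        have "(norm (l *\<^sub>R w - q))\<^sup>2 = (norm (l *\<^sub>R w))\<^sup>2 - 2 * l * (w \<bullet> q) + (norm q)\<^sup>2" for q
          unfolding power2_norm_eq_inner by (simp add: inner_diff_left inner_diff_right inner_commute)
        then show ?thesis unfolding dist_norm e by simp
      qed
      finally show ?thesis by (simp add: abs_le_square_iff[symmetric])
    next
      case False
      have "l \<le> \<delta> / (2 * norm w + 1)" using l unfolding m_def by linarith
      then have "l * (2 * norm w + 1) \<le> \<delta>" by (simp only: pos_le_divide_eq[OF nw])
      then have "2 * (l * norm w) \<le> \<delta>" using l by (simp add: distrib_left)
      moreover have "\<delta> \<le> dist s y"
        using False dist_fst_le[of s y] by (simp add: s_def y')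
      moreover have "dist s y \<le> dist (s + l *\<^sub>R w) s + dist (s + l *\<^sub>R w) y"
        by (metis dist_commute dist_triangle)
      moreover have "dist (s + l *\<^sub>R w) s = l * norm w" using l by (simp add: dist_norm)
      ultimately show ?thesis by linarith
    qed
  qed
  have "w \<in> normal_cone (epi h) s"
    unfolding normal_cone_def mem_Collect_eq
  proof (intro exI conjI allI ballI)
    \<comment> \<open>The reciprocal of the step length: the scaled differences are constantly
      \<open>w\<close>, and the nearest points constantly \<open>s\<close>.\<close>
    define l where "l k = inverse (m / real (Suc k))" for k
    have lim: "(\<lambda>k. m / real (Suc k)) \<longlonglongrightarrow> 0"
      using LIMSEQ_Suc[OF lim_const_over_n[of m]] by simp
    show "0 < l k" for k using m by (simp add: l_def)
    show "(\<lambda>k. s + (m / real (Suc k)) *\<^sub>R w) \<longlonglongrightarrow> s"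
      using tendsto_add[OF tendsto_const tendsto_scaleR[OF lim tendsto_const], of s w] by simp
    show "(\<lambda>k. s) \<longlonglongrightarrow> s" by simp
    show "s \<in> epi h" by (simp add: epi_def s_def hz)
    show "dist (s + (m / real (Suc k)) *\<^sub>R w) s \<le> dist (s + (m / real (Suc k)) *\<^sub>R w) y" if "y \<in> epi h" for k y
      using m by (intro closest that) (auto simp: field_simps)
    show "(\<lambda>k. l k *\<^sub>R (s + (m / real (Suc k)) *\<^sub>R w - s)) \<longlonglongrightarrow> w"
      using m by (simp add: l_def)
  qed
  then show ?thesis by (simp add: subdifferential_def w_def s_def hz)
qed

text \<open>At a nearest point of a convex set the angle condition holds against every point of the
  set, and it survives the limit that defines the normal cone. The inequality is global and has no
  quadratic defect, which supplies the convex case with \<rho> = 0.\<close>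

lemma convex_subgradient_inequality:
  fixes h :: "'a::euclidean_space \<Rightarrow> ereal"
  assumes conv: "convex (epi h)" and v: "v \<in> subdifferential h z" and y: "h y \<le> ereal t"
  shows "real_of_ereal (h z) + v \<bullet> (y - z) \<le> t"
proof -
  define s where "s = (z, real_of_ereal (h z))"
  obtain l :: "nat \<Rightarrow> real" and u p where l: "\<forall>k. 0 < l k" and lim: "p \<longlonglongrightarrow> s"
    and closest: "\<forall>k. p k \<in> epi h \<and> (\<forall>y\<in>epi h. dist (u k) (p k) \<le> dist (u k) y)"
    and w: "(\<lambda>k. l k *\<^sub>R (u k - p k)) \<longlonglongrightarrow> (v, -1)"
    using v unfolding subdifferential_def normal_cone_def s_def[symmetric] by blast
  have yt: "(y, t) \<in> epi h" using y by (simp add: epi_def)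
  have "(l k *\<^sub>R (u k - p k)) \<bullet> ((y, t) - p k) \<le> 0" for k
  proof -
    have "(u k - p k) \<bullet> ((y, t) - p k) \<le> 0"
    proof (rule ccontr)
      assume "\<not> ?thesis"
      \<comment> \<open>Were the angle acute, a small move towards \<open>(y, t)\<close> would come
        closer to \<open>u k\<close> and, by convexity, stay in the epigraph.\<close>
      then obtain a where a: "a > 0" "a \<le> 1" "dist (p k + a *\<^sub>R ((y, t) - p k)) (u k) < dist (p k) (u k)"
        using closer_point_lemma[of "u k" "p k" "(y, t)"] by auto
      have "(1 - a) *\<^sub>R p k + a *\<^sub>R (y, t) \<in> epi h"
        using convexD_alt[OF conv, of "p k" "(y, t)" a] closest yt a by auto
      then have "p k + a *\<^sub>R ((y, t) - p k) \<in> epi h" by (simp add: algebra_simps)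
      then show False using closest a(3) by (metis dist_commute not_less)
    qed
    then show ?thesis using l by (simp add: mult_le_0_iff less_imp_le)
  qed
  moreover have "(\<lambda>k. (l k *\<^sub>R (u k - p k)) \<bullet> ((y, t) - p k)) \<longlonglongrightarrow> (v, -1) \<bullet> ((y, t) - s)"
    by (intro tendsto_intros w lim)
  ultimately have "(v, -1) \<bullet> ((y, t) - s) \<le> 0"
    by (intro tendsto_upperbound[where F=sequentially]) auto
  then show ?thesis by (simp add: s_def)
qed

lemma local_minimizer_subdifferential:
  fixes f :: "'a::euclidean_space \<Rightarrow> ereal"
  assumes "local_minimizer f d" "f d = ereal \<alpha>"
  shows "0 \<in> subdifferential f d"
proof -
  obtain r where r: "0 < r" "\<And>e. dist e d < r \<Longrightarrow> f d \<le> f e"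
    using assms(1) unfolding local_minimizer_def eventually_nhds_metric by blast
  show ?thesis
  proof (rule subdifferential_proximal[where h=f and z=d and \<alpha>=\<alpha> and \<delta>=r and v=0 and \<rho>=0])
    fix y t assume y: "y \<in> ball d r" "f y \<le> ereal t"
    then have "f d \<le> ereal t" using r(2)[of y] by (auto simp: dist_commute)
    then show "\<alpha> + 0 \<bullet> (y - d) - 0 / 2 * (norm (y - d))\<^sup>2 \<le> t" by (simp add: assms(2))
  qed (fact assms(2) r(1))+
qed

lemma parallel_subspace_eq:
  assumes "subspace L" "affine_parallel L (affine hull S)" "S \<noteq> {}"
  shows "parallel_subspace S = L"
proof -
  have "\<exists>!L. subspace L \<and> affine_parallel (affine hull S) L"
    using assms(3) by (intro affine_parallel_subspace) auto
  then show ?thesis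
    unfolding parallel_subspace_def using assms by (intro the1_equality) (auto simp: affine_parallel_commute)
qed

section \<open>Composition with a smooth map\<close>

text \<open>All local data with one radius \<open>R\<close> and one constant \<open>K\<close>.
  \<open>tilt\<close> is what relative interiority of \<open>vbar\<close> provides;
  \<open>transversal\<close> is the constraint qualification with the parallel subspace identified
  with the normal space; \<open>prox\<close> is phrased with a real majorant \<open>t\<close> of
  \<open>h y\<close>, so that infinite values need no separate treatment.\<close>

locale composite_problem =
  fixes h :: "'b::euclidean_space \<Rightarrow> ereal" and c :: "'a::euclidean_space \<Rightarrow> 'b"
    and xbar :: 'a and M :: "'b set"
    and c' :: "'a \<Rightarrow> 'a \<Rightarrow>\<^sub>L 'b" and F :: "'b \<Rightarrow> 'b" and F' :: "'b \<Rightarrow> 'b \<Rightarrow>\<^sub>L 'b" and Y :: "'b set"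
    and g :: "'b \<Rightarrow> real" and g' :: "'b \<Rightarrow> 'b \<Rightarrow>\<^sub>L real"
    and R K :: real and vbar :: 'b and \<delta> \<epsilon> \<rho> :: real
  assumes c_smooth: "lipschitz_derivative_on c c' xbar R K"
    and F_smooth: "lipschitz_derivative_on F F' (c xbar) R K"
    and g_smooth: "lipschitz_derivative_on g g' (c xbar) R K"
    and subspace_Y: "subspace Y" and range_F: "range F \<subseteq> Y" and range_F': "range (F' (c xbar)) = Y"
    and cbar_in_M: "c xbar \<in> M"
    and in_M_iff: "\<And>z. z \<in> ball (c xbar) R \<Longrightarrow> z \<in> M \<longleftrightarrow> F z = 0"
    and h_on_M: "\<And>z. z \<in> ball (c xbar) R \<Longrightarrow> z \<in> M \<Longrightarrow> h z = ereal (g z)"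
    and inner_semicontinuous:
      "\<And>w y. w \<in> subdifferential h (c xbar) \<Longrightarrow> \<forall>k::nat. y k \<in> M \<Longrightarrow> y \<longlonglongrightarrow> c xbar \<Longrightarrow>
        \<exists>v. v \<longlonglongrightarrow> w \<and> (\<forall>\<^sub>F k in sequentially. v k \<in> subdifferential h (y k))"
    and \<delta>: "0 < \<delta>"
    and tilt: "\<And>w. w \<in> range (adjoint (F' (c xbar))) \<Longrightarrow> norm w \<le> \<delta> \<Longrightarrow> vbar + w \<in> subdifferential h (c xbar)"
    and vbar_unique: "subdifferential h (c xbar) \<inter> null_space (adjoint (c' xbar)) = {vbar}"
    and transversal: "\<And>w. w \<in> range (adjoint (F' (c xbar))) \<Longrightarrow> adjoint (c' xbar) w = 0 \<Longrightarrow> w = 0"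
    and \<epsilon>: "0 < \<epsilon>" "\<epsilon> \<le> R" and \<rho>: "0 \<le> \<rho>"
    and prox: "\<And>z y v t. z \<in> ball (c xbar) \<epsilon> \<Longrightarrow> y \<in> ball (c xbar) \<epsilon> \<Longrightarrow> \<bar>h z - h (c xbar)\<bar> < ereal \<epsilon> \<Longrightarrow>
        v \<in> subdifferential h z \<Longrightarrow> dist v vbar < \<epsilon> \<Longrightarrow> h y \<le> ereal t \<Longrightarrow>
        real_of_ereal (h z) + v \<bullet> (y - z) - \<rho> / 2 * (norm (y - z))\<^sup>2 \<le> t"
begin

abbreviation "cbar \<equiv> c xbar"

abbreviation "N z \<equiv> range (adjoint (F' z))"

definition grad :: "'b \<Rightarrow> 'b" where "grad z = adjoint (g' z) 1"

definition lin :: "'a \<Rightarrow> 'a \<Rightarrow> 'b" where "lin x d = c x + c' x d"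

text \<open>The value at \<open>z\<close> is taken from \<open>g\<close>, so the set is meant for
  \<open>z\<close> in \<open>M\<close>; the ball is centred at \<open>cbar\<close> and does not move
  with \<open>z\<close>.\<close>

definition P :: "'b \<Rightarrow> 'b set" where
  "P z = {v. \<forall>y\<in>ball cbar \<epsilon>. \<forall>t. h y \<le> ereal t \<longrightarrow> g z + v \<bullet> (y - z) - \<rho> / 2 * (norm (y - z))\<^sup>2 \<le> t}"

lemmas R_pos [simp] = lipschitz_derivative_pos[OF c_smooth]
lemmas K_nonneg = lipschitz_derivative_nonneg[OF c_smooth]

lemma subspace_N: "subspace (N z)"
  by (simp add: adjoint_linear linear_blinfun_apply linear_subspace_image)

lemma cbar_in_ball [simp]: "cbar \<in> ball cbar R"
  using R_pos by simp

lemma xbar_in_ball [simp]: "xbar \<in> ball xbar R"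
  using R_pos by simp

lemma F_cbar: "F cbar = 0"
  using in_M_iff cbar_in_M by simp

lemma h_cbar: "h cbar = ereal (g cbar)"
  using h_on_M cbar_in_M by simp

lemma F_in_Y: "F z \<in> Y"
  using range_F by auto

lemma vbar_subgradient: "vbar \<in> subdifferential h cbar"
  using vbar_unique by auto

lemma vbar_critical: "adjoint (c' xbar) vbar = 0"
  using vbar_unique unfolding null_space_def by auto

lemma norm_F_le: "z \<in> ball cbar R \<Longrightarrow> norm (F z) \<le> K * norm (z - cbar)"
  using lipschitz_derivative_lipschitz[OF F_smooth, of z cbar] by (simp add: F_cbar)

section \<open>Normal vectors and right inverses\<close>

text \<open>For \<open>y\<close> orthogonal to \<open>Y\<close> the function
  \<open>y \<bullet> F\<close> is constantly 0; differentiating it shows that \<open>F' z t\<close>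
  is orthogonal to the complement of \<open>Y\<close>.\<close>

lemma F'_in_Y:
  assumes "z \<in> ball cbar R"
  shows "F' z t \<in> Y"
proof -
  have "y \<bullet> F' z t = 0" if y: "y \<in> Y\<^sup>\<bottom>" for y
  proof -
    have zero: "y \<bullet> F u = 0" for u
      using y F_in_Y[of u] by (auto simp: orthogonal_comp_def orthogonal_def inner_commute)
    have "((\<lambda>u. y \<bullet> F u) has_derivative (\<lambda>t. y \<bullet> F' z t)) (at z)"
      by (rule has_derivative_inner_right[OF lipschitz_derivative_has_derivative[OF F_smooth assms]])
    then have "((\<lambda>u. 0) has_derivative (\<lambda>t. y \<bullet> F' z t)) (at z)"
      unfolding zero .
    then have "(\<lambda>t. y \<bullet> F' z t) = (\<lambda>t. 0)"
      by (rule has_derivative_unique) simp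
    then show ?thesis by metis
  qed
  then have "F' z t \<in> Y\<^sup>\<bottom>\<^sup>\<bottom>"
    by (auto simp: orthogonal_comp_def orthogonal_def)
  then show ?thesis using orthogonal_comp_self[OF subspace_Y] by simp
qed

text \<open>Gives normal vectors coordinates in \<open>Y\<close>: the part of a preimage orthogonal
  to \<open>Y\<close> is killed by the adjoint, because \<open>F' z\<close> takes values in
  \<open>Y\<close>. Coordinates in \<open>Y\<close> are the ones that
  \<open>normal_lower_bound\<close> controls.\<close>

lemma N_from_Y:
  assumes "z \<in> ball cbar R" "w \<in> N z"
  obtains y where "y \<in> Y" "w = adjoint (F' z) y"
proof -
  obtain y0 where y0: "w = adjoint (F' z) y0" using assms by auto
  obtain a b where ab: "a \<in> span Y" "\<And>w. w \<in> span Y \<Longrightarrow> orthogonal b w" "y0 = a + b"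
    using orthogonal_subspace_decomp_exists[of Y y0] by metis
  have Y: "span Y = Y" using subspace_Y by simp
  have "adjoint (F' z) b \<bullet> t = 0" for t
    using ab(2)[of "F' z t"] F'_in_Y[OF assms(1)] unfolding Y adjoint_blinfun_inner orthogonal_def by blast
  then have "adjoint (F' z) b = 0" by (metis inner_eq_zero_iff)
  then show ?thesis using that[of a] ab Y y0 by (simp add: adjoint_blinfun_simps)
qed

text \<open>The orthogonal complement of \<open>N cbar\<close> is the kernel of
  \<open>F' cbar\<close>, so restriction to \<open>N cbar\<close> loses no values. A right inverse
  with values in \<open>N cbar\<close> makes the correction onto \<open>M\<close> a normal
  displacement.\<close>

lemma right_inverse_F':
  obtains A \<alpha> where "linear A" "range A \<subseteq> N cbar" "\<And>y. y \<in> Y \<Longrightarrow> F' cbar (A y) = y"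
    "0 < \<alpha>" "\<And>y. norm (A y) \<le> \<alpha> * norm y"
proof -
  obtain A \<alpha> where A: "linear A" "range A \<subseteq> N cbar" "\<And>y. y \<in> F' cbar ` N cbar \<Longrightarrow> F' cbar (A y) = y"
    "0 < \<alpha>" "\<And>y. norm (A y) \<le> \<alpha> * norm y"
    using linear_right_inverse_on[OF linear_blinfun_apply subspace_N] by metis
  have "y \<in> F' cbar ` N cbar" if y: "y \<in> Y" for y
  proof -
    obtain u where u: "y = F' cbar u" using y range_F' by auto
    have NN: "span (N cbar) = N cbar" using subspace_N by simp
    obtain a b where ab: "a \<in> span (N cbar)" "\<And>w. w \<in> span (N cbar) \<Longrightarrow> orthogonal b w" "u = a + b"
      using orthogonal_subspace_decomp_exists[of "N cbar" u] by metis
    have "b \<in> (N cbar)\<^sup>\<bottom>" using ab(2) unfolding NN orthogonal_comp_def by (blast intro: orthogonal_commute[THEN iffD1])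
    then have "F' cbar b = 0" using ker_orthogonal_comp_adjoint[OF linear_blinfun_apply, of "F' cbar"] by auto
    then have "y = F' cbar a" by (simp add: u ab(3) blinfun.add_right)
    then show ?thesis using ab(1) NN by simp
  qed
  then show ?thesis using that[OF A(1,2) _ A(4,5)] A(3) by blast
qed

text \<open>Surjectivity by duality: if the adjoint of the composite kills \<open>t\<close>, then
  the adjoint of \<open>F' cbar\<close> sends \<open>t\<close> to a normal vector killed by the
  adjoint of \<open>c' xbar\<close>, and \<open>transversal\<close> makes this vector 0. Here the
  constraint qualification becomes solvability.\<close>

lemma right_inverse_composite:
  obtains A \<alpha> where "linear A" "\<And>y. y \<in> Y \<Longrightarrow> F' cbar (c' xbar (A y)) = y"
    "0 < \<alpha>" "\<And>y. norm (A y) \<le> \<alpha> * norm y"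
proof -
  define L where "L t = F' cbar (c' xbar t)" for t
  have L: "linear L" unfolding L_def
    using linear_compose[OF linear_blinfun_apply linear_blinfun_apply, of "F' cbar" "c' xbar"] by (simp add: o_def)
  obtain A \<alpha> where A: "linear A" "\<And>y. y \<in> range L \<Longrightarrow> L (A y) = y"
    "0 < \<alpha>" "\<And>y. norm (A y) \<le> \<alpha> * norm y"
    using linear_right_inverse_on[OF L subspace_UNIV] by metis
  have "y \<in> range L" if y: "y \<in> Y" for y
  proof -
    have "y \<bullet> t = 0" if t: "adjoint L t = 0" for t
    proof -
      have "adjoint (c' xbar) (adjoint (F' cbar) t) \<bullet> s = 0" for s
        using adjoint_works[OF L, of s t] t by (simp add: adjoint_blinfun_inner L_def inner_commute[of t])
      then have "adjoint (c' xbar) (adjoint (F' cbar) t) = 0" by (metis inner_eq_zero_iff)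
      then have *: "adjoint (F' cbar) t = 0" using transversal by blast
      obtain u where "y = F' cbar u" using y range_F' by auto
      then show ?thesis using adjoint_blinfun_inner[of "F' cbar" t u] * by (simp add: inner_commute)
    qed
    then have "y \<in> range (adjoint (adjoint L))"
      by (simp add: range_adjoint_iff[OF adjoint_linear[OF L]])
    then show ?thesis by (simp add: adjoint_adjoint[OF L])
  qed
  then show ?thesis using that[OF A(1) _ A(3,4)] A(2) L_def by metis
qed

lemma norm_lin_diff_le:
  assumes "x \<in> ball xbar R"
  shows "norm (lin x d - lin x d') \<le> K * norm (d - d')"
  using lipschitz_derivative_apply[OF c_smooth assms, of "d - d'"]
  by (simp add: lin_def blinfun.diff_right)

lemma norm_lin_le:
  assumes "x \<in> ball xbar R"
  shows "norm (lin x d - cbar) \<le> K * norm (x - xbar) + K * norm d"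
proof -
  have "norm (lin x d - cbar) \<le> norm (c x - cbar) + norm (c' x d)"
    unfolding lin_def using norm_triangle_ineq[of "c x - cbar" "c' x d"] by (simp add: algebra_simps)
  then show ?thesis
    using lipschitz_derivative_lipschitz[OF c_smooth assms xbar_in_ball]
      lipschitz_derivative_apply[OF c_smooth assms, of d] by linarith
qed

lemma linearization_eq_lin:
  assumes "x \<in> ball xbar R"
  shows "linearization c x d = lin x d"
  by (simp add: linearization_def lin_def lipschitz_derivative_nabla[OF c_smooth assms])

lemma F_strict:
  assumes "a \<in> cball cbar s" "b \<in> cball cbar s" "s < R"
  shows "norm (F a - F b - F' cbar (a - b)) \<le> K * s * norm (a - b)"
  using assms by (intro lipschitz_derivative_strict[OF F_smooth]) auto

section \<open>Feasible corrections with uniform distance estimates\<close>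

text \<open>Not a metric projection: \<open>solve_near\<close> corrects \<open>z\<close> along
  \<open>N cbar\<close>, so \<open>z - p\<close> is normal at \<open>cbar\<close> and controlled by
  the residual \<open>F z\<close>.\<close>

lemma project_onto_M:
  obtains s \<kappa> where "0 < s" "0 \<le> \<kappa>"
    "\<And>z. z \<in> ball cbar s \<Longrightarrow>
      \<exists>p\<in>M. p \<in> ball cbar R \<and> z - p \<in> N cbar \<and> norm (z - p) \<le> \<kappa> * norm (F z)"
proof -
  obtain A \<alpha> where A: "linear A" "range A \<subseteq> N cbar" "\<And>y. y \<in> Y \<Longrightarrow> F' cbar (A y) = y"
    "0 < \<alpha>" "\<And>y. norm (A y) \<le> \<alpha> * norm y"
    using right_inverse_F' by metis
  obtain s where s: "0 < s" "s < R / 2" "(2 * K * \<alpha>) * s < 1 / 2"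
    using exists_small[of "R / 2" "1 / 2" "2 * K * \<alpha>"] R_pos by auto
  \<comment> \<open>Within \<open>s'\<close> the residual is at most \<open>K * s'\<close>, small
    enough for the correction to stay within \<open>s\<close>.\<close>
  obtain s' where s': "0 < s'" "s' < s" "(2 * \<alpha> * K) * s' < s"
    using exists_small[of s s "2 * \<alpha> * K"] s by auto
  have "\<exists>p\<in>M. p \<in> ball cbar R \<and> z - p \<in> N cbar \<and> norm (z - p) \<le> 2 * \<alpha> * norm (F z)"
    if z: "z \<in> ball cbar s'" for z
  proof -
    have zs: "norm (z - cbar) < s'" using z by (simp only: mem_ball_norm)
    have "2 * \<alpha> * norm (F z) \<le> 2 * \<alpha> * (K * norm (z - cbar))"
      using zs s s' A by (intro mult_left_mono norm_F_le) (simp only: mem_ball_norm, simp_all)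
    also have "\<dots> \<le> (2 * \<alpha> * K) * s'"
      using zs A K_nonneg by (simp add: mult.assoc[symmetric] mult_left_mono)
    finally have Fz: "2 * \<alpha> * norm (F z) \<le> s" using s' by linarith
    have sub: "cball z s \<subseteq> cball cbar (2 * s)"
      using zs s' s by (auto simp: cball_subset_cball_iff dist_norm)
    obtain y where y: "y \<in> Y" "norm y \<le> 2 * norm (F z)" "F (z + A y) = 0"
    proof (rule solve_near[of Y A "F' cbar" \<alpha> F z s "K * (2 * s)"])
      show "norm (F a - F b - F' cbar (a - b)) \<le> K * (2 * s) * norm (a - b)"
        if "a \<in> cball z s" "b \<in> cball z s" for a b
        using that sub s by (intro F_strict) auto
    qed (use A subspace_Y range_F K_nonneg s Fz in \<open>auto simp: algebra_simps\<close>)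
    have Ay: "norm (A y) \<le> 2 * \<alpha> * norm (F z)"
      using order_trans[OF A(5)[of y] mult_left_mono[OF y(2)]] A(4) by simp
    have "norm (z + A y - cbar) \<le> norm (z - cbar) + norm (A y)"
      using norm_triangle_ineq[of "z - cbar" "A y"] by (simp add: algebra_simps)
    then have b: "z + A y \<in> ball cbar R" using Ay Fz zs s s' by (simp only: mem_ball_norm)
    have "- A y \<in> N cbar" using A(2) subspace_N by (meson range_subsetD subspace_neg)
    then have "z - (z + A y) \<in> N cbar" by simp
    moreover have "z + A y \<in> M" using b y in_M_iff by blast
    ultimately show ?thesis using b Ay by (intro bexI[of _ "z + A y"]) auto
  qed
  then show ?thesis using that[of s' "2 * \<alpha>"] s' A(4) by auto
qed

text \<open>The derivative is frozen at \<open>xbar\<close> and \<open>cbar\<close>, so a single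
  right inverse serves all nearby \<open>x\<close>, and \<kappa> is uniform in \<open>x\<close> and
  \<open>d\<close>.\<close>

lemma lin_feasible:
  obtains s \<kappa> where "0 < s" "s \<le> R" "0 \<le> \<kappa>"
    "\<And>x d. x \<in> ball xbar s \<Longrightarrow> d \<in> ball 0 s \<Longrightarrow>
      lin x d \<in> ball cbar R \<and> (\<exists>d'. lin x d' \<in> ball cbar R \<and> F (lin x d') = 0 \<and> norm (d' - d) \<le> \<kappa> * norm (F (lin x d)))"
proof -
  obtain A \<alpha> where A: "linear A" "\<And>y. y \<in> Y \<Longrightarrow> F' cbar (c' xbar (A y)) = y"
    "0 < \<alpha>" "\<And>y. norm (A y) \<le> \<alpha> * norm y"
    using right_inverse_composite by metis
  define C where "C = K * (3 * K) * K + K * K"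
  have C: "0 \<le> C" using K_nonneg by (simp add: C_def)
  obtain s0 where s0: "0 < s0" "s0 < R" "(3 * K) * s0 < R"
    using exists_small[of R R "3 * K"] R_pos by auto
  obtain s where s: "0 < s" "s < s0" "(C * \<alpha>) * s < 1 / 2"
    using exists_small[of s0 "1 / 2" "C * \<alpha>"] s0 by auto
  have sR: "3 * K * s < R" using s s0 K_nonneg by (meson less_le_not_le mult_left_mono order.strict_trans1 mult_nonneg_nonneg zero_le_numeral)
  obtain s' where s': "0 < s'" "s' < s" "(2 * \<alpha> * (K * (2 * K))) * s' < s"
    using exists_small[of s s "2 * \<alpha> * (K * (2 * K))"] s by auto
  have "lin x d \<in> ball cbar R \<and> (\<exists>d'. lin x d' \<in> ball cbar R \<and> F (lin x d') = 0 \<and> norm (d' - d) \<le> 2 * \<alpha> * norm (F (lin x d)))"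
    if x: "x \<in> ball xbar s'" and d: "d \<in> ball 0 s'" for x d
  proof -
    have xs: "norm (x - xbar) < s'" using x by (simp only: mem_ball_norm)
    have ds: "norm d < s'" using d by simp
    have xR: "x \<in> ball xbar R" using xs s s' s0 by (simp only: mem_ball_norm)
    have l: "norm (lin x d1 - cbar) \<le> 3 * K * s" if "norm d1 \<le> 2 * s" for d1
    proof -
      have "norm (lin x d1 - cbar) \<le> K * norm (x - xbar) + K * norm d1" by (rule norm_lin_le[OF xR])
      also have "\<dots> \<le> K * s + K * (2 * s)"
        using xs s' that K_nonneg by (intro add_mono mult_left_mono) auto
      finally show ?thesis by simp
    qed
    have ld: "lin x d \<in> ball cbar R"
      using l[of d] ds s s' sR unfolding mem_ball_norm by linarith
    have "norm (F (lin x d)) \<le> K * (K * norm (x - xbar) + K * norm d)"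
      by (rule order_trans[OF norm_F_le[OF ld] mult_left_mono[OF norm_lin_le[OF xR] K_nonneg]])
    also have "\<dots> \<le> K * (K * s' + K * s')"
      using xs ds K_nonneg by (intro mult_left_mono add_mono) auto
    finally have "2 * \<alpha> * norm (F (lin x d)) \<le> 2 * \<alpha> * (K * (K * s' + K * s'))"
      using A(3) by (intro mult_left_mono) auto
    also have "\<dots> = (2 * \<alpha> * (K * (2 * K))) * s'" by (simp add: algebra_simps)
    finally have Fs: "2 * \<alpha> * norm (F (lin x d)) \<le> s" using s' by linarith
    have strict: "norm (F (lin x a) - F (lin x b) - F' cbar (c' xbar (a - b))) \<le> (C * s) * norm (a - b)"
      if ab: "a \<in> cball d s" "b \<in> cball d s" for a b
    proof -
      have n: "norm a \<le> 2 * s" "norm b \<le> 2 * s"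
        using ab ds s' norm_triangle_sub[of a d] norm_triangle_sub[of b d] by (auto simp: dist_norm norm_minus_commute)
      have eq: "lin x a - lin x b = c' x (a - b)" by (simp add: lin_def blinfun.diff_right)
      have "norm (F (lin x a) - F (lin x b) - F' cbar (lin x a - lin x b)) \<le> K * (3 * K * s) * norm (lin x a - lin x b)"
        using l[OF n(1)] l[OF n(2)] sR by (intro F_strict) (auto simp: dist_norm norm_minus_commute)
      also have "\<dots> \<le> K * (3 * K * s) * (K * norm (a - b))"
        using K_nonneg s by (intro mult_left_mono norm_lin_diff_le xR) auto
      finally have 1: "norm (F (lin x a) - F (lin x b) - F' cbar (c' x (a - b))) \<le> K * (3 * K * s) * (K * norm (a - b))"
        unfolding eq .
      have "norm (F' cbar (c' x (a - b)) - F' cbar (c' xbar (a - b))) \<le> K * norm (c' x (a - b) - c' xbar (a - b))"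
        unfolding blinfun.diff_right[symmetric] by (intro lipschitz_derivative_apply[OF F_smooth]) simp
      also have "\<dots> \<le> K * (K * norm (x - xbar) * norm (a - b))"
        by (intro mult_left_mono lipschitz_derivative_diff_apply[OF c_smooth xR xbar_in_ball] K_nonneg)
      also have "\<dots> \<le> K * (K * s * norm (a - b))"
        using xs s' K_nonneg by (intro mult_left_mono mult_right_mono) auto
      finally have 2: "norm (F' cbar (c' x (a - b)) - F' cbar (c' xbar (a - b))) \<le> K * (K * s * norm (a - b))" .
      have "norm (F (lin x a) - F (lin x b) - F' cbar (c' xbar (a - b)))
        \<le> norm (F (lin x a) - F (lin x b) - F' cbar (c' x (a - b))) + norm (F' cbar (c' x (a - b)) - F' cbar (c' xbar (a - b)))"
        using norm_triangle_ineq[of "F (lin x a) - F (lin x b) - F' cbar (c' x (a - b))"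
            "F' cbar (c' x (a - b)) - F' cbar (c' xbar (a - b))"] by simp
      also have "\<dots> \<le> K * (3 * K * s) * (K * norm (a - b)) + K * (K * s * norm (a - b))"
        using 1 2 by simp
      also have "\<dots> = (C * s) * norm (a - b)" by (simp add: C_def algebra_simps)
      finally show ?thesis .
    qed
    obtain y where y: "y \<in> Y" "norm y \<le> 2 * norm (F (lin x d))" "F (lin x (d + A y)) = 0"
      by (rule solve_near[of Y A "\<lambda>t. F' cbar (c' xbar t)" \<alpha> "\<lambda>d. F (lin x d)" d s "C * s"])
        (use A subspace_Y F_in_Y strict Fs C s in \<open>auto simp: mult_ac\<close>)
    have Ay: "norm (A y) \<le> 2 * \<alpha> * norm (F (lin x d))"
      using order_trans[OF A(4)[of y] mult_left_mono[OF y(2)]] A(3) by simp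
    have "norm (d + A y) \<le> 2 * s"
      using norm_triangle_ineq[of d "A y"] Ay Fs ds s' by linarith
    then have "lin x (d + A y) \<in> ball cbar R"
      using l sR by (simp only: mem_ball_norm) (meson order.strict_trans1)
    then show ?thesis using ld y Ay by (intro conjI exI[of _ "d + A y"]) auto
  qed
  then show ?thesis using that[of s' "2 * \<alpha>"] s' A(3) s s0 by auto
qed

text \<open>The same correction for the nonlinear constraint \<open>F (c x) = 0\<close>; it later
  turns \<open>x + d\<close> into the point required in \<open>identifies_manifold\<close>.\<close>

lemma c_feasible:
  obtains s \<kappa> where "0 < s" "s \<le> R" "0 \<le> \<kappa>"
    "\<And>x. x \<in> ball xbar s \<Longrightarrow>
      c x \<in> ball cbar R \<and> (\<exists>x'\<in>ball xbar R. c x' \<in> ball cbar R \<and> c x' \<in> M \<and> norm (x' - x) \<le> \<kappa> * norm (F (c x)))"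
proof -
  obtain A \<alpha> where A: "linear A" "\<And>y. y \<in> Y \<Longrightarrow> F' cbar (c' xbar (A y)) = y"
    "0 < \<alpha>" "\<And>y. norm (A y) \<le> \<alpha> * norm y"
    using right_inverse_composite by metis
  \<comment> \<open>The second summand is now the nonlinearity of \<open>c\<close> on the ball of
    radius \<open>2 * s\<close> around \<open>xbar\<close>.\<close>
  define C where "C = K * (2 * K) * K + K * (2 * K)"
  have C: "0 \<le> C" using K_nonneg by (simp add: C_def)
  obtain s0 where s0: "0 < s0" "s0 < R / 2" "(2 * K) * s0 < R"
    using exists_small[of "R / 2" R "2 * K"] R_pos by auto
  obtain s where s: "0 < s" "s < s0" "(C * \<alpha>) * s < 1 / 2"
    using exists_small[of s0 "1 / 2" "C * \<alpha>"] s0 by auto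
  have sR: "2 * K * s < R" using s s0 K_nonneg by (meson less_le_not_le mult_left_mono order.strict_trans1 mult_nonneg_nonneg zero_le_numeral)
  obtain s' where s': "0 < s'" "s' < s" "(2 * \<alpha> * (K * K)) * s' < s"
    using exists_small[of s s "2 * \<alpha> * (K * K)"] s by auto
  have "c x \<in> ball cbar R \<and> (\<exists>x'\<in>ball xbar R. c x' \<in> ball cbar R \<and> c x' \<in> M \<and> norm (x' - x) \<le> 2 * \<alpha> * norm (F (c x)))"
    if x: "x \<in> ball xbar s'" for x
  proof -
    have xs: "norm (x - xbar) < s'" using x by (simp only: mem_ball_norm)
    have l: "a \<in> ball xbar R \<and> norm (c a - cbar) \<le> K * norm (a - xbar) \<and> norm (c a - cbar) \<le> 2 * K * s"
      if a: "norm (a - xbar) \<le> 2 * s" for a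
    proof -
      have aR: "a \<in> ball xbar R" using a s s0 by (simp only: mem_ball_norm)
      have b: "norm (c a - cbar) \<le> K * norm (a - xbar)"
        by (rule lipschitz_derivative_lipschitz[OF c_smooth aR xbar_in_ball])
      also have "\<dots> \<le> K * (2 * s)" using a K_nonneg by (intro mult_left_mono) auto
      finally show ?thesis using aR b by simp
    qed
    have lx: "c x \<in> ball cbar R" "norm (c x - cbar) \<le> K * norm (x - xbar)"
      using l[of x] xs s s' sR by (simp_all only: mem_ball_norm) (auto intro: order.strict_trans1)
    have "norm (F (c x)) \<le> K * (K * norm (x - xbar))"
      by (rule order_trans[OF norm_F_le[OF lx(1)] mult_left_mono[OF lx(2) K_nonneg]])
    also have "\<dots> \<le> K * (K * s')"
      using xs K_nonneg by (intro mult_left_mono) auto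
    finally have "2 * \<alpha> * norm (F (c x)) \<le> 2 * \<alpha> * (K * (K * s'))"
      using A(3) by (intro mult_left_mono) auto
    also have "\<dots> = (2 * \<alpha> * (K * K)) * s'" by (simp add: algebra_simps)
    finally have Fs: "2 * \<alpha> * norm (F (c x)) \<le> s" using s' by linarith
    have strict: "norm (F (c a) - F (c b) - F' cbar (c' xbar (a - b))) \<le> (C * s) * norm (a - b)"
      if ab: "a \<in> cball x s" "b \<in> cball x s" for a b
    proof -
      have n: "norm (a - xbar) \<le> 2 * s" "norm (b - xbar) \<le> 2 * s"
        using ab xs s' norm_triangle_ineq[of "a - x" "x - xbar"] norm_triangle_ineq[of "b - x" "x - xbar"]
        by (auto simp: dist_norm norm_minus_commute)
      have "norm (F (c a) - F (c b) - F' cbar (c a - c b)) \<le> K * (2 * K * s) * norm (c a - c b)"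
        using l[OF n(1)] l[OF n(2)] sR by (intro F_strict) (auto simp: dist_norm norm_minus_commute)
      also have "\<dots> \<le> K * (2 * K * s) * (K * norm (a - b))"
        using K_nonneg s l[OF n(1)] l[OF n(2)] by (intro mult_left_mono lipschitz_derivative_lipschitz[OF c_smooth]) auto
      finally have 1: "norm (F (c a) - F (c b) - F' cbar (c a - c b)) \<le> K * (2 * K * s) * (K * norm (a - b))" .
      have "norm (F' cbar (c a - c b) - F' cbar (c' xbar (a - b))) \<le> K * norm (c a - c b - c' xbar (a - b))"
        unfolding blinfun.diff_right[symmetric] by (intro lipschitz_derivative_apply[OF F_smooth]) simp
      also have "\<dots> \<le> K * (K * (2 * s) * norm (a - b))"
        using n s s0 by (intro mult_left_mono lipschitz_derivative_strict[OF c_smooth] K_nonneg)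
          (auto simp: dist_norm norm_minus_commute)
      finally have 2: "norm (F' cbar (c a - c b) - F' cbar (c' xbar (a - b))) \<le> K * (K * (2 * s) * norm (a - b))" .
      have "norm (F (c a) - F (c b) - F' cbar (c' xbar (a - b)))
        \<le> norm (F (c a) - F (c b) - F' cbar (c a - c b)) + norm (F' cbar (c a - c b) - F' cbar (c' xbar (a - b)))"
        using norm_triangle_ineq[of "F (c a) - F (c b) - F' cbar (c a - c b)"
            "F' cbar (c a - c b) - F' cbar (c' xbar (a - b))"] by simp
      also have "\<dots> \<le> K * (2 * K * s) * (K * norm (a - b)) + K * (K * (2 * s) * norm (a - b))"
        using 1 2 by simp
      also have "\<dots> = (C * s) * norm (a - b)" by (simp add: C_def algebra_simps)
      finally show ?thesis .
    qed
    obtain y where y: "y \<in> Y" "norm y \<le> 2 * norm (F (c x))" "F (c (x + A y)) = 0"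
      by (rule solve_near[of Y A "\<lambda>t. F' cbar (c' xbar t)" \<alpha> "\<lambda>x. F (c x)" x s "C * s"])
        (use A subspace_Y F_in_Y strict Fs C s in \<open>auto simp: mult_ac\<close>)
    have Ay: "norm (A y) \<le> 2 * \<alpha> * norm (F (c x))"
      using order_trans[OF A(4)[of y] mult_left_mono[OF y(2)]] A(3) by simp
    have "norm (x + A y - xbar) \<le> 2 * s"
      using norm_triangle_ineq[of "x - xbar" "A y"] Ay Fs xs s' by (simp add: algebra_simps)
    from l[OF this] have "x + A y \<in> ball xbar R" "c (x + A y) \<in> ball cbar R"
      using sR by (simp_all only: mem_ball_norm) linarith
    then show ?thesis using lx(1) y Ay in_M_iff by (intro conjI bexI[of _ "x + A y"]) auto
  qed
  then show ?thesis using that[of s' "2 * \<alpha>"] s' A(3) s s0 by auto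
qed

section \<open>The sets \<open>P z\<close> and first-order conditions along the manifold\<close>

lemma g_has_derivative:
  assumes "z \<in> ball cbar R"
  shows "(g has_derivative (\<lambda>t. grad z \<bullet> t)) (at z)"
proof -
  have "blinfun_apply (g' z) = (\<lambda>t. grad z \<bullet> t)"
    by (auto simp: grad_def adjoint_blinfun_inner)
  then show ?thesis using lipschitz_derivative_has_derivative[OF g_smooth assms] by simp
qed

lemma grad_diff_le:
  assumes "z \<in> ball cbar R" "y \<in> ball cbar R"
  shows "norm (grad z - grad y) \<le> K * norm (z - y)"
proof -
  have "norm (grad z - grad y) \<le> norm (g' z - g' y) * norm (1::real)"
    unfolding grad_def adjoint_blinfun_diff[symmetric] by (rule norm_adjoint_le)
  also have "\<dots> \<le> K * norm (z - y)" using lipschitz_derivative_diff[OF g_smooth assms] by simp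
  finally show ?thesis .
qed

lemma F_step_le:
  assumes "z \<in> ball cbar R" "z + w \<in> ball cbar R" "F z = 0" "F' z w = 0"
  shows "norm (F (z + w)) \<le> K * (norm w)\<^sup>2"
  using lipschitz_derivative_taylor[OF F_smooth assms(2,1)] assms(3,4) by simp

text \<open>Each epigraph point \<open>(y, t)\<close> over the ball contributes a closed half-space
  in \<open>v\<close>; the other pairs contribute the whole space.\<close>

lemma P_closed_convex: "closed (P z)" "convex (P z)"
proof -
  define Q where "Q y t = (if h y \<le> ereal t then {v. (y - z) \<bullet> v \<le> t - g z + \<rho> / 2 * (norm (y - z))\<^sup>2} else UNIV)" for y t
  have "P z = (\<Inter>y\<in>ball cbar \<epsilon>. \<Inter>t. Q y t)"
  proof (intro set_eqI)
    fix v
    have "v \<in> Q y t \<longleftrightarrow> (h y \<le> ereal t \<longrightarrow> g z + v \<bullet> (y - z) - \<rho> / 2 * (norm (y - z))\<^sup>2 \<le> t)" for y t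
      by (auto simp: Q_def inner_commute[of v])
    then show "v \<in> P z \<longleftrightarrow> v \<in> (\<Inter>y\<in>ball cbar \<epsilon>. \<Inter>t. Q y t)"
      unfolding P_def INT_iff by blast
  qed
  moreover have "closed (Q y t)" "convex (Q y t)" for y t
    by (auto simp: Q_def closed_halfspace_le convex_halfspace_le)
  ultimately show "closed (P z)" "convex (P z)"
    by (auto intro!: closed_INT convex_INT)
qed

lemma P_subset_subdifferential:
  assumes "z \<in> ball cbar \<epsilon>" "z \<in> M" "v \<in> P z"
  shows "v \<in> subdifferential h z"
proof -
  obtain r where r: "0 < r" "ball z r \<subseteq> ball cbar \<epsilon>"
    using assms(1) open_contains_ball by blast
  show ?thesis
  proof (rule subdifferential_proximal[of h z "g z" r v \<rho>])
    show "h z = ereal (g z)" using assms \<epsilon> by (intro h_on_M) auto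
    show "g z + v \<bullet> (y - z) - \<rho> / 2 * (norm (y - z))\<^sup>2 \<le> t" if "y \<in> ball z r" "h y \<le> ereal t" for y t
      using assms(3) that r unfolding P_def by blast
  qed fact
qed

lemma subgradient_in_P:
  assumes "z \<in> ball cbar \<epsilon>" "z \<in> M" "\<bar>g z - g cbar\<bar> < \<epsilon>" "v \<in> subdifferential h z" "dist v vbar < \<epsilon>"
  shows "v \<in> P z"
proof -
  have hz: "h z = ereal (g z)" using assms \<epsilon> by (intro h_on_M) auto
  show ?thesis
    using prox[OF assms(1) _ _ assms(4,5)] assms(3) unfolding P_def by (auto simp: hz h_cbar)
qed

lemma vbar_in_P: "vbar \<in> P cbar"
  using \<epsilon> by (intro subgradient_in_P cbar_in_M vbar_subgradient) auto

text \<open>For \<open>v\<close> in \<open>P z\<close> the function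
  \<open>g y - v \<bullet> y\<close> has along \<open>M\<close> a minimum at \<open>z\<close> up to
  a quadratic defect, so its gradient is normal. Thus \<open>P z\<close> lies in the affine space
  \<open>grad z + N z\<close>.\<close>

lemma P_normal:
  obtains s where "0 < s" "s \<le> \<epsilon>" "\<And>z v. z \<in> ball cbar s \<Longrightarrow> z \<in> M \<Longrightarrow> v \<in> P z \<Longrightarrow> v - grad z \<in> N z"
proof -
  obtain s \<kappa> where s: "0 < s" "0 \<le> \<kappa>"
    and proj: "\<And>z. z \<in> ball cbar s \<Longrightarrow>
      \<exists>p\<in>M. p \<in> ball cbar R \<and> z - p \<in> N cbar \<and> norm (z - p) \<le> \<kappa> * norm (F z)"
    using project_onto_M by metis
  have "v - grad z \<in> N z" if z: "z \<in> ball cbar (min s \<epsilon>)" "z \<in> M" and v: "v \<in> P z" for z v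
  proof -
    have zR: "z \<in> ball cbar R" and z\<epsilon>: "z \<in> ball cbar \<epsilon>" using z \<epsilon> by auto
    have Fz: "F z = 0" using zR z in_M_iff by blast
    have "grad z - v \<in> range (adjoint (F' z))"
    proof (rule multiplier_exists[where \<phi>="\<lambda>y. g y - v \<bullet> y" and d=z and S=M and \<rho>="\<rho> / 2"])
      show "((\<lambda>y. g y - v \<bullet> y) has_derivative (\<lambda>t. (grad z - v) \<bullet> t)) (at z)"
        by (rule has_derivative_eq_rhs, rule has_derivative_diff[OF g_has_derivative[OF zR]])
          (auto intro!: derivative_eq_intros simp: inner_diff_left)
      have "\<forall>\<^sub>F y in nhds z. y \<in> ball cbar \<epsilon>"
        using eventually_nhds_in_open[OF open_ball z\<epsilon>] .
      then show "\<forall>\<^sub>F y in nhds z. y \<in> M \<longrightarrow> g z - v \<bullet> z - \<rho> / 2 * (norm (y - z))\<^sup>2 \<le> g y - v \<bullet> y"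
      proof eventually_elim
        case (elim y)
        show ?case
        proof
          assume "y \<in> M"
          then have "h y \<le> ereal (g y)" using h_on_M[of y] elim \<epsilon> by auto
          then have "g z + v \<bullet> (y - z) - \<rho> / 2 * (norm (y - z))\<^sup>2 \<le> g y"
            using v elim unfolding P_def by blast
          then show "g z - v \<bullet> z - \<rho> / 2 * (norm (y - z))\<^sup>2 \<le> g y - v \<bullet> y"
            by (simp add: inner_diff_right)
        qed
      qed
      show "linear (F' z)" by (rule linear_blinfun_apply)
      fix t assume t: "F' z t = 0"
      \<comment> \<open>The tangent line is pushed onto \<open>M\<close>; since
        \<open>F' z t = 0\<close>, the residual and hence the displacement are quadratic in
        \<tau>.\<close>
      have "\<forall>\<^sub>F \<tau> in at_right 0. z + \<tau> *\<^sub>R t \<in> ball cbar s \<inter> ball cbar R"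
        using z zR by (intro eventually_at_right_curve) auto
      then have "\<forall>\<^sub>F \<tau> in at_right 0. \<exists>p\<in>M. norm (p - (z + \<tau> *\<^sub>R t)) \<le> (\<kappa> * K * (norm t)\<^sup>2) * \<tau>\<^sup>2"
      proof eventually_elim
        case (elim \<tau>)
        obtain p where p: "p \<in> M" "norm (z + \<tau> *\<^sub>R t - p) \<le> \<kappa> * norm (F (z + \<tau> *\<^sub>R t))"
          using proj elim by blast
        have "\<kappa> * norm (F (z + \<tau> *\<^sub>R t)) \<le> \<kappa> * (K * (norm (\<tau> *\<^sub>R t))\<^sup>2)"
          using elim zR Fz t s by (intro mult_left_mono F_step_le) (auto simp: blinfun.scaleR_right)
        also have "\<dots> = (\<kappa> * K * (norm t)\<^sup>2) * \<tau>\<^sup>2" by (simp add: power_mult_distrib)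
        finally show ?case using p by (intro bexI[of _ p]) (auto simp: norm_minus_commute)
      qed
      then show "\<exists>C. \<forall>\<^sub>F \<tau> in at_right 0. \<exists>p\<in>M. norm (p - (z + \<tau> *\<^sub>R t)) \<le> C * \<tau>\<^sup>2" by blast
    qed
    then have "- (grad z - v) \<in> N z" using subspace_N subspace_neg by blast
    then show ?thesis by simp
  qed
  then show ?thesis using that[of "min s \<epsilon>"] s \<epsilon> by auto
qed

text \<open>The multiplier rule for the reduced problem in \<open>d\<close>, with curves from
  \<open>lin_feasible\<close>. The resulting \<open>v\<close> is \<open>grad\<close> plus a normal
  vector: a candidate subgradient of \<open>h\<close>, not yet known to be one.\<close>

lemma lin_multiplier:
  obtains s where "0 < s" "s \<le> R"
    "\<And>x d \<mu>. x \<in> ball xbar s \<Longrightarrow> d \<in> ball 0 s \<Longrightarrow> F (lin x d) = 0 \<Longrightarrow>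
      \<forall>\<^sub>F e in nhds d. F (lin x e) = 0 \<longrightarrow> g (lin x d) + \<mu> / 2 * (norm d)\<^sup>2 \<le> g (lin x e) + \<mu> / 2 * (norm e)\<^sup>2 \<Longrightarrow>
      \<exists>v. v - grad (lin x d) \<in> N (lin x d) \<and> adjoint (c' x) v + \<mu> *\<^sub>R d = 0"
proof -
  obtain s \<kappa> where s: "0 < s" "s \<le> R" "0 \<le> \<kappa>"
    and feas: "\<And>x d. x \<in> ball xbar s \<Longrightarrow> d \<in> ball 0 s \<Longrightarrow>
      lin x d \<in> ball cbar R \<and> (\<exists>d'. lin x d' \<in> ball cbar R \<and> F (lin x d') = 0 \<and> norm (d' - d) \<le> \<kappa> * norm (F (lin x d)))"
    using lin_feasible by metis
  have "\<exists>v. v - grad (lin x d) \<in> N (lin x d) \<and> adjoint (c' x) v + \<mu> *\<^sub>R d = 0"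
    if x: "x \<in> ball xbar s" and d: "d \<in> ball 0 s" and Fd: "F (lin x d) = 0"
      and min: "\<forall>\<^sub>F e in nhds d. F (lin x e) = 0 \<longrightarrow> g (lin x d) + \<mu> / 2 * (norm d)\<^sup>2 \<le> g (lin x e) + \<mu> / 2 * (norm e)\<^sup>2"
    for x d \<mu>
  proof -
    define z where "z = lin x d"
    define W where "W t = F' z (c' x t)" for t
    have W: "linear W" unfolding W_def
      using linear_compose[OF linear_blinfun_apply linear_blinfun_apply, of "F' z" "c' x"] by (simp add: o_def)
    have zR: "z \<in> ball cbar R" using feas[OF x d] by (simp add: z_def)
    have lin_der: "(lin x has_derivative c' x) (at d)" for d
      unfolding lin_def by (auto intro!: derivative_eq_intros bounded_linear_imp_has_derivative blinfun.bounded_linear_right)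
    have "adjoint (c' x) (grad z) + \<mu> *\<^sub>R d \<in> range (adjoint W)"
    proof (rule multiplier_exists[where \<phi>="\<lambda>e. g (lin x e) + \<mu> / 2 * (norm e)\<^sup>2" and d=d and S="{e. F (lin x e) = 0}" and \<rho>=0])
      have 1: "((\<lambda>e. g (lin x e)) has_derivative (\<lambda>t. grad z \<bullet> c' x t)) (at d)"
        using has_derivative_compose[OF lin_der g_has_derivative, of d] zR by (simp add: z_def)
      have 2: "((\<lambda>e. \<mu> / 2 * (norm e)\<^sup>2) has_derivative (\<lambda>t. \<mu> * (d \<bullet> t))) (at d)"
        unfolding power2_norm_eq_inner
        by (auto intro!: derivative_eq_intros simp: inner_commute)
      show "((\<lambda>e. g (lin x e) + \<mu> / 2 * (norm e)\<^sup>2) has_derivative (\<lambda>t. (adjoint (c' x) (grad z) + \<mu> *\<^sub>R d) \<bullet> t)) (at d)"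
        by (rule has_derivative_eq_rhs[OF has_derivative_add[OF 1 2]])
          (simp add: inner_add_left adjoint_blinfun_inner)
      show "\<forall>\<^sub>F e in nhds d. e \<in> {e. F (lin x e) = 0} \<longrightarrow>
          g (lin x d) + \<mu> / 2 * (norm d)\<^sup>2 - 0 * (norm (e - d))\<^sup>2 \<le> g (lin x e) + \<mu> / 2 * (norm e)\<^sup>2"
        using min by simp
      show "linear W" by fact
      fix t assume t: "W t = 0"
      have "\<forall>\<^sub>F \<tau> in at_right 0. d + \<tau> *\<^sub>R t \<in> ball 0 s"
        using d by (intro eventually_at_right_curve) auto
      then have "\<forall>\<^sub>F \<tau> in at_right 0. \<exists>p\<in>{e. F (lin x e) = 0}. norm (p - (d + \<tau> *\<^sub>R t)) \<le> (\<kappa> * K * (norm (c' x t))\<^sup>2) * \<tau>\<^sup>2"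
      proof eventually_elim
        case (elim \<tau>)
        have lin: "lin x (d + \<tau> *\<^sub>R t) = z + \<tau> *\<^sub>R c' x t"
          by (simp add: z_def lin_def blinfun.add_right blinfun.scaleR_right)
        obtain p where p: "F (lin x p) = 0" "norm (p - (d + \<tau> *\<^sub>R t)) \<le> \<kappa> * norm (F (lin x (d + \<tau> *\<^sub>R t)))"
          and R': "lin x (d + \<tau> *\<^sub>R t) \<in> ball cbar R"
          using feas[OF x elim] by blast
        have "\<kappa> * norm (F (lin x (d + \<tau> *\<^sub>R t))) \<le> \<kappa> * (K * (norm (\<tau> *\<^sub>R c' x t))\<^sup>2)"
          using R' Fd zR t s unfolding lin W_def
          by (intro mult_left_mono F_step_le) (auto simp: blinfun.scaleR_right z_def)
        also have "\<dots> = (\<kappa> * K * (norm (c' x t))\<^sup>2) * \<tau>\<^sup>2" by (simp add: power_mult_distrib)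
        finally show ?case using p by (intro bexI[of _ p]) auto
      qed
      then show "\<exists>C. \<forall>\<^sub>F \<tau> in at_right 0. \<exists>p\<in>{e. F (lin x e) = 0}. norm (p - (d + \<tau> *\<^sub>R t)) \<le> C * \<tau>\<^sup>2" by blast
    qed
    then obtain w where w: "adjoint (c' x) (grad z) + \<mu> *\<^sub>R d = adjoint W w" by blast
    \<comment> \<open>The adjoint of the composite factors, so the multiplier \<open>w\<close> can
      be absorbed into \<open>grad z\<close> as a normal vector at \<open>z\<close>.\<close>
    have "adjoint W = (\<lambda>w. adjoint (c' x) (adjoint (F' z) w))"
      by (rule adjoint_unique) (simp add: W_def adjoint_works[OF linear_blinfun_apply])
    then have aW: "adjoint W w = adjoint (c' x) (adjoint (F' z) w)" by simp
    show ?thesis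
    proof (intro exI[of _ "grad z - adjoint (F' z) w"] conjI)
      have "- adjoint (F' z) w \<in> N z" using subspace_N subspace_neg by blast
      then show "grad z - adjoint (F' z) w - grad (lin x d) \<in> N (lin x d)" by (simp add: z_def)
      show "adjoint (c' x) (grad z - adjoint (F' z) w) + \<mu> *\<^sub>R d = 0"
        using w unfolding aW by (simp add: adjoint_blinfun_simps algebra_simps)
    qed
  qed
  then show ?thesis using that[of s] s by blast
qed

section \<open>Stability of normal spaces and multipliers\<close>

text \<open>A right inverse of the composite bounds its adjoint from below on \<open>Y\<close>;
  moving \<open>x\<close> and \<open>z\<close> perturbs the composite by at most
  \<open>2 * K * K * s\<close>, which uses up at most half of that bound.\<close>

lemma normal_lower_bound:
  obtains s \<beta> where "0 < s" "s \<le> R" "0 < \<beta>"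
    "\<And>z y. z \<in> ball cbar s \<Longrightarrow> y \<in> Y \<Longrightarrow> norm y \<le> \<beta> * norm (adjoint (F' z) y)"
    "\<And>x z y. x \<in> ball xbar s \<Longrightarrow> z \<in> ball cbar s \<Longrightarrow> y \<in> Y \<Longrightarrow>
      norm y \<le> \<beta> * norm (adjoint (c' x) (adjoint (F' z) y))"
proof -
  obtain A \<alpha> where A: "linear A" "\<And>y. y \<in> Y \<Longrightarrow> F' cbar (c' xbar (A y)) = y"
    "0 < \<alpha>" "\<And>y. norm (A y) \<le> \<alpha> * norm y"
    using right_inverse_composite by metis
  obtain s where s: "0 < s" "s < R" "(2 * K * K * \<alpha>) * s < 1 / 2"
    using exists_small[of R "1 / 2" "2 * K * K * \<alpha>"] R_pos by auto
  have comp: "norm y \<le> (2 * \<alpha>) * norm (adjoint (c' x) (adjoint (F' z) y))"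
    if x: "x \<in> ball xbar s" and z: "z \<in> ball cbar s" and y: "y \<in> Y" for x z y
  proof -
    have xR: "x \<in> ball xbar R" and zR: "z \<in> ball cbar R" using x z s by auto
    have xs: "norm (x - xbar) \<le> s" and zs: "norm (z - cbar) \<le> s" using x z by (simp_all only: mem_ball_norm less_imp_le)
    let ?a = "adjoint (c' x) (adjoint (F' z) y)"
    have "y \<bullet> y = y \<bullet> F' cbar (c' xbar (A y))" using A(2)[OF y] by simp
    also have "\<dots> = ?a \<bullet> A y + (y \<bullet> (F' cbar (c' xbar (A y)) - F' z (c' x (A y))))"
      by (simp add: adjoint_blinfun_inner inner_diff_right)
    also have "\<dots> \<le> norm ?a * (\<alpha> * norm y) + norm y * ((2 * K * K * s) * (\<alpha> * norm y))"
    proof (intro add_mono)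
      show "?a \<bullet> A y \<le> norm ?a * (\<alpha> * norm y)"
        by (rule order_trans[OF norm_cauchy_schwarz mult_left_mono[OF A(4)]]) simp
      have "norm (F' cbar (c' xbar (A y)) - F' z (c' x (A y)))
        \<le> norm (F' cbar (c' xbar (A y) - c' x (A y))) + norm (F' cbar (c' x (A y)) - F' z (c' x (A y)))"
        using norm_triangle_ineq[of "F' cbar (c' xbar (A y) - c' x (A y))" "F' cbar (c' x (A y)) - F' z (c' x (A y))"]
        by (simp add: blinfun.diff_right)
      also have "\<dots> \<le> K * (K * norm (xbar - x) * norm (A y)) + K * norm (cbar - z) * (K * norm (A y))"
      proof (intro add_mono)
        show "norm (F' cbar (c' xbar (A y) - c' x (A y))) \<le> K * (K * norm (xbar - x) * norm (A y))"
          by (rule order_trans[OF lipschitz_derivative_apply[OF F_smooth cbar_in_ball]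
                mult_left_mono[OF lipschitz_derivative_diff_apply[OF c_smooth xbar_in_ball xR] K_nonneg]])
        show "norm (F' cbar (c' x (A y)) - F' z (c' x (A y))) \<le> K * norm (cbar - z) * (K * norm (A y))"
          by (rule order_trans[OF lipschitz_derivative_diff_apply[OF F_smooth cbar_in_ball zR]
                mult_left_mono[OF lipschitz_derivative_apply[OF c_smooth xR]]])
            (simp add: K_nonneg)
      qed
      also have "\<dots> \<le> K * (K * s * norm (A y)) + K * s * (K * norm (A y))"
        using xs zs K_nonneg by (intro add_mono mult_left_mono mult_right_mono) (auto simp: norm_minus_commute)
      also have "\<dots> = (2 * K * K * s) * norm (A y)" by (simp add: algebra_simps)
      also have "\<dots> \<le> (2 * K * K * s) * (\<alpha> * norm y)"
        using K_nonneg s by (intro mult_left_mono A) auto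
      finally show "y \<bullet> (F' cbar (c' xbar (A y)) - F' z (c' x (A y))) \<le> norm y * ((2 * K * K * s) * (\<alpha> * norm y))"
        by (rule order_trans[OF norm_cauchy_schwarz mult_left_mono]) simp
    qed
    also have "norm y * ((2 * K * K * s) * (\<alpha> * norm y)) = ((2 * K * K * \<alpha>) * s) * (norm y)\<^sup>2"
      by (simp add: power2_eq_square)
    also have "\<dots> \<le> 1 / 2 * (norm y)\<^sup>2" using s by (intro mult_right_mono) auto
    finally have "norm y * norm y \<le> norm y * ((2 * \<alpha>) * norm ?a)"
      unfolding power2_norm_eq_inner[symmetric] by (simp add: power2_eq_square algebra_simps)
    then show ?thesis using A(3) by (cases "y = 0") auto
  qed
  \<comment> \<open>\<open>2 * \<alpha>\<close> serves the composite; a further factor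
    \<open>K\<close> pays for removing the adjoint of \<open>c' xbar\<close>.\<close>
  define \<beta> where "\<beta> = 2 * \<alpha> * (K + 1)"
  have \<beta>: "0 < \<beta>" "2 * \<alpha> \<le> \<beta>" "(2 * \<alpha>) * K \<le> \<beta>"
    using A(3) K_nonneg by (auto simp: \<beta>_def algebra_simps add_pos_nonneg)
  show ?thesis
  proof (rule that[of s \<beta>])
    fix x z y assume *: "x \<in> ball xbar s" "z \<in> ball cbar s" "y \<in> Y"
    show "norm y \<le> \<beta> * norm (adjoint (c' x) (adjoint (F' z) y))"
      by (rule order_trans[OF comp[OF *] mult_right_mono[OF \<beta>(2)]]) simp
  next
    fix z y assume *: "z \<in> ball cbar s" "y \<in> Y"
    have "norm y \<le> (2 * \<alpha>) * norm (adjoint (c' xbar) (adjoint (F' z) y))"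
      using s * by (intro comp) auto
    also have "\<dots> \<le> (2 * \<alpha>) * (K * norm (adjoint (F' z) y))"
      using A(3) lipschitz_derivative_norm[OF c_smooth xbar_in_ball]
      by (intro mult_left_mono order_trans[OF norm_adjoint_le] mult_right_mono) auto
    also have "\<dots> = ((2 * \<alpha>) * K) * norm (adjoint (F' z) y)" by simp
    also have "\<dots> \<le> \<beta> * norm (adjoint (F' z) y)" using \<beta> by (intro mult_right_mono) auto
    finally show "norm y \<le> \<beta> * norm (adjoint (F' z) y)" .
  qed (use s \<beta> in auto)
qed

lemma adjoint_F'_diff_le:
  assumes "z \<in> ball cbar R"
  shows "norm (adjoint (F' z) y - adjoint (F' cbar) y) \<le> K * norm (z - cbar) * norm y"
  unfolding adjoint_blinfun_diff[symmetric]
  by (rule order_trans[OF norm_adjoint_le mult_right_mono[OF lipschitz_derivative_diff[OF F_smooth assms cbar_in_ball]]]) simp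

text \<open>Transport by coordinates: the same \<open>y\<close> in \<open>Y\<close> represents a
  normal vector at \<open>z\<close> and one at \<open>cbar\<close>, and the lower bound controls
  \<open>norm y\<close> by \<open>norm w\<close>.\<close>

lemma normal_approximation:
  obtains s C where "0 < s" "0 \<le> C"
    "\<And>z w. z \<in> ball cbar s \<Longrightarrow> w \<in> N z \<Longrightarrow> \<exists>u\<in>N cbar. norm (w - u) \<le> C * norm (z - cbar) * norm w"
proof -
  obtain s \<beta> where s: "0 < s" "s \<le> R" "0 < \<beta>"
    and lower: "\<And>z y. z \<in> ball cbar s \<Longrightarrow> y \<in> Y \<Longrightarrow> norm y \<le> \<beta> * norm (adjoint (F' z) y)"
    using normal_lower_bound by metis
  have "\<exists>u\<in>N cbar. norm (w - u) \<le> (K * \<beta>) * norm (z - cbar) * norm w" if z: "z \<in> ball cbar s" and w: "w \<in> N z" for z w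
  proof -
    have zR: "z \<in> ball cbar R" using z s by auto
    obtain y where y: "y \<in> Y" "w = adjoint (F' z) y" using N_from_Y[OF zR w] by blast
    have "norm (w - adjoint (F' cbar) y) \<le> K * norm (z - cbar) * norm y"
      unfolding y by (rule adjoint_F'_diff_le[OF zR])
    also have "\<dots> \<le> K * norm (z - cbar) * (\<beta> * norm w)"
      unfolding y using lower[OF z y(1)] K_nonneg by (intro mult_left_mono) auto
    finally show ?thesis by (intro bexI[of _ "adjoint (F' cbar) y"]) (auto simp: mult_ac)
  qed
  then show ?thesis using that[of s "K * \<beta>"] s K_nonneg by auto
qed

text \<open>A member of \<open>grad z + N z\<close> is determined, with a Lipschitz estimate, by its
  image under the adjoint of \<open>c' x\<close>. At the base point \<open>vbar\<close> is the
  member with image 0.\<close>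

lemma multiplier_near:
  obtains s C where "0 < s" "0 \<le> C"
    "\<And>x z v. x \<in> ball xbar s \<Longrightarrow> z \<in> ball cbar s \<Longrightarrow> v - grad z \<in> N z \<Longrightarrow>
      norm (v - vbar) \<le> C * (norm (x - xbar) + norm (z - cbar) + norm (adjoint (c' x) v))"
proof -
  obtain s \<beta> where s: "0 < s" "s \<le> R" "0 < \<beta>"
    and lower: "\<And>x z y. x \<in> ball xbar s \<Longrightarrow> z \<in> ball cbar s \<Longrightarrow> y \<in> Y \<Longrightarrow>
      norm y \<le> \<beta> * norm (adjoint (c' x) (adjoint (F' z) y))"
    using normal_lower_bound by metis
  obtain s1 where s1: "0 < s1" "\<And>z v. z \<in> ball cbar s1 \<Longrightarrow> z \<in> M \<Longrightarrow> v \<in> P z \<Longrightarrow> v - grad z \<in> N z"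
    using P_normal by metis
  have "vbar - grad cbar \<in> N cbar" using s1 cbar_in_M vbar_in_P by auto
  then obtain ybar where ybar: "vbar - grad cbar = adjoint (F' cbar) ybar" by blast
  define B where "B = K + K * norm ybar"
  define D where "D = K * B + K * norm vbar + B + 1"
  have B: "0 \<le> B" using K_nonneg by (simp add: B_def)
  have D: "B \<le> D" "K * B \<le> D" "K * norm vbar \<le> D" "1 \<le> D" "0 \<le> D"
    using K_nonneg B by (auto simp: D_def)
  have "norm (v - vbar) \<le> (K * \<beta> * D + D) * (norm (x - xbar) + norm (z - cbar) + norm (adjoint (c' x) v))"
    if x: "x \<in> ball xbar s" and z: "z \<in> ball cbar s" and v: "v - grad z \<in> N z" for x z v
  proof -
    have xR: "x \<in> ball xbar R" and zR: "z \<in> ball cbar R" using x z s by auto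
    define T where "T = norm (x - xbar) + norm (z - cbar) + norm (adjoint (c' x) v)"
    \<comment> \<open>The member of \<open>grad z + N z\<close> with the coordinates
      \<open>ybar\<close> that \<open>vbar\<close> has at \<open>cbar\<close>; it stays within
      \<open>B * norm (z - cbar)\<close> of \<open>vbar\<close>.\<close>
    define q where "q = grad z + adjoint (F' z) ybar"
    have "q - vbar = (grad z - grad cbar) + (adjoint (F' z) ybar - adjoint (F' cbar) ybar)"
      using ybar by (simp add: q_def algebra_simps)
    then have "norm (q - vbar) \<le> norm (grad z - grad cbar) + norm (adjoint (F' z) ybar - adjoint (F' cbar) ybar)"
      by (simp add: norm_triangle_ineq)
    also have "\<dots> \<le> K * norm (z - cbar) + K * norm (z - cbar) * norm ybar"
      by (intro add_mono grad_diff_le adjoint_F'_diff_le zR cbar_in_ball)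
    also have "\<dots> = B * norm (z - cbar)" by (simp add: B_def algebra_simps)
    finally have q: "norm (q - vbar) \<le> B * norm (z - cbar)" .
    have "(v - grad z) - adjoint (F' z) ybar \<in> N z" using v subspace_N by (meson rangeI subspace_diff)
    then have "v - q \<in> N z" by (simp add: q_def algebra_simps)
    then obtain y where y: "y \<in> Y" "v - q = adjoint (F' z) y" using N_from_Y[OF zR] by blast
    have adj: "norm (adjoint (c' x) w) \<le> K * norm w" for w
      using lipschitz_derivative_norm[OF c_smooth xR]
      by (intro order_trans[OF norm_adjoint_le] mult_right_mono) auto
    \<comment> \<open>Criticality of \<open>vbar\<close> turns its image under the adjoint of
      \<open>c' x\<close> into a mere change of derivative.\<close>
    have "adjoint (c' x) (v - q) = adjoint (c' x) v - adjoint (c' x) (q - vbar) - adjoint (c' x - c' xbar) vbar"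
      by (simp add: adjoint_blinfun_simps adjoint_blinfun_diff vbar_critical)
    then have "norm (adjoint (c' x) (v - q))
        \<le> norm (adjoint (c' x) v) + norm (adjoint (c' x) (q - vbar)) + norm (adjoint (c' x - c' xbar) vbar)"
      by (metis (no_types, lifting) add_mono_thms_linordered_semiring(3) norm_triangle_ineq4 order_trans)
    also have "\<dots> \<le> norm (adjoint (c' x) v) + K * (B * norm (z - cbar)) + K * norm (x - xbar) * norm vbar"
    proof (intro add_mono order_refl)
      show "norm (adjoint (c' x) (q - vbar)) \<le> K * (B * norm (z - cbar))"
        by (rule order_trans[OF adj mult_left_mono[OF q K_nonneg]])
      show "norm (adjoint (c' x - c' xbar) vbar) \<le> K * norm (x - xbar) * norm vbar"
        by (rule order_trans[OF norm_adjoint_le mult_right_mono[OF lipschitz_derivative_diff[OF c_smooth xR xbar_in_ball]]]) simp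
    qed
    also have "\<dots> = 1 * norm (adjoint (c' x) v) + (K * B) * norm (z - cbar) + (K * norm vbar) * norm (x - xbar)"
      by simp
    also have "\<dots> \<le> D * norm (adjoint (c' x) v) + D * norm (z - cbar) + D * norm (x - xbar)"
      using D by (intro add_mono mult_right_mono) auto
    also have "\<dots> = D * T" by (simp add: T_def algebra_simps)
    finally have vq: "norm (adjoint (c' x) (v - q)) \<le> D * T" .
    have "norm (v - q) \<le> K * norm y"
      unfolding y(2) using lipschitz_derivative_norm[OF F_smooth zR]
      by (intro order_trans[OF norm_adjoint_le] mult_right_mono) auto
    also have "\<dots> \<le> K * (\<beta> * (D * T))"
      using lower[OF x z y(1)] vq s K_nonneg unfolding y(2)[symmetric]
      by (intro mult_left_mono) (auto intro: order_trans mult_left_mono)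
    finally have 1: "norm (v - q) \<le> K * \<beta> * D * T" by (simp add: mult.assoc)
    have "B * norm (z - cbar) \<le> D * T"
      using D by (intro mult_mono) (auto simp: T_def)
    with q have 2: "norm (q - vbar) \<le> D * T" by simp
    have "norm (v - vbar) \<le> norm (v - q) + norm (q - vbar)"
      using norm_triangle_ineq[of "v - q" "q - vbar"] by simp
    also have "\<dots> \<le> (K * \<beta> * D + D) * T" using 1 2 by (simp add: algebra_simps)
    finally show ?thesis by (simp add: T_def)
  qed
  then show ?thesis using that[of s "K * \<beta> * D + D"] s K_nonneg D by auto
qed

section \<open>Relative interiority, and identification of the manifold\<close>

text \<open>Inner semicontinuity provides subgradients; a limit within \<epsilon> of
  \<open>vbar\<close> brings them eventually within reach of prox-regularity, hence into
  \<open>P\<close>.\<close>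

lemma P_inner_semicontinuous:
  assumes w: "w \<in> subdifferential h cbar" "dist w vbar < \<epsilon>"
    and y: "\<forall>k::nat. y k \<in> M" "y \<longlonglongrightarrow> cbar"
  obtains u where "u \<longlonglongrightarrow> w" "\<forall>\<^sub>F k in sequentially. u k \<in> P (y k)"
proof -
  obtain u where u: "u \<longlonglongrightarrow> w" "\<forall>\<^sub>F k in sequentially. u k \<in> subdifferential h (y k)"
    using inner_semicontinuous[OF w(1) y] by blast
  have "(\<lambda>k. dist (u k) vbar) \<longlonglongrightarrow> dist w vbar" by (intro tendsto_intros u)
  then have "\<forall>\<^sub>F k in sequentially. dist (u k) vbar < \<epsilon>" using w(2) by (rule order_tendstoD)
  moreover have "\<forall>\<^sub>F k in sequentially. y k \<in> ball cbar \<epsilon>"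
    using topological_tendstoD[OF y(2) open_ball] \<epsilon> by simp
  moreover have "\<forall>\<^sub>F k in sequentially. \<bar>g (y k) - g cbar\<bar> < \<epsilon>"
  proof -
    have "isCont g cbar"
      using has_derivative_continuous[OF g_has_derivative[OF cbar_in_ball]] by simp
    then have "(\<lambda>k. g (y k)) \<longlonglongrightarrow> g cbar" by (rule isCont_tendsto_compose) (rule y)
    from tendstoD[OF this \<epsilon>(1)] show ?thesis by (simp add: dist_real_def)
  qed
  ultimately have "\<forall>\<^sub>F k in sequentially. u k \<in> P (y k)"
    using u(2)
  proof eventually_elim
    case (elim k)
    then show ?case using subgradient_in_P[of "y k" "u k"] y(1) by simp
  qed
  with u(1) that show ?thesis by blast
qed

text \<open>
  Tilting \<open>vbar\<close> by a small multiple of a normal direction \<open>w0\<close> stays inside the subdifferential, so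
  nearby subgradients cannot all lie to one side of \<open>v\<close>, even up to \<open>o(1)\<close>.
\<close>

lemma no_separation:
  fixes z :: "nat \<Rightarrow> 'b"
  assumes z: "\<forall>k. z k \<in> M" "z \<longlonglongrightarrow> cbar" and v: "v \<longlonglongrightarrow> vbar" and w: "w \<longlonglongrightarrow> w0"
    and w0: "w0 \<in> N cbar" "norm w0 = 1" and \<theta>: "\<theta> \<longlonglongrightarrow> 0"
    and sep: "\<forall>\<^sub>F k in sequentially. \<forall>u\<in>P (z k). w k \<bullet> (u - v k) \<le> \<theta> k"
  shows False
proof -
  \<comment> \<open>The bound \<delta> keeps the tilted vector in the subdifferential at
    \<open>cbar\<close>, the bound below \<epsilon> keeps the approximating subgradients in
    \<open>P\<close>. The contradiction is that the inner product of \<open>w0\<close> with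
    \<open>r *\<^sub>R w0\<close>, which is \<open>r\<close>, would be at most 0.\<close>
  define r where "r = min \<delta> (\<epsilon> / 2)"
  have r: "0 < r" "r \<le> \<delta>" "r < \<epsilon>" using \<delta> \<epsilon> by (auto simp: r_def)
  have "r *\<^sub>R w0 \<in> N cbar" using w0 subspace_N by (meson subspace_scale)
  then have "vbar + r *\<^sub>R w0 \<in> subdifferential h cbar"
    using r w0 by (intro tilt) auto
  moreover have "dist (vbar + r *\<^sub>R w0) vbar < \<epsilon>" using r w0 by (simp add: dist_norm)
  ultimately obtain u where u: "u \<longlonglongrightarrow> vbar + r *\<^sub>R w0" "\<forall>\<^sub>F k in sequentially. u k \<in> P (z k)"
    using P_inner_semicontinuous z by metis
  have "\<forall>\<^sub>F k in sequentially. w k \<bullet> (u k - v k) \<le> \<theta> k"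
    using u(2) sep by eventually_elim blast
  moreover have "(\<lambda>k. w k \<bullet> (u k - v k)) \<longlonglongrightarrow> w0 \<bullet> (vbar + r *\<^sub>R w0 - vbar)"
    by (intro tendsto_intros u v w)
  ultimately have "w0 \<bullet> (vbar + r *\<^sub>R w0 - vbar) \<le> 0"
    using \<theta> by (intro tendsto_le[of sequentially \<theta> 0]) auto
  then show False using r w0(2) by (simp add: norm_eq_sqrt_inner)
qed

text \<open>Compactness gives a unit limit along a subsequence; its members are asymptotically close
  to the fixed closed subspace \<open>N cbar\<close>.\<close>

lemma unit_normal_limit:
  fixes z :: "nat \<Rightarrow> 'b"
  assumes z: "z \<longlonglongrightarrow> cbar" and bounded: "\<forall>k. norm (w k) \<le> 1"
    and w: "\<forall>\<^sub>F k in sequentially. norm (w k) = 1 \<and> w k \<in> N (z k)"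
  obtains w0 \<sigma> where "w0 \<in> N cbar" "norm w0 = 1" "strict_mono (\<sigma> :: nat \<Rightarrow> nat)" "(w \<circ> \<sigma>) \<longlonglongrightarrow> w0"
proof -
  obtain s C where s: "0 < s" "0 \<le> C"
    and approx: "\<And>z w. z \<in> ball cbar s \<Longrightarrow> w \<in> N z \<Longrightarrow> \<exists>u\<in>N cbar. norm (w - u) \<le> C * norm (z - cbar) * norm w"
    using normal_approximation by metis
  have "\<forall>k. w k \<in> cball 0 1" using bounded by simp
  then obtain w0 \<sigma> where \<sigma>: "strict_mono (\<sigma> :: nat \<Rightarrow> nat)" "(w \<circ> \<sigma>) \<longlonglongrightarrow> w0"
    using compact_cball[of "0::'b" 1] unfolding compact_def by metis
  have ev: "\<forall>\<^sub>F k in sequentially. norm ((w \<circ> \<sigma>) k) = 1 \<and> (w \<circ> \<sigma>) k \<in> N (z (\<sigma> k))"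
    using eventually_subseq[OF \<sigma>(1) w] by simp
  have z\<sigma>: "(\<lambda>k. z (\<sigma> k)) \<longlonglongrightarrow> cbar" using LIMSEQ_subseq_LIMSEQ[OF z \<sigma>(1)] by (simp add: o_def)
  have "(\<lambda>k. norm ((w \<circ> \<sigma>) k)) \<longlonglongrightarrow> norm w0" by (intro tendsto_intros \<sigma>)
  moreover have "(\<lambda>k. norm ((w \<circ> \<sigma>) k)) \<longlonglongrightarrow> 1"
    by (rule tendsto_eventually) (use ev in eventually_elim, auto)
  ultimately have n1: "norm w0 = 1" using LIMSEQ_unique by blast
  \<comment> \<open>The approximants exist only eventually; \<open>SOME\<close> makes them a
    sequence.\<close>
  define u where "u k = (SOME u. u \<in> N cbar \<and> norm ((w \<circ> \<sigma>) k - u) \<le> C * norm (z (\<sigma> k) - cbar))" for k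
  have "\<forall>\<^sub>F k in sequentially. z (\<sigma> k) \<in> ball cbar s"
    using topological_tendstoD[OF z\<sigma> open_ball] s by simp
  with ev have "\<forall>\<^sub>F k in sequentially. u k \<in> N cbar \<and> norm ((w \<circ> \<sigma>) k - u k) \<le> C * norm (z (\<sigma> k) - cbar)"
  proof eventually_elim
    case (elim k)
    then have "\<exists>u\<in>N cbar. norm ((w \<circ> \<sigma>) k - u) \<le> C * norm (z (\<sigma> k) - cbar) * norm ((w \<circ> \<sigma>) k)"
      by (intro approx) blast+
    then have "\<exists>u. u \<in> N cbar \<and> norm ((w \<circ> \<sigma>) k - u) \<le> C * norm (z (\<sigma> k) - cbar)"
      using elim by simp
    then show ?case unfolding u_def by (rule someI_ex)
  qed
  then have u: "\<forall>\<^sub>F k in sequentially. u k \<in> N cbar"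
    and un: "\<forall>\<^sub>F k in sequentially. norm ((w \<circ> \<sigma>) k - u k) \<le> C * norm (z (\<sigma> k) - cbar)"
    by (auto elim: eventually_mono)
  have "(\<lambda>k. C * norm (z (\<sigma> k) - cbar)) \<longlonglongrightarrow> C * norm (cbar - cbar)" by (intro tendsto_intros z\<sigma>)
  then have "(\<lambda>k. (w \<circ> \<sigma>) k - u k) \<longlonglongrightarrow> 0"
    by (intro Lim_null_comparison[OF un]) simp
  then have "(\<lambda>k. (w \<circ> \<sigma>) k - ((w \<circ> \<sigma>) k - u k)) \<longlonglongrightarrow> w0 - 0" by (intro tendsto_diff \<sigma>)
  then have "u \<longlonglongrightarrow> w0" by simp
  then have "w0 \<in> N cbar"
    using Lim_in_closed_set[OF closed_subspace[OF subspace_N] u] by simp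
  then show ?thesis using that n1 \<sigma> by blast
qed

text \<open>Otherwise the nearest point of \<open>P z\<close> to \<open>v\<close> gives a separating
  unit direction, normal because both points lie in \<open>grad z + N z\<close>. Along a subsequence
  this contradicts \<open>no_separation\<close>.\<close>

lemma near_multiplier_in_P:
  obtains s where "0 < s"
    "\<And>z v. z \<in> ball cbar s \<Longrightarrow> z \<in> M \<Longrightarrow> v \<in> ball vbar s \<Longrightarrow> v - grad z \<in> N z \<Longrightarrow> v \<in> P z"
proof -
  obtain s1 where s1: "0 < s1" "\<And>z v. z \<in> ball cbar s1 \<Longrightarrow> z \<in> M \<Longrightarrow> v \<in> P z \<Longrightarrow> v - grad z \<in> N z"
    using P_normal by metis
  have "\<exists>s>0. \<forall>z v. z \<in> ball cbar s \<longrightarrow> z \<in> M \<longrightarrow> v \<in> ball vbar s \<longrightarrow> v - grad z \<in> N z \<longrightarrow> v \<in> P z"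
  proof (rule ccontr)
    assume "\<not> ?thesis"
    then have "\<exists>z v. z \<in> ball cbar (inverse (Suc k)) \<and> z \<in> M \<and> v \<in> ball vbar (inverse (Suc k)) \<and> v - grad z \<in> N z \<and> v \<notin> P z" for k
      by (metis inverse_positive_iff_positive of_nat_0_less_iff zero_less_Suc)
    then obtain z v where zv: "\<And>k. z k \<in> ball cbar (inverse (Suc k))" "\<And>k. z k \<in> M"
      "\<And>k. v k \<in> ball vbar (inverse (Suc k))" "\<And>k. v k - grad (z k) \<in> N (z k)" "\<And>k. v k \<notin> P (z k)"
      by metis
    have z: "z \<longlonglongrightarrow> cbar"
      using zv(1) by (intro tendsto_of_dist_less_inverse) (auto simp: dist_commute)
    have v: "v \<longlonglongrightarrow> vbar"
      using zv(3) by (intro tendsto_of_dist_less_inverse) (auto simp: dist_commute)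
    \<comment> \<open>Makes \<open>P (z k)\<close> nonempty from some index on, so that nearest
      points exist.\<close>
    obtain u where u: "\<forall>\<^sub>F k in sequentially. u k \<in> P (z k)"
      using P_inner_semicontinuous[OF vbar_subgradient _ _ z] zv(2) \<epsilon> by (metis dist_self)
    define q where "q k = closest_point (P (z k)) (v k)" for k
    define w where "w k = sgn (v k - q k)" for k
    have bw: "\<forall>k. norm (w k) \<le> 1" by (simp add: w_def norm_sgn)
    have q: "\<forall>\<^sub>F k in sequentially. q k \<in> P (z k) \<and> (\<forall>u\<in>P (z k). (v k - q k) \<bullet> (u - q k) \<le> 0)"
      using u
    proof eventually_elim
      case (elim k)
      then show ?case unfolding q_def
        using closest_point_in_set[OF P_closed_convex(1)] closest_point_dot[OF P_closed_convex(2,1)] by blast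
    qed
    have "\<forall>\<^sub>F k in sequentially. z k \<in> ball cbar s1"
      using topological_tendstoD[OF z open_ball] s1 by simp
    with q have w: "\<forall>\<^sub>F k in sequentially. norm (w k) = 1 \<and> w k \<in> N (z k)"
    proof eventually_elim
      case (elim k)
      have "q k - grad (z k) \<in> N (z k)" using elim zv(2) s1 by blast
      then have "(v k - grad (z k)) - (q k - grad (z k)) \<in> N (z k)" using zv(4) subspace_N by (meson subspace_diff)
      then have "v k - q k \<in> N (z k)" by simp
      then have "w k \<in> N (z k)" unfolding w_def sgn_div_norm using subspace_N by (meson subspace_scale)
      moreover have "v k \<noteq> q k" using elim zv(5)[of k] by metis
      ultimately show ?case by (simp add: w_def norm_sgn)
    qed
    \<comment> \<open>Changing the base point from \<open>q k\<close> to \<open>v k\<close>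
      subtracts a squared distance, so the sign of the inequality is kept.\<close>
    have sep: "\<forall>\<^sub>F k in sequentially. \<forall>u\<in>P (z k). w k \<bullet> (u - v k) \<le> 0"
      using q
    proof eventually_elim
      case (elim k)
      show ?case
      proof
        fix u assume "u \<in> P (z k)"
        then have "(v k - q k) \<bullet> (u - q k) \<le> 0" using elim by blast
        moreover have "u - v k = (u - q k) - (v k - q k)" by simp
        ultimately have "(v k - q k) \<bullet> (u - v k) \<le> 0"
          using inner_ge_zero[of "v k - q k"] by (simp only: inner_diff_right)
        then show "w k \<bullet> (u - v k) \<le> 0"
          unfolding w_def sgn_div_norm by (simp add: mult_nonneg_nonpos)
      qed
    qed
    obtain w0 \<sigma> where w0: "w0 \<in> N cbar" "norm w0 = 1" "strict_mono (\<sigma> :: nat \<Rightarrow> nat)" "(w \<circ> \<sigma>) \<longlonglongrightarrow> w0"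
      using unit_normal_limit[OF z bw w] by metis
    show False
    proof (rule no_separation[of "z \<circ> \<sigma>" "v \<circ> \<sigma>" "w \<circ> \<sigma>" w0 "\<lambda>k. 0"])
      show "\<forall>\<^sub>F k in sequentially. \<forall>u\<in>P ((z \<circ> \<sigma>) k). (w \<circ> \<sigma>) k \<bullet> (u - (v \<circ> \<sigma>) k) \<le> 0"
        using eventually_subseq[OF w0(3) sep] by simp
    qed (use zv w0 LIMSEQ_subseq_LIMSEQ[OF z w0(3)] LIMSEQ_subseq_LIMSEQ[OF v w0(3)] in auto)
  qed
  then show ?thesis using that by blast
qed

text \<open>Counterexamples are drawn from shrinking balls because inner semicontinuity speaks of
  sequences; their failure to exist yields a uniform radius.\<close>

lemma active_manifold_identification:
  obtains s where "0 < s" "s \<le> \<epsilon>"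
    "\<And>z v. z \<in> ball cbar s \<Longrightarrow> \<bar>h z - h cbar\<bar> < ereal s \<Longrightarrow> v \<in> subdifferential h z \<Longrightarrow> dist v vbar < s \<Longrightarrow> z \<in> M"
proof -
  obtain s1 \<kappa> where s1: "0 < s1" "0 \<le> \<kappa>"
    and proj: "\<And>z. z \<in> ball cbar s1 \<Longrightarrow>
      \<exists>p\<in>M. p \<in> ball cbar R \<and> z - p \<in> N cbar \<and> norm (z - p) \<le> \<kappa> * norm (F z)"
    using project_onto_M by metis
  define b where "b = min s1 (min \<epsilon> R)"
  have b: "0 < b" "b \<le> s1" "b \<le> \<epsilon>" "b \<le> R" using s1 \<epsilon> by (auto simp: b_def)
  have "\<exists>s>0. s \<le> b \<and> (\<forall>z v. z \<in> ball cbar s \<longrightarrow> \<bar>h z - h cbar\<bar> < ereal s \<longrightarrow> v \<in> subdifferential h z \<longrightarrow> dist v vbar < s \<longrightarrow> z \<in> M)"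
  proof (rule ccontr)
    assume contra: "\<not> ?thesis"
    have "\<exists>z v. z \<in> ball cbar (min b (inverse (Suc k))) \<and> \<bar>h z - h cbar\<bar> < ereal (min b (inverse (Suc k)))
      \<and> v \<in> subdifferential h z \<and> dist v vbar < min b (inverse (Suc k)) \<and> z \<notin> M" for k
    proof -
      have "0 < min b (inverse (Suc k))" "min b (inverse (Suc k)) \<le> b" using b by auto
      then show ?thesis using contra by blast
    qed
    then obtain z v where zv: "\<And>k. z k \<in> ball cbar (min b (inverse (Suc k)))" "\<And>k. \<bar>h (z k) - h cbar\<bar> < ereal (min b (inverse (Suc k)))"
      "\<And>k. v k \<in> subdifferential h (z k)" "\<And>k. dist (v k) vbar < min b (inverse (Suc k))" "\<And>k. z k \<notin> M"
      by metis
    have z: "z \<longlonglongrightarrow> cbar"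
      using zv(1) by (intro tendsto_of_dist_less_inverse) (auto simp: dist_commute)
    have v: "v \<longlonglongrightarrow> vbar"
      using zv(4) by (intro tendsto_of_dist_less_inverse) auto
    have zb: "z k \<in> ball cbar b" for k using zv(1)[of k] by auto
    have "\<exists>p\<in>M. p \<in> ball cbar R \<and> z k - p \<in> N cbar \<and> norm (z k - p) \<le> \<kappa> * norm (F (z k))" for k
      using proj[of "z k"] zb[of k] b by auto
    then obtain p where p: "\<And>k. p k \<in> M" "\<And>k. p k \<in> ball cbar R" "\<And>k. z k - p k \<in> N cbar"
      "\<And>k. norm (z k - p k) \<le> \<kappa> * norm (F (z k))" by metis
    have zp: "(\<lambda>k. z k - p k) \<longlonglongrightarrow> 0"
    proof (rule Lim_null_comparison)
      have "norm (z k - p k) \<le> \<kappa> * (K * norm (z k - cbar))" for k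
      proof -
        have "z k \<in> ball cbar R" using zb[of k] b by auto
        then show ?thesis using order_trans[OF p(4) mult_left_mono[OF norm_F_le s1(2)]] by blast
      qed
      then show "\<forall>\<^sub>F k in sequentially. norm (z k - p k) \<le> \<kappa> * (K * norm (z k - cbar))" by simp
      have "(\<lambda>k. \<kappa> * (K * norm (z k - cbar))) \<longlonglongrightarrow> \<kappa> * (K * norm (cbar - cbar))"
        by (intro tendsto_intros z)
      then show "(\<lambda>k. \<kappa> * (K * norm (z k - cbar))) \<longlonglongrightarrow> 0" by simp
    qed
    have pc: "p \<longlonglongrightarrow> cbar" using tendsto_diff[OF z zp] by simp
    define w where "w k = sgn (z k - p k)" for k
    have ne: "z k \<noteq> p k" for k using zv(5)[of k] p(1)[of k] by metis
    have w1: "norm (w k) = 1" for k using ne[of k] by (simp add: w_def norm_sgn)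
    have wN: "w k \<in> N cbar" for k
      unfolding w_def sgn_div_norm using p(3)[of k] subspace_N by (meson subspace_scale)
    have pe: "\<forall>\<^sub>F k in sequentially. p k \<in> ball cbar \<epsilon>"
      using topological_tendstoD[OF pc open_ball] \<epsilon> by simp
    \<comment> \<open>The values of \<open>h\<close> cancel when the inequalities at
      \<open>z k\<close> and \<open>p k\<close> are added. Division by the distance leaves the
      defect \<open>\<rho> * norm (z k - p k)\<close>, a null sequence as
      \<open>no_separation\<close> requires of \<theta>.\<close>
    have sep: "\<forall>\<^sub>F k in sequentially. \<forall>u\<in>P (p k). w k \<bullet> (u - v k) \<le> \<rho> * norm (z k - p k)"
      using pe
    proof eventually_elim
      case (elim k)
      show ?case
      proof
        fix u assume u: "u \<in> P (p k)"
        obtain a where a: "h (z k) = ereal a"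
          using zv(3)[of k] unfolding subdifferential_def by (cases "h (z k)") auto
        have hp: "h (p k) = ereal (g (p k))" using p h_on_M by blast
        have z\<epsilon>: "z k \<in> ball cbar \<epsilon>" using zb[of k] b by auto
        have "a + v k \<bullet> (p k - z k) - \<rho> / 2 * (norm (p k - z k))\<^sup>2 \<le> g (p k)"
          using prox[OF z\<epsilon> elim less_le_trans[OF zv(2)] zv(3), of "g (p k)"] zv(4)[of k] b a hp by (simp add: min.coboundedI1)
        moreover have "g (p k) + u \<bullet> (z k - p k) - \<rho> / 2 * (norm (z k - p k))\<^sup>2 \<le> a"
          using u z\<epsilon> a unfolding P_def by auto
        moreover have "v k \<bullet> (p k - z k) = - (v k \<bullet> (z k - p k))" by (simp add: inner_diff_right)
        ultimately have "(z k - p k) \<bullet> (u - v k) \<le> \<rho> * (norm (z k - p k))\<^sup>2"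
          by (simp add: inner_diff_right inner_diff_left norm_minus_commute inner_commute)
        then have "(z k - p k) \<bullet> (u - v k) / norm (z k - p k) \<le> \<rho> * norm (z k - p k)"
          using ne[of k] by (simp add: divide_le_eq power2_eq_square mult.assoc)
        then show "w k \<bullet> (u - v k) \<le> \<rho> * norm (z k - p k)"
          by (simp add: w_def sgn_div_norm divide_inverse mult.commute)
      qed
    qed
    \<comment> \<open>The directions lie in \<open>N cbar\<close> itself, hence the constant base
      sequence.\<close>
    obtain w0 \<sigma> where w0: "w0 \<in> N cbar" "norm w0 = 1" "strict_mono (\<sigma> :: nat \<Rightarrow> nat)" "(w \<circ> \<sigma>) \<longlonglongrightarrow> w0"
    proof (rule unit_normal_limit[of "\<lambda>k. cbar" w])
      show "\<forall>\<^sub>F k in sequentially. norm (w k) = 1 \<and> w k \<in> N cbar"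
        using w1 wN by (intro always_eventually) blast
    qed (use w1 in auto)
    show False
    proof (rule no_separation[of "p \<circ> \<sigma>" "v \<circ> \<sigma>" "w \<circ> \<sigma>" w0 "\<lambda>k. \<rho> * norm (z (\<sigma> k) - p (\<sigma> k))"])
      show "\<forall>\<^sub>F k in sequentially. \<forall>u\<in>P ((p \<circ> \<sigma>) k). (w \<circ> \<sigma>) k \<bullet> (u - (v \<circ> \<sigma>) k) \<le> \<rho> * norm (z (\<sigma> k) - p (\<sigma> k))"
        using eventually_subseq[OF w0(3) sep] by simp
      have "(\<lambda>k. \<rho> * norm (z (\<sigma> k) - p (\<sigma> k))) \<longlonglongrightarrow> \<rho> * norm (0::'b)"
        using LIMSEQ_subseq_LIMSEQ[OF zp w0(3)] by (intro tendsto_intros) (simp add: o_def)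
      then show "(\<lambda>k. \<rho> * norm (z (\<sigma> k) - p (\<sigma> k))) \<longlonglongrightarrow> 0" by simp
    qed (use p w0 LIMSEQ_subseq_LIMSEQ[OF pc w0(3)] LIMSEQ_subseq_LIMSEQ[OF v w0(3)] in auto)
  qed
  then show ?thesis using that b(3) by (meson order_trans)
qed

section \<open>Existence of the small local minimizer\<close>

lemma continuous_on_lin: "continuous_on S (lin x)"
  unfolding lin_def by (intro continuous_intros)

lemma continuous_on_F: "S \<subseteq> ball cbar R \<Longrightarrow> continuous_on S F"
  using lipschitz_derivative_has_derivative[OF F_smooth]
  by (meson continuous_at_imp_continuous_on has_derivative_continuous subsetD)

lemma continuous_on_g: "S \<subseteq> ball cbar R \<Longrightarrow> continuous_on S g"
  using lipschitz_derivative_has_derivative[OF g_smooth]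
  by (meson continuous_at_imp_continuous_on has_derivative_continuous subsetD)

text \<open>The inequality for \<open>vbar\<close> at \<open>cbar\<close>. Since \<open>vbar\<close>
  annihilates the range of \<open>c' xbar\<close>, its linear term sees only second-order errors,
  and no term linear in \<open>norm d\<close> alone survives; this makes a bound of
  \<open>norm d\<close> by a multiple of \<open>norm (x - xbar)\<close> possible.\<close>

lemma g_lower_bound:
  assumes x: "x \<in> ball xbar R" and z: "lin x d \<in> ball cbar \<epsilon>" "lin x d \<in> M"
  shows "g cbar - norm vbar * K * ((norm (x - xbar))\<^sup>2 + norm (x - xbar) * norm d)
    - \<rho> * K\<^sup>2 * ((norm (x - xbar))\<^sup>2 + (norm d)\<^sup>2) \<le> g (lin x d)"
proof -
  define t where "t = norm (x - xbar)"
  define e where "e = norm d"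
  have hz: "h (lin x d) = ereal (g (lin x d))" using z \<epsilon> by (intro h_on_M) auto
  have "g cbar + vbar \<bullet> (lin x d - cbar) - \<rho> / 2 * (norm (lin x d - cbar))\<^sup>2 \<le> g (lin x d)"
    using vbar_in_P z hz unfolding P_def by auto
  moreover have "- (norm vbar * K * (t\<^sup>2 + t * e)) \<le> vbar \<bullet> (lin x d - cbar)"
  proof -
    have zero: "vbar \<bullet> c' xbar u = 0" for u
      using adjoint_blinfun_inner[of "c' xbar" vbar u] by (simp add: vbar_critical)
    \<comment> \<open>The last summand is invisible to \<open>vbar\<close>; the others are the
      Taylor remainder of \<open>c\<close> and the change of derivative.\<close>
    have eq: "lin x d - cbar = (c x - cbar - c' xbar (x - xbar)) + (c' x d - c' xbar d) + c' xbar (x - xbar + d)"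
      by (simp add: lin_def blinfun.add_right blinfun.diff_right)
    have "vbar \<bullet> (lin x d - cbar) = vbar \<bullet> ((c x - cbar - c' xbar (x - xbar)) + (c' x d - c' xbar d))"
      unfolding eq inner_add_right[of _ _ "c' xbar _"] zero by simp
    moreover have "\<bar>vbar \<bullet> ((c x - cbar - c' xbar (x - xbar)) + (c' x d - c' xbar d))\<bar>
      \<le> norm vbar * (K * t\<^sup>2 + K * t * e)"
    proof (rule order_trans[OF Cauchy_Schwarz_ineq2 mult_left_mono])
      show "norm ((c x - cbar - c' xbar (x - xbar)) + (c' x d - c' xbar d)) \<le> K * t\<^sup>2 + K * t * e"
        unfolding t_def e_def
        by (intro norm_triangle_le add_mono lipschitz_derivative_taylor[OF c_smooth x xbar_in_ball]
            lipschitz_derivative_diff_apply[OF c_smooth x xbar_in_ball])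
    qed simp
    ultimately show ?thesis by (simp add: algebra_simps)
  qed
  moreover have "\<rho> / 2 * (norm (lin x d - cbar))\<^sup>2 \<le> \<rho> * K\<^sup>2 * (t\<^sup>2 + e\<^sup>2)"
  proof -
    have "(norm (lin x d - cbar))\<^sup>2 \<le> (K * t + K * e)\<^sup>2"
      using norm_lin_le[OF x, of d] by (intro power_mono) (auto simp: t_def e_def)
    also have "\<dots> = K\<^sup>2 * (t + e)\<^sup>2" by (simp add: power_mult_distrib[symmetric] distrib_left)
    also have "\<dots> \<le> K\<^sup>2 * (2 * (t\<^sup>2 + e\<^sup>2))"
      using zero_le_power2[of "t - e"] by (intro mult_left_mono) (auto simp: power2_sum power2_diff)
    finally have "\<rho> / 2 * (norm (lin x d - cbar))\<^sup>2 \<le> \<rho> / 2 * (K\<^sup>2 * (2 * (t\<^sup>2 + e\<^sup>2)))"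
      using \<rho> by (intro mult_left_mono) auto
    also have "\<dots> = \<rho> * K\<^sup>2 * (t\<^sup>2 + e\<^sup>2)" by (simp add: mult.assoc)
    finally show ?thesis .
  qed
  ultimately show ?thesis unfolding t_def e_def by linarith
qed

text \<open>The step \<open>xbar - x\<close> nearly returns to \<open>cbar\<close>: the linearized
  value misses it by a quadratic amount, so the correction to feasibility and the increase of
  \<open>g\<close> are quadratic as well.\<close>

lemma feasible_comparison:
  obtains s C where "0 < s" "s \<le> R" "0 \<le> C"
    "\<And>x. x \<in> ball xbar s \<Longrightarrow> \<exists>d. lin x d \<in> ball cbar R \<and> F (lin x d) = 0 \<and>
      norm d \<le> C * norm (x - xbar) \<and> g (lin x d) \<le> g cbar + C * (norm (x - xbar))\<^sup>2"
proof -
  obtain s1 \<kappa> where s1: "0 < s1" "s1 \<le> R" "0 \<le> \<kappa>"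
    and feas: "\<And>x d. x \<in> ball xbar s1 \<Longrightarrow> d \<in> ball 0 s1 \<Longrightarrow>
      lin x d \<in> ball cbar R \<and> (\<exists>d'. lin x d' \<in> ball cbar R \<and> F (lin x d') = 0 \<and> norm (d' - d) \<le> \<kappa> * norm (F (lin x d)))"
    by (rule lin_feasible) (rule that; assumption)
  \<comment> \<open>A radius of at most 1 lets \<open>t^2 \<le> t\<close> turn the quadratic
    correction into a linear bound on \<open>norm d\<close>.\<close>
  define s where "s = min s1 1"
  define D where "D = \<kappa> * (K * K)"
  define C where "C = 1 + D + K * (K * D + K)"
  have D: "0 \<le> D" using s1 K_nonneg by (simp add: D_def)
  have C: "1 + D \<le> C" "K * (K * D + K) \<le> C" "0 \<le> C" using D K_nonneg by (auto simp: C_def)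
  have "\<exists>d. lin x d \<in> ball cbar R \<and> F (lin x d) = 0 \<and>
      norm d \<le> C * norm (x - xbar) \<and> g (lin x d) \<le> g cbar + C * (norm (x - xbar))\<^sup>2"
    if x: "x \<in> ball xbar s" for x
  proof -
    define t where "t = norm (x - xbar)"
    have t: "0 \<le> t" "t < s1" "t < 1" using x unfolding mem_ball_norm t_def s_def by auto
    have xs: "x \<in> ball xbar s1" "x \<in> ball xbar R" using x s1 by (auto simp: s_def)
    have nd: "norm (xbar - x) = t" by (simp add: t_def norm_minus_commute)
    have b: "xbar - x \<in> ball 0 s1" using t nd by simp
    define a where "a = lin x (xbar - x)"
    have aR: "a \<in> ball cbar R" using feas[OF xs(1) b] by (simp add: a_def)
    have "norm (cbar - c x - c' x (xbar - x)) \<le> K * t\<^sup>2"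
      using lipschitz_derivative_taylor[OF c_smooth xbar_in_ball xs(2)] nd by simp
    then have a: "norm (a - cbar) \<le> K * t\<^sup>2"
      unfolding a_def lin_def by (metis diff_diff_eq norm_minus_commute)
    obtain d where d: "lin x d \<in> ball cbar R" "F (lin x d) = 0" "norm (d - (xbar - x)) \<le> \<kappa> * norm (F a)"
      using feas[OF xs(1) b] unfolding a_def by blast
    have "\<kappa> * norm (F a) \<le> \<kappa> * (K * (K * t\<^sup>2))"
      using s1 K_nonneg a by (intro mult_left_mono order_trans[OF norm_F_le[OF aR]]) auto
    then have dd: "norm (d - (xbar - x)) \<le> D * t\<^sup>2" using d(3) by (simp add: D_def mult.assoc)
    have tt: "t\<^sup>2 \<le> t" using t by (simp add: power2_eq_square mult_left_le_one_le)
    have "norm d \<le> norm (d - (xbar - x)) + norm (xbar - x)" using norm_triangle_sub[of d "xbar - x"] by simp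
    also have "\<dots> \<le> D * t + t" using dd nd mult_left_mono[OF tt D] by simp
    also have "\<dots> \<le> C * t" using mult_right_mono[OF C(1) t(1)] by (simp add: algebra_simps)
    finally have "norm d \<le> C * t" .
    moreover have "g (lin x d) \<le> g cbar + C * t\<^sup>2"
    proof -
      have "norm (lin x d - cbar) \<le> norm (lin x d - a) + norm (a - cbar)"
        using norm_triangle_ineq[of "lin x d - a" "a - cbar"] by simp
      also have "\<dots> \<le> K * (D * t\<^sup>2) + K * t\<^sup>2"
        using order_trans[OF norm_lin_diff_le[OF xs(2)] mult_left_mono[OF dd K_nonneg]] a
        by (simp add: a_def)
      finally have "K * norm (lin x d - cbar) \<le> K * (K * (D * t\<^sup>2) + K * t\<^sup>2)"
        using K_nonneg by (intro mult_left_mono) auto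
      also have "\<dots> = (K * (K * D + K)) * t\<^sup>2" by (simp add: algebra_simps)
      also have "\<dots> \<le> C * t\<^sup>2" using C by (intro mult_right_mono) auto
      finally have "norm (g (lin x d) - g cbar) \<le> C * t\<^sup>2"
        using lipschitz_derivative_lipschitz[OF g_smooth d(1) cbar_in_ball] by linarith
      then show ?thesis by simp
    qed
    ultimately show ?thesis using d unfolding t_def by blast
  qed
  then show ?thesis using that[of s C] s1 C by (auto simp: s_def)
qed

text \<open>A minimizer exists on a compact set of short feasible steps; the comparison of values
  then bounds it strictly inside the radius, so the artificial length constraint is inactive and the
  multiplier rule applies.\<close>

lemma manifold_step_exists:
  assumes \<eta>: "0 < \<eta>"
  obtains s C where "0 < s" "s \<le> R" "0 \<le> C"
    "\<And>x \<mu>. x \<in> ball xbar s \<Longrightarrow> 4 * \<rho> * K\<^sup>2 + \<eta> \<le> \<mu> \<Longrightarrow>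
      \<exists>d v. norm d \<le> C * norm (x - xbar) \<and> lin x d \<in> M \<and>
        v - grad (lin x d) \<in> N (lin x d) \<and> adjoint (c' x) v + \<mu> *\<^sub>R d = 0"
proof -
  obtain s1 D where s1: "0 < s1" "s1 \<le> R" "0 \<le> D"
    and comp: "\<And>x. x \<in> ball xbar s1 \<Longrightarrow> \<exists>d. lin x d \<in> ball cbar R \<and> F (lin x d) = 0 \<and>
      norm d \<le> D * norm (x - xbar) \<and> g (lin x d) \<le> g cbar + D * (norm (x - xbar))\<^sup>2"
    by (rule feasible_comparison) (rule that; assumption)
  obtain s2 where s2: "0 < s2" "s2 \<le> R"
    and mult: "\<And>x d \<mu>. x \<in> ball xbar s2 \<Longrightarrow> d \<in> ball 0 s2 \<Longrightarrow> F (lin x d) = 0 \<Longrightarrow>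
      \<forall>\<^sub>F e in nhds d. F (lin x e) = 0 \<longrightarrow> g (lin x d) + \<mu> / 2 * (norm d)\<^sup>2 \<le> g (lin x e) + \<mu> / 2 * (norm e)\<^sup>2 \<Longrightarrow>
      \<exists>v. v - grad (lin x d) \<in> N (lin x d) \<and> adjoint (c' x) v + \<mu> *\<^sub>R d = 0"
    by (rule lin_multiplier) (rule that; assumption)
  \<comment> \<open>The third condition keeps \<open>lin x d\<close> for all steps up to length
    \<open>r\<close> in the ball where the inequality for \<open>vbar\<close> is available.\<close>
  obtain r where r: "0 < r" "r < min s1 s2" "(2 * K) * r < \<epsilon>"
    using exists_small[of "min s1 s2" \<epsilon> "2 * K"] s1 s2 \<epsilon> by auto
  define V where "V = norm vbar * K"
  \<comment> \<open>\<open>A\<close> gathers the terms quadratic in \<open>norm (x - xbar)\<close>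
    and free of \<mu>: excess value, error at \<open>vbar\<close>, defect. \<open>B\<close> is the
    proximal cost of the comparison step, \<open>V\<close> the coefficient of the mixed
    error.\<close>
  define A where "A = D + V + \<rho> * K\<^sup>2"
  define B where "B = D\<^sup>2 / 2"
  define C where "C = 1 + 4 * (A / \<eta> + B) + 4 * V / \<eta>"
  have nonneg: "0 \<le> V" "0 \<le> A" "0 \<le> B"
    using s1 K_nonneg \<rho> by (auto simp: V_def A_def B_def)
  then have C: "0 \<le> C" using \<eta> by (simp add: C_def)
  \<comment> \<open>Puts both the comparison step, of length at most \<open>D * t\<close>, and the
    minimizer, of length at most \<open>C * t\<close>, strictly inside radius
    \<open>r\<close>.\<close>
  obtain s where s: "0 < s" "s < r" "(C + D) * s < r"
    using exists_small[of r r "C + D"] r by auto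
  have "\<exists>d v. norm d \<le> C * norm (x - xbar) \<and> lin x d \<in> M \<and>
        v - grad (lin x d) \<in> N (lin x d) \<and> adjoint (c' x) v + \<mu> *\<^sub>R d = 0"
    if x: "x \<in> ball xbar s" and \<mu>: "4 * \<rho> * K\<^sup>2 + \<eta> \<le> \<mu>" for x \<mu>
  proof -
    define t where "t = norm (x - xbar)"
    have t: "0 \<le> t" "t < s" using x unfolding mem_ball_norm t_def by auto
    have xs: "x \<in> ball xbar s1" "x \<in> ball xbar s2" "x \<in> ball xbar R" using x s r s1 s2 by auto
    have "C * t \<le> (C + D) * s" "D * t \<le> (C + D) * s"
      using t C s1 by (auto intro!: mult_mono)
    then have Ct: "C * t < r" and Dt: "D * t < r" using s(3) by auto
    have \<mu>pos: "\<eta> \<le> \<mu>" "0 < \<mu>" "\<rho> * K\<^sup>2 \<le> \<mu> / 4"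
      using \<mu> \<eta> mult_nonneg_nonneg[OF \<rho> zero_le_power2[of K]] by auto
    have near: "lin x d \<in> ball cbar \<epsilon>" if "norm d \<le> r" for d
    proof -
      have "K * norm (x - xbar) \<le> K * r" "K * norm d \<le> K * r"
        using t that s K_nonneg by (auto simp: t_def intro!: mult_left_mono)
      then show ?thesis using norm_lin_le[OF xs(3), of d] r(3) unfolding mem_ball_norm by linarith
    qed
    define S where "S = {d \<in> cball 0 r. F (lin x d) = 0}"
    have sub: "lin x ` cball 0 r \<subseteq> ball cbar R" using near \<epsilon> by fastforce
    have "continuous_on (cball 0 r) (\<lambda>d. F (lin x d))"
      using continuous_on_compose2[OF continuous_on_F[OF sub] continuous_on_lin] by blast
    then have "closed S" unfolding S_def
      by (intro continuous_closed_preimage_constant) auto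
    moreover have "bounded S" by (rule bounded_subset[OF bounded_cball[of 0 r]]) (auto simp: S_def)
    ultimately have "compact S" by (simp add: compact_eq_bounded_closed)
    moreover have "continuous_on S (\<lambda>d. g (lin x d) + \<mu> / 2 * (norm d)\<^sup>2)"
    proof -
      have "continuous_on (cball 0 r) (\<lambda>d. g (lin x d))"
        using continuous_on_compose2[OF continuous_on_g[OF sub] continuous_on_lin] by blast
      then have "continuous_on S (\<lambda>d. g (lin x d))"
        by (rule continuous_on_subset) (auto simp: S_def)
      then show ?thesis by (intro continuous_intros)
    qed
    moreover obtain d0 where d0: "F (lin x d0) = 0" "norm d0 \<le> D * t" "g (lin x d0) \<le> g cbar + D * t\<^sup>2"
      using comp[OF xs(1)] unfolding t_def by blast
    have d0S: "d0 \<in> S" using d0 Dt by (simp add: S_def)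
    ultimately obtain d where d: "d \<in> S"
      and min: "\<And>e. e \<in> S \<Longrightarrow> g (lin x d) + \<mu> / 2 * (norm d)\<^sup>2 \<le> g (lin x e) + \<mu> / 2 * (norm e)\<^sup>2"
      using continuous_attains_inf[of S "\<lambda>d. g (lin x d) + \<mu> / 2 * (norm d)\<^sup>2"] by blast
    have dr: "norm d \<le> r" and Fd: "F (lin x d) = 0" using d by (auto simp: S_def)
    have zM: "lin x d \<in> M" using in_M_iff[of "lin x d"] near[OF dr] \<epsilon> Fd by auto
    define e where "e = norm d"
    have "\<mu> / 4 * e\<^sup>2 \<le> A * t\<^sup>2 + V * t * e + \<mu> * B * t\<^sup>2"
    proof -
      have 1: "g cbar - V * (t\<^sup>2 + t * e) - \<rho> * K\<^sup>2 * (t\<^sup>2 + e\<^sup>2) \<le> g (lin x d)"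
        using g_lower_bound[OF xs(3) near[OF dr] zM] by (simp add: t_def e_def V_def)
      have 2: "g (lin x d) + \<mu> / 2 * e\<^sup>2 \<le> g (lin x d0) + \<mu> / 2 * (norm d0)\<^sup>2"
        using min[OF d0S] by (simp add: e_def)
      have "(norm d0)\<^sup>2 \<le> (D * t)\<^sup>2" using d0 by (intro power_mono) auto
      then have 3: "\<mu> / 2 * (norm d0)\<^sup>2 \<le> \<mu> / 2 * (D * t)\<^sup>2"
        using \<mu>pos by (intro mult_left_mono) auto
      have 4: "\<rho> * K\<^sup>2 * e\<^sup>2 \<le> \<mu> / 4 * e\<^sup>2" using \<mu>pos by (intro mult_right_mono) auto
      have 5: "\<mu> / 2 * (D * t)\<^sup>2 = \<mu> * B * t\<^sup>2" by (simp add: B_def power_mult_distrib)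
      have 6: "A * t\<^sup>2 = D * t\<^sup>2 + V * t\<^sup>2 + \<rho> * K\<^sup>2 * t\<^sup>2" by (simp add: A_def algebra_simps)
      have 7: "V * (t\<^sup>2 + t * e) = V * t\<^sup>2 + V * t * e" "\<rho> * K\<^sup>2 * (t\<^sup>2 + e\<^sup>2) = \<rho> * K\<^sup>2 * t\<^sup>2 + \<rho> * K\<^sup>2 * e\<^sup>2"
        by (simp_all add: algebra_simps)
      have 8: "\<mu> / 2 * e\<^sup>2 = \<mu> / 4 * e\<^sup>2 + \<mu> / 4 * e\<^sup>2" by simp
      show ?thesis using 1 2 3 4 d0(3) unfolding 5 6 7 8 by linarith
    qed
    then have e: "e \<le> C * t"
      unfolding C_def using nonneg t \<eta> \<mu>pos by (intro quadratic_growth_bound) (auto simp: e_def)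
    then have er: "norm d < r" using Ct by (simp add: e_def)
    have "\<forall>\<^sub>F e in nhds d. e \<in> ball 0 r"
      using er by (intro eventually_nhds_in_open) auto
    then have "\<forall>\<^sub>F e in nhds d. F (lin x e) = 0 \<longrightarrow> g (lin x d) + \<mu> / 2 * (norm d)\<^sup>2 \<le> g (lin x e) + \<mu> / 2 * (norm e)\<^sup>2"
    proof eventually_elim
      case (elim e)
      then show ?case using min[of e] by (simp add: S_def)
    qed
    moreover have "d \<in> ball 0 s2" using er r by simp
    ultimately obtain v where "v - grad (lin x d) \<in> N (lin x d)" "adjoint (c' x) v + \<mu> *\<^sub>R d = 0"
      using mult[OF xs(2) _ Fd] by blast
    then show ?thesis using e zM unfolding e_def t_def by blast
  qed
  then show ?thesis using that[of s C] s r s1 C by auto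
qed

lemma local_minimizer_of_multiplier:
  assumes x: "x \<in> ball xbar R" and z: "lin x d \<in> ball cbar \<epsilon>" "lin x d \<in> M"
    and v: "v \<in> P (lin x d)" "adjoint (c' x) v + \<mu> *\<^sub>R d = 0" and \<mu>: "\<rho> * K\<^sup>2 \<le> \<mu>"
  shows "local_minimizer (prox_linear_objective h c x \<mu>) d"
    and "0 \<in> subdifferential (prox_linear_objective h c x \<mu>) d"
proof -
  have hz: "h (lin x d) = ereal (g (lin x d))" using z \<epsilon> by (intro h_on_M) auto
  have obj: "prox_linear_objective h c x \<mu> e = h (lin x e) + ereal (\<mu> / 2 * (norm e)\<^sup>2)" for e
    by (simp add: prox_linear_objective_def linearization_eq_lin[OF x])
  have objd: "prox_linear_objective h c x \<mu> d = ereal (g (lin x d) + \<mu> / 2 * (norm d)\<^sup>2)"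
    by (simp add: obj hz)
  have "isCont (lin x) d" using continuous_on_lin[of UNIV x] by (simp add: continuous_on_eq_continuous_at)
  then have "(lin x \<longlongrightarrow> lin x d) (nhds d)" by (simp add: isCont_def tendsto_at_iff_tendsto_nhds)
  then have "\<forall>\<^sub>F e in nhds d. lin x e \<in> ball cbar \<epsilon>" using z by (auto dest: topological_tendstoD)
  then have "\<forall>\<^sub>F e in nhds d. prox_linear_objective h c x \<mu> d \<le> prox_linear_objective h c x \<mu> e"
  proof eventually_elim
    case (elim e)
    have *: "g (lin x d) + \<mu> / 2 * (norm d)\<^sup>2 \<le> t + \<mu> / 2 * (norm e)\<^sup>2" if t: "h (lin x e) \<le> ereal t" for t
    proof -
      have eq: "lin x e - lin x d = c' x (e - d)" by (simp add: lin_def blinfun.diff_right)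
      have "adjoint (c' x) v = - (\<mu> *\<^sub>R d)" using v(2) by (simp add: eq_neg_iff_add_eq_0)
      then have ve: "v \<bullet> c' x (e - d) = - \<mu> * (d \<bullet> (e - d))"
        using adjoint_blinfun_inner[of "c' x" v "e - d"] by simp
      have "g (lin x d) + v \<bullet> c' x (e - d) - \<rho> / 2 * (norm (c' x (e - d)))\<^sup>2 \<le> t"
        using v(1) elim t unfolding P_def eq[symmetric] by blast
      moreover have "\<rho> / 2 * (norm (c' x (e - d)))\<^sup>2 \<le> \<mu> / 2 * (norm (e - d))\<^sup>2"
      proof -
        have "(norm (c' x (e - d)))\<^sup>2 \<le> (K * norm (e - d))\<^sup>2"
          using lipschitz_derivative_apply[OF c_smooth x] by (intro power_mono) auto
        then have "\<rho> / 2 * (norm (c' x (e - d)))\<^sup>2 \<le> \<rho> / 2 * (K * norm (e - d))\<^sup>2"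
          using \<rho> by (intro mult_left_mono) auto
        also have "\<dots> = (\<rho> * K\<^sup>2) / 2 * (norm (e - d))\<^sup>2" by (simp add: power_mult_distrib)
        also have "\<dots> \<le> \<mu> / 2 * (norm (e - d))\<^sup>2" using \<mu> by (intro mult_right_mono) auto
        finally show ?thesis .
      qed
      \<comment> \<open>Exact expansion: its linear term cancels the contribution of
        \<open>v\<close> computed in \<open>ve\<close>, so only squares of
        \<open>norm (e - d)\<close> compete.\<close>
      moreover have "\<mu> / 2 * (norm e)\<^sup>2 = \<mu> / 2 * (norm d)\<^sup>2 + \<mu> * (d \<bullet> (e - d)) + \<mu> / 2 * (norm (e - d))\<^sup>2"
        unfolding power2_norm_eq_inner by (simp add: inner_diff_left inner_diff_right inner_commute algebra_simps)
      ultimately show ?thesis unfolding ve by linarith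
    qed
    show ?case
    proof (cases "h (lin x e)")
      case (real t)
      then show ?thesis using *[of t] unfolding objd unfolding obj by simp
    next
      case PInf
      then show ?thesis unfolding obj by simp
    next
      \<comment> \<open>Minus infinity is excluded by testing with a majorant that is too small by
        1.\<close>
      case MInf
      then show ?thesis using *[of "g (lin x d) + \<mu> / 2 * (norm d)\<^sup>2 - \<mu> / 2 * (norm e)\<^sup>2 - 1"] by simp
    qed
  qed
  then show 1: "local_minimizer (prox_linear_objective h c x \<mu>) d" by (simp add: local_minimizer_def)
  show "0 \<in> subdifferential (prox_linear_objective h c x \<mu>) d"
    by (rule local_minimizer_subdifferential[OF 1 objd])
qed

lemma lin_tendsto:
  assumes "x \<longlonglongrightarrow> xbar" "d \<longlonglongrightarrow> 0"
  shows "(\<lambda>r. lin (x r) (d r)) \<longlonglongrightarrow> cbar"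
proof -
  have "\<forall>\<^sub>F r in sequentially. x r \<in> ball xbar R"
    using topological_tendstoD[OF assms(1) open_ball] by simp
  then have "\<forall>\<^sub>F r in sequentially. norm (lin (x r) (d r) - cbar) \<le> K * norm (x r - xbar) + K * norm (d r)"
    by eventually_elim (rule norm_lin_le)
  moreover have "(\<lambda>r. K * norm (x r - xbar) + K * norm (d r)) \<longlonglongrightarrow> K * norm (xbar - xbar) + K * norm (0::'a)"
    by (intro tendsto_intros assms)
  then have "(\<lambda>r. K * norm (x r - xbar) + K * norm (d r)) \<longlonglongrightarrow> 0" by simp
  ultimately have "(\<lambda>r. lin (x r) (d r) - cbar) \<longlonglongrightarrow> 0"
    by (rule Lim_null_comparison)
  then show ?thesis by (simp add: LIM_zero_iff)
qed

text \<open>Convergence of \<open>v\<close> has to precede its membership in the subdifferential: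
  \<open>near_multiplier_in_P\<close> recognizes candidates as subgradients only near
  \<open>vbar\<close>.\<close>

lemma small_local_minimizers_exist:
  assumes \<eta>: "0 < \<eta>" and \<mu>: "\<And>r. 4 * \<rho> * K\<^sup>2 + \<eta> \<le> \<mu> r"
    and x: "x \<longlonglongrightarrow> xbar" and \<mu>x: "(\<lambda>r. \<mu> r * norm (x r - xbar)) \<longlonglongrightarrow> 0"
  shows "\<exists>d. small_local_minimizers h c xbar \<mu> x d"
proof -
  obtain s C where s: "0 < s" "s \<le> R" "0 \<le> C"
    and step: "\<And>x \<mu>. x \<in> ball xbar s \<Longrightarrow> 4 * \<rho> * K\<^sup>2 + \<eta> \<le> \<mu> \<Longrightarrow>
      \<exists>d v. norm d \<le> C * norm (x - xbar) \<and> lin x d \<in> M \<and>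
        v - grad (lin x d) \<in> N (lin x d) \<and> adjoint (c' x) v + \<mu> *\<^sub>R d = 0"
    by (rule manifold_step_exists[OF \<eta>]) (rule that; assumption)
  obtain s1 C1 where s1: "0 < s1" "0 \<le> C1"
    and mult: "\<And>x z v. x \<in> ball xbar s1 \<Longrightarrow> z \<in> ball cbar s1 \<Longrightarrow> v - grad z \<in> N z \<Longrightarrow>
      norm (v - vbar) \<le> C1 * (norm (x - xbar) + norm (z - cbar) + norm (adjoint (c' x) v))"
    by (rule multiplier_near) (rule that; assumption)
  obtain s2 where s2: "0 < s2"
    "\<And>z v. z \<in> ball cbar s2 \<Longrightarrow> z \<in> M \<Longrightarrow> v \<in> ball vbar s2 \<Longrightarrow> v - grad z \<in> N z \<Longrightarrow> v \<in> P z"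
    by (rule near_multiplier_in_P) (rule that; assumption)
  have "\<exists>d v. x r \<in> ball xbar s \<longrightarrow> norm d \<le> C * norm (x r - xbar) \<and> lin (x r) d \<in> M \<and>
        v - grad (lin (x r) d) \<in> N (lin (x r) d) \<and> adjoint (c' (x r)) v + \<mu> r *\<^sub>R d = 0" for r
    using step \<mu> by blast
  then obtain d v where dv: "\<And>r. x r \<in> ball xbar s \<Longrightarrow> norm (d r) \<le> C * norm (x r - xbar) \<and> lin (x r) (d r) \<in> M \<and>
        v r - grad (lin (x r) (d r)) \<in> N (lin (x r) (d r)) \<and> adjoint (c' (x r)) (v r) + \<mu> r *\<^sub>R d r = 0"
    by metis
  define z where "z r = lin (x r) (d r)" for r
  have x_ev: "\<forall>\<^sub>F r in sequentially. x r \<in> ball xbar q" if "0 < q" for q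
    using topological_tendstoD[OF x open_ball] that by simp
  have dle: "\<forall>\<^sub>F r in sequentially. norm (d r) \<le> C * norm (x r - xbar)"
    using x_ev[OF s(1)] by eventually_elim (use dv in blast)
  have "(\<lambda>r. C * norm (x r - xbar)) \<longlonglongrightarrow> C * norm (xbar - xbar)" by (intro tendsto_intros x)
  then have d0: "d \<longlonglongrightarrow> 0" by (intro Lim_null_comparison[OF dle]) simp
  have z: "z \<longlonglongrightarrow> cbar" unfolding z_def by (rule lin_tendsto[OF x d0])
  have z_ev: "\<forall>\<^sub>F r in sequentially. z r \<in> ball cbar q" if "0 < q" for q
    using topological_tendstoD[OF z open_ball] that by simp
  have \<mu>pos: "0 \<le> \<mu> r" for r
    using \<mu>[of r] \<eta> mult_nonneg_nonneg[OF \<rho> zero_le_power2[of K]] by linarith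
  \<comment> \<open>Here the hypothesis on \<open>\<mu> r * norm (x r - xbar)\<close> enters: as
    \<open>C\<close> does not depend on \<mu>, the image of \<open>v r\<close> under the adjoint of
    \<open>c' (x r)\<close> tends to 0 even for unbounded \<mu>.\<close>
  have \<mu>d: "(\<lambda>r. \<mu> r *\<^sub>R d r) \<longlonglongrightarrow> 0"
  proof (rule Lim_null_comparison)
    show "\<forall>\<^sub>F r in sequentially. norm (\<mu> r *\<^sub>R d r) \<le> C * (\<mu> r * norm (x r - xbar))"
      using dle
    proof eventually_elim
      case (elim r)
      then show ?case using mult_left_mono[OF elim \<mu>pos[of r]] \<mu>pos[of r] by (simp add: mult_ac)
    qed
    show "(\<lambda>r. C * (\<mu> r * norm (x r - xbar))) \<longlonglongrightarrow> 0"
      using tendsto_mult[OF tendsto_const \<mu>x, of C] by simp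
  qed
  have "\<forall>\<^sub>F r in sequentially. norm (v r - vbar) \<le> C1 * (norm (x r - xbar) + norm (z r - cbar) + norm (\<mu> r *\<^sub>R d r))"
    using x_ev[OF s(1)] x_ev[OF s1(1)] z_ev[OF s1(1)]
  proof eventually_elim
    case (elim r)
    have *: "v r - grad (z r) \<in> N (z r)" "adjoint (c' (x r)) (v r) + \<mu> r *\<^sub>R d r = 0"
      using dv[OF elim(1)] by (auto simp: z_def)
    then have "norm (adjoint (c' (x r)) (v r)) = norm (\<mu> r *\<^sub>R d r)"
      by (metis add_eq_0_iff norm_minus_cancel)
    then show ?case using mult[OF elim(2,3) *(1)] by simp
  qed
  moreover have "(\<lambda>r. C1 * (norm (x r - xbar) + norm (z r - cbar) + norm (\<mu> r *\<^sub>R d r))) \<longlonglongrightarrow>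
      C1 * (norm (xbar - xbar) + norm (cbar - cbar) + norm (0::'a))"
    by (intro tendsto_intros x z \<mu>d)
  then have "(\<lambda>r. C1 * (norm (x r - xbar) + norm (z r - cbar) + norm (\<mu> r *\<^sub>R d r))) \<longlonglongrightarrow> 0" by simp
  ultimately have "(\<lambda>r. v r - vbar) \<longlonglongrightarrow> 0"
    by (rule Lim_null_comparison)
  then have v: "v \<longlonglongrightarrow> vbar" by (simp add: LIM_zero_iff)
  have v_ev: "\<forall>\<^sub>F r in sequentially. v r \<in> ball vbar s2"
    using topological_tendstoD[OF v open_ball] s2 by simp
  have main: "\<forall>\<^sub>F r in sequentially. x r \<in> ball xbar R \<and> z r \<in> ball cbar \<epsilon> \<and> z r \<in> M \<and> v r \<in> P (z r) \<and>
      adjoint (c' (x r)) (v r) + \<mu> r *\<^sub>R d r = 0"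
    using x_ev[OF s(1)] z_ev[OF s2(1)] z_ev[OF \<epsilon>(1)] v_ev
  proof eventually_elim
    case (elim r)
    have "z r \<in> M" "v r - grad (z r) \<in> N (z r)" "adjoint (c' (x r)) (v r) + \<mu> r *\<^sub>R d r = 0"
      using dv[OF elim(1)] by (auto simp: z_def)
    moreover have "x r \<in> ball xbar R" using elim(1) s by auto
    ultimately show ?case using elim s2 by blast
  qed
  have \<mu>\<rho>: "\<rho> * K\<^sup>2 \<le> \<mu> r" for r
    using \<mu>[of r] \<eta> mult_nonneg_nonneg[OF \<rho> zero_le_power2[of K]] by linarith
  have "small_local_minimizers h c xbar \<mu> x d"
    unfolding small_local_minimizers_def
  proof (intro conjI exI[of _ v] exI[of _ vbar])
    show "\<forall>\<^sub>F r in sequentially. local_minimizer (prox_linear_objective h c (x r) (\<mu> r)) (d r) \<and>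
        0 \<in> subdifferential (prox_linear_objective h c (x r) (\<mu> r)) (d r)"
      using main
    proof eventually_elim
      case (elim r)
      then show ?case
        using local_minimizer_of_multiplier[of "x r" "d r" "v r" "\<mu> r"] \<mu>\<rho>[of r] unfolding z_def by blast
    qed
    show "(\<lambda>r. norm (d r)) \<in> O(\<lambda>r. norm (x r - xbar))"
      using dle by (intro bigoI[of _ C]) simp
    have "\<forall>\<^sub>F r in sequentially. h (linearization c (x r) (d r)) = ereal (g (z r))"
      using main
    proof eventually_elim
      case (elim r)
      then show ?case using linearization_eq_lin[of "x r" "d r"] h_on_M[of "z r"] \<epsilon> by (simp add: z_def)
    qed
    moreover have "(\<lambda>r. ereal (g (z r))) \<longlonglongrightarrow> ereal (g cbar)"
    proof -
      have "isCont g cbar"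
        using has_derivative_continuous[OF g_has_derivative[OF cbar_in_ball]] by simp
      then have "(\<lambda>r. g (z r)) \<longlonglongrightarrow> g cbar" by (rule isCont_tendsto_compose) (rule z)
      then show ?thesis by simp
    qed
    ultimately show "(\<lambda>r. h (linearization c (x r) (d r))) \<longlonglongrightarrow> h (c xbar)"
      by (simp add: h_cbar tendsto_cong)
    show "subdifferential h (c xbar) \<inter> null_space (adjoint (\<nabla> c xbar)) = {vbar}"
      using vbar_unique lipschitz_derivative_nabla[OF c_smooth xbar_in_ball] by simp
    show "\<forall>\<^sub>F r in sequentially. v r \<in> subdifferential h (linearization c (x r) (d r)) \<and>
        adjoint (\<nabla> c (x r)) (v r) + \<mu> r *\<^sub>R d r = 0"
      using main
    proof eventually_elim
      case (elim r)
      then show ?case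
        using P_subset_subdifferential[of "z r" "v r"] linearization_eq_lin[of "x r" "d r"]
          lipschitz_derivative_nabla[OF c_smooth, of "x r"] by (simp add: z_def)
    qed
  qed fact
  then show ?thesis by blast
qed

section \<open>Uniqueness and identification for arbitrary small minimizers\<close>

lemma small_local_minimizersE:
  assumes x: "x \<longlonglongrightarrow> xbar" and d: "small_local_minimizers h c xbar \<mu> x d" and q: "0 < q"
  obtains v where "d \<longlonglongrightarrow> 0"
    "\<forall>\<^sub>F r in sequentially. lin (x r) (d r) \<in> ball cbar q \<and> \<bar>h (lin (x r) (d r)) - h cbar\<bar> < ereal q \<and>
      v r \<in> subdifferential h (lin (x r) (d r)) \<and> dist (v r) vbar < q \<and>
      adjoint (c' (x r)) (v r) + \<mu> r *\<^sub>R d r = 0"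
proof -
  obtain v w where O: "(\<lambda>r. norm (d r)) \<in> O(\<lambda>r. norm (x r - xbar))"
    and hl: "(\<lambda>r. h (linearization c (x r) (d r))) \<longlonglongrightarrow> h (c xbar)"
    and w: "subdifferential h (c xbar) \<inter> null_space (adjoint (\<nabla> c xbar)) = {w}"
    and vr: "\<forall>\<^sub>F r in sequentially. v r \<in> subdifferential h (linearization c (x r) (d r)) \<and>
           adjoint (\<nabla> c (x r)) (v r) + \<mu> r *\<^sub>R d r = 0" and v: "v \<longlonglongrightarrow> w"
    using d unfolding small_local_minimizers_def by blast
  have "w = vbar" using w vbar_unique lipschitz_derivative_nabla[OF c_smooth xbar_in_ball] by simp
  with v have v: "v \<longlonglongrightarrow> vbar" by simp
  obtain C where C: "\<forall>\<^sub>F r in sequentially. norm (d r) \<le> C * norm (x r - xbar)"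
    using O by (auto elim!: landau_o.bigE)
  have "(\<lambda>r. C * norm (x r - xbar)) \<longlonglongrightarrow> C * norm (xbar - xbar)" by (intro tendsto_intros x)
  then have d0: "d \<longlonglongrightarrow> 0" by (intro Lim_null_comparison[OF C]) simp
  have xR: "\<forall>\<^sub>F r in sequentially. x r \<in> ball xbar R"
    using topological_tendstoD[OF x open_ball] by simp
  have zq: "\<forall>\<^sub>F r in sequentially. lin (x r) (d r) \<in> ball cbar q"
    using topological_tendstoD[OF lin_tendsto[OF x d0] open_ball] q by simp
  have hq: "\<forall>\<^sub>F r in sequentially. \<bar>h (linearization c (x r) (d r)) - h cbar\<bar> < ereal q"
    using eventually_near_ereal[OF hl[unfolded h_cbar] q] unfolding h_cbar .
  have vq: "\<forall>\<^sub>F r in sequentially. dist (v r) vbar < q" by (rule tendstoD[OF v q])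
  have "\<forall>\<^sub>F r in sequentially. lin (x r) (d r) \<in> ball cbar q \<and> \<bar>h (lin (x r) (d r)) - h cbar\<bar> < ereal q \<and>
      v r \<in> subdifferential h (lin (x r) (d r)) \<and> dist (v r) vbar < q \<and>
      adjoint (c' (x r)) (v r) + \<mu> r *\<^sub>R d r = 0"
    using xR zq hq vq vr
  proof eventually_elim
    case (elim r)
    then show ?case
      using linearization_eq_lin[OF elim(1)] lipschitz_derivative_nabla[OF c_smooth elim(1)] by simp
  qed
  then show ?thesis using that d0 by blast
qed

lemma small_local_minimizers_unique:
  assumes \<mu>: "\<And>r. \<rho> * K\<^sup>2 < \<mu> r" and x: "x \<longlonglongrightarrow> xbar"
    and d: "small_local_minimizers h c xbar \<mu> x d" and d': "small_local_minimizers h c xbar \<mu> x d'"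
  shows "\<forall>\<^sub>F r in sequentially. d r = d' r"
proof -
  obtain v where v: "\<forall>\<^sub>F r in sequentially. lin (x r) (d r) \<in> ball cbar \<epsilon> \<and> \<bar>h (lin (x r) (d r)) - h cbar\<bar> < ereal \<epsilon> \<and>
      v r \<in> subdifferential h (lin (x r) (d r)) \<and> dist (v r) vbar < \<epsilon> \<and>
      adjoint (c' (x r)) (v r) + \<mu> r *\<^sub>R d r = 0"
    by (rule small_local_minimizersE[OF x d \<epsilon>(1)]) (rule that; assumption)
  obtain v' where v': "\<forall>\<^sub>F r in sequentially. lin (x r) (d' r) \<in> ball cbar \<epsilon> \<and> \<bar>h (lin (x r) (d' r)) - h cbar\<bar> < ereal \<epsilon> \<and>
      v' r \<in> subdifferential h (lin (x r) (d' r)) \<and> dist (v' r) vbar < \<epsilon> \<and>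
      adjoint (c' (x r)) (v' r) + \<mu> r *\<^sub>R d' r = 0"
    by (rule small_local_minimizersE[OF x d' \<epsilon>(1)]) (rule that; assumption)
  have "\<forall>\<^sub>F r in sequentially. x r \<in> ball xbar R"
    using topological_tendstoD[OF x open_ball] by simp
  with v v' show ?thesis
  proof eventually_elim
    case (elim r)
    define z where "z = lin (x r) (d r)"
    define z' where "z' = lin (x r) (d' r)"
    obtain a where a: "h z = ereal a"
      using elim unfolding subdifferential_def z_def by (cases "h z") (auto simp: z_def)
    obtain a' where a': "h z' = ereal a'"
      using elim unfolding subdifferential_def z'_def by (cases "h z'") (auto simp: z'_def)
    have 1: "a + v r \<bullet> (z' - z) - \<rho> / 2 * (norm (z' - z))\<^sup>2 \<le> a'"
      using prox[of z z' "v r" a'] elim a a' by (simp add: z_def z'_def)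
    have 2: "a' + v' r \<bullet> (z - z') - \<rho> / 2 * (norm (z - z'))\<^sup>2 \<le> a"
      using prox[of z' z "v' r" a] elim a a' by (simp add: z_def z'_def)
    have zz: "z' - z = c' (x r) (d' r - d r)" by (simp add: z_def z'_def lin_def blinfun.diff_right)
    have "v' r \<bullet> (z - z') = - (v' r \<bullet> (z' - z))" by (simp add: inner_diff_right)
    then have "(v r - v' r) \<bullet> (z' - z) \<le> \<rho> * (norm (z' - z))\<^sup>2"
      using 1 2 by (simp add: inner_diff_left norm_minus_commute)
    also have "\<dots> \<le> \<rho> * (K * norm (d' r - d r))\<^sup>2"
      unfolding zz using lipschitz_derivative_apply[OF c_smooth] elim \<rho>
      by (intro mult_left_mono power_mono) auto
    finally have le: "(v r - v' r) \<bullet> c' (x r) (d' r - d r) \<le> \<rho> * K\<^sup>2 * (norm (d' r - d r))\<^sup>2"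
      unfolding zz by (simp add: power_mult_distrib)
    \<comment> \<open>The multiplier equations make the left side of \<open>le\<close> equal to
      \<mu> times the squared distance of the steps, and \<mu> exceeds
      \<open>\<rho> * K^2\<close>.\<close>
    have "adjoint (c' (x r)) (v r - v' r) = \<mu> r *\<^sub>R (d' r - d r)"
      using elim by (simp add: adjoint_blinfun_simps scaleR_diff_right add_eq_0_iff2)
    then have "(v r - v' r) \<bullet> c' (x r) (d' r - d r) = \<mu> r * (norm (d' r - d r))\<^sup>2"
      by (simp add: adjoint_blinfun_inner[symmetric] power2_norm_eq_inner)
    with le have "\<mu> r * (norm (d' r - d r))\<^sup>2 \<le> \<rho> * K\<^sup>2 * (norm (d' r - d r))\<^sup>2" by simp
    then have "(norm (d' r - d r))\<^sup>2 \<le> 0" using \<mu>[of r] by (simp add: mult_le_cancel_right)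
    then show ?case by simp
  qed
qed

lemma small_local_minimizers_identify:
  obtains \<gamma> where "0 \<le> \<gamma>"
    "\<And>\<mu> x d. x \<longlonglongrightarrow> xbar \<Longrightarrow> small_local_minimizers h c xbar \<mu> x d \<Longrightarrow> identifies_manifold h c M \<gamma> x d"
proof -
  obtain q where q: "0 < q" "q \<le> \<epsilon>"
    and ident: "\<And>z v. z \<in> ball cbar q \<Longrightarrow> \<bar>h z - h cbar\<bar> < ereal q \<Longrightarrow> v \<in> subdifferential h z \<Longrightarrow> dist v vbar < q \<Longrightarrow> z \<in> M"
    by (rule active_manifold_identification) (rule that; assumption)
  obtain s \<kappa> where s: "0 < s" "s \<le> R" "0 \<le> \<kappa>"
    and feas: "\<And>x. x \<in> ball xbar s \<Longrightarrow>
      c x \<in> ball cbar R \<and> (\<exists>x'\<in>ball xbar R. c x' \<in> ball cbar R \<and> c x' \<in> M \<and> norm (x' - x) \<le> \<kappa> * norm (F (c x)))"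
    by (rule c_feasible) (rule that; assumption)
  \<comment> \<open>The correction of \<open>x + d\<close> is at most \<kappa> times
    \<open>norm (F (c (x + d)))\<close>, itself at most \<open>K * K * |d|^2\<close>. The second
    summand of \<gamma> bounds the resulting change of \<open>g\<close>.\<close>
  define \<kappa>' where "\<kappa>' = \<kappa> * (K * K)"
  define \<gamma> where "\<gamma> = \<kappa>' + K * (K * \<kappa>' + K)"
  have \<kappa>': "0 \<le> \<kappa>'" using s K_nonneg by (simp add: \<kappa>'_def)
  have \<gamma>: "\<kappa>' \<le> \<gamma>" "K * (K * \<kappa>' + K) \<le> \<gamma>" "0 \<le> \<gamma>" using \<kappa>' K_nonneg by (auto simp: \<gamma>_def)
  have "identifies_manifold h c M \<gamma> x d"
    if x: "x \<longlonglongrightarrow> xbar" and d: "small_local_minimizers h c xbar \<mu> x d" for \<mu> x d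
  proof -
    obtain v where d0: "d \<longlonglongrightarrow> 0"
      and v: "\<forall>\<^sub>F r in sequentially. lin (x r) (d r) \<in> ball cbar q \<and> \<bar>h (lin (x r) (d r)) - h cbar\<bar> < ereal q \<and>
      v r \<in> subdifferential h (lin (x r) (d r)) \<and> dist (v r) vbar < q \<and>
      adjoint (c' (x r)) (v r) + \<mu> r *\<^sub>R d r = 0"
      by (rule small_local_minimizersE[OF x d q(1)])
    have xR: "\<forall>\<^sub>F r in sequentially. x r \<in> ball xbar R"
      using topological_tendstoD[OF x open_ball] by simp
    have "(\<lambda>r. x r + d r) \<longlonglongrightarrow> xbar" using tendsto_add[OF x d0] by simp
    then have "\<forall>\<^sub>F r in sequentially. x r + d r \<in> ball xbar s"
      using topological_tendstoD[OF _ open_ball] s by fastforce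
    with v xR show ?thesis
      unfolding identifies_manifold_def
    proof eventually_elim
      case (elim r)
      define z where "z = lin (x r) (d r)"
      define u where "u = x r + d r"
      have lz: "linearization c (x r) (d r) = z" using elim by (simp add: z_def linearization_eq_lin)
      have zM: "z \<in> M" unfolding z_def by (rule ident) (use elim in blast)+
      have zR: "z \<in> ball cbar R" using elim q \<epsilon> by (simp add: z_def)
      have Fz: "F z = 0" using in_M_iff zR zM by blast
      have us: "u \<in> ball xbar s" "u \<in> ball xbar R" using elim s by (auto simp: u_def)
      obtain x' where x': "x' \<in> ball xbar R" "c x' \<in> ball cbar R" "c x' \<in> M" "norm (x' - u) \<le> \<kappa> * norm (F (c u))"
        and cu: "c u \<in> ball cbar R" using feas[OF us(1)] by blast
      \<comment> \<open>\<open>z\<close> is the linearized value at \<open>x r\<close>, so the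
        difference is the Taylor remainder of \<open>c\<close>.\<close>
      have cuz: "norm (c u - z) \<le> K * (norm (d r))\<^sup>2"
        using lipschitz_derivative_taylor[OF c_smooth us(2), of "x r"] elim by (simp add: u_def z_def lin_def diff_diff_eq)
      have "norm (F (c u)) \<le> K * norm (c u - z)"
        using lipschitz_derivative_lipschitz[OF F_smooth cu zR] by (simp add: Fz)
      also have "\<dots> \<le> K * (K * (norm (d r))\<^sup>2)" by (rule mult_left_mono[OF cuz K_nonneg])
      finally have x'u: "norm (x' - u) \<le> \<kappa>' * (norm (d r))\<^sup>2"
        using order_trans[OF x'(4) mult_left_mono[OF _ s(3)]] by (simp add: \<kappa>'_def mult.assoc)
      have "norm (c x' - z) \<le> norm (c x' - c u) + norm (c u - z)"
        using norm_triangle_ineq[of "c x' - c u" "c u - z"] by simp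
      also have "\<dots> \<le> K * (\<kappa>' * (norm (d r))\<^sup>2) + K * (norm (d r))\<^sup>2"
        by (intro add_mono cuz order_trans[OF lipschitz_derivative_lipschitz[OF c_smooth x'(1) us(2)] mult_left_mono[OF x'u K_nonneg]])
      finally have "K * norm (c x' - z) \<le> K * (K * (\<kappa>' * (norm (d r))\<^sup>2) + K * (norm (d r))\<^sup>2)"
        using K_nonneg by (intro mult_left_mono) auto
      also have "\<dots> = (K * (K * \<kappa>' + K)) * (norm (d r))\<^sup>2" by (simp add: algebra_simps)
      also have "\<dots> \<le> \<gamma> * (norm (d r))\<^sup>2" using \<gamma> by (intro mult_right_mono) auto
      finally have "norm (g (c x') - g z) \<le> \<gamma> * (norm (d r))\<^sup>2"
        using lipschitz_derivative_lipschitz[OF g_smooth x'(2) zR] by linarith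
      then have "h (c x') \<le> h z + ereal (\<gamma> * (norm (d r))\<^sup>2)"
        using h_on_M[OF x'(2,3)] h_on_M[OF zR zM] by simp
      moreover have "norm (x' - u) \<le> \<gamma> * (norm (d r))\<^sup>2"
        using order_trans[OF x'u mult_right_mono[OF \<gamma>(1)]] by simp
      ultimately show ?case using zM x'(3) unfolding lz u_def by blast
    qed
  qed
  then show ?thesis using that \<gamma>(3) by blast
qed

end

section \<open>From the hypotheses to the local data\<close>

text \<open>The last conclusion is an implication because \<epsilon> and \<rho> are supplied later:
  the same smooth data are used once with prox-regularity and once with convexity.\<close>

lemma composite_problem_exists:
  fixes h :: "'b::euclidean_space \<Rightarrow> ereal" and c :: "'a::euclidean_space \<Rightarrow> 'b"
  assumes c: "C2_around c xbar" and ps: "partly_smooth h (c xbar) M"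
    and par: "parallel_subspace (subdifferential h (c xbar)) \<inter> null_space (adjoint (\<nabla> c xbar)) = {0}"
    and ri: "rel_interior (subdifferential h (c xbar)) \<inter> null_space (adjoint (\<nabla> c xbar)) \<noteq> {}"
  obtains c' F F' Y g g' R K vbar \<delta> where "0 < R" "vbar \<in> subdifferential h (c xbar)"
    "\<And>\<epsilon> \<rho>. 0 < \<epsilon> \<Longrightarrow> \<epsilon> \<le> R \<Longrightarrow> 0 \<le> \<rho> \<Longrightarrow>
      (\<And>z y v t. z \<in> ball (c xbar) \<epsilon> \<Longrightarrow> y \<in> ball (c xbar) \<epsilon> \<Longrightarrow> \<bar>h z - h (c xbar)\<bar> < ereal \<epsilon> \<Longrightarrow>
        v \<in> subdifferential h z \<Longrightarrow> dist v vbar < \<epsilon> \<Longrightarrow> h y \<le> ereal t \<Longrightarrow>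
        real_of_ereal (h z) + v \<bullet> (y - z) - \<rho> / 2 * (norm (y - z))\<^sup>2 \<le> t) \<Longrightarrow>
      composite_problem h c xbar M c' F F' Y g g' R K vbar \<delta> \<epsilon> \<rho>"
proof -
  let ?cb = "c xbar" and ?S = "subdifferential h (c xbar)"
  obtain c' R1 K1 where 1: "lipschitz_derivative_on c c' xbar R1 K1"
    using C2_around_lipschitz_derivative[OF c] by blast
  \<comment> \<open>The very choice made in \<open>normal_space\<close>, so that the normal space
    becomes the range of the adjoint of this derivative.\<close>
  define F where "F = (SOME F. defining_map M ?cb F)"
  have "manifold_about M ?cb" using ps unfolding partly_smooth_def by blast
  then have cM: "?cb \<in> M" and ex: "\<exists>F. defining_map M ?cb F" unfolding manifold_about_def by blast+
  have "defining_map M ?cb F" unfolding F_def by (rule someI_ex[OF ex])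
  then obtain Y where "subspace Y \<and> range F \<subseteq> Y \<and> C2_around F ?cb \<and> range (\<nabla> F ?cb) = Y \<and>
      (\<forall>\<^sub>F z in nhds ?cb. z \<in> M \<longleftrightarrow> F z = 0)"
    unfolding defining_map_def ..
  then have Y: "subspace Y" "range F \<subseteq> Y" "C2_around F ?cb" "range (\<nabla> F ?cb) = Y"
    and evM: "\<forall>\<^sub>F z in nhds ?cb. z \<in> M \<longleftrightarrow> F z = 0" by - (elim conjE, assumption)+
  obtain F' R2 K2 where 2: "lipschitz_derivative_on F F' ?cb R2 K2"
    using C2_around_lipschitz_derivative[OF Y(3)] by blast
  obtain g where g: "C2_around g ?cb" and evh: "\<forall>\<^sub>F z in nhds ?cb. z \<in> M \<longrightarrow> h z = ereal (g z)"
    using ps unfolding partly_smooth_def by blast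
  obtain g' R3 K3 where 3: "lipschitz_derivative_on g g' ?cb R3 K3"
    using C2_around_lipschitz_derivative[OF g] by blast
  obtain R4 where 4: "0 < R4" "\<And>z. dist z ?cb < R4 \<Longrightarrow> (z \<in> M \<longleftrightarrow> F z = 0) \<and> (z \<in> M \<longrightarrow> h z = ereal (g z))"
    using eventually_conj[OF evM evh] unfolding eventually_nhds_metric by blast
  define R where "R = min (min R1 R2) (min R3 R4)"
  define K where "K = max K1 (max K2 K3)"
  have R: "0 < R" "R \<le> R1" "R \<le> R2" "R \<le> R3" "R \<le> R4"
    using lipschitz_derivative_pos[OF 1] lipschitz_derivative_pos[OF 2] lipschitz_derivative_pos[OF 3] 4(1)
    by (auto simp: R_def)
  have K: "K1 \<le> K" "K2 \<le> K" "K3 \<le> K" by (auto simp: K_def)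
  have c1: "lipschitz_derivative_on c c' xbar R K"
    by (rule lipschitz_derivative_on_mono[OF 1 R(1,2) K(1)])
  have F1: "lipschitz_derivative_on F F' ?cb R K"
    by (rule lipschitz_derivative_on_mono[OF 2 R(1,3) K(2)])
  have g1: "lipschitz_derivative_on g g' ?cb R K"
    by (rule lipschitz_derivative_on_mono[OF 3 R(1,4) K(3)])
  have nc: "\<nabla> c xbar = blinfun_apply (c' xbar)" by (rule lipschitz_derivative_nabla[OF c1]) (simp add: R)
  have nF: "\<nabla> F ?cb = blinfun_apply (F' ?cb)" by (rule lipschitz_derivative_nabla[OF F1]) (simp add: R)
  define N where "N = range (adjoint (F' ?cb))"
  have N: "normal_space M ?cb = N" by (simp add: normal_space_def F_def[symmetric] nF N_def)
  have sN: "subspace N" unfolding N_def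
    by (simp add: adjoint_linear linear_blinfun_apply linear_subspace_image)
  have aff: "affine_parallel N (affine hull ?S)" using ps N unfolding partly_smooth_def by simp
  obtain vbar where vbar: "vbar \<in> rel_interior ?S" "adjoint (c' xbar) vbar = 0"
    using ri by (auto simp: null_space_def nc)
  have vS: "vbar \<in> ?S" using vbar(1) rel_interior_subset by blast
  obtain e where e: "0 < e" "ball vbar e \<inter> affine hull ?S \<subseteq> ?S"
    using vbar(1) unfolding mem_rel_interior_ball by blast
  obtain a where a: "affine hull ?S = (\<lambda>x. a + x) ` N" using aff unfolding affine_parallel_def by blast
  \<comment> \<open>The affine hull is the translate of \<open>N\<close> through
    \<open>vbar\<close>; this turns relative interiority into \<open>tilt\<close> and yields
    uniqueness of the critical subgradient.\<close>
  have hull: "u \<in> affine hull ?S \<longleftrightarrow> u - vbar \<in> N" for u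
  proof -
    have "vbar \<in> affine hull ?S" using vS by (rule hull_inc)
    then have va: "vbar - a \<in> N" using a by auto
    have "u \<in> affine hull ?S \<longleftrightarrow> u - a \<in> N" unfolding a by (force simp: image_iff algebra_simps)
    also have "\<dots> \<longleftrightarrow> u - vbar \<in> N"
      using subspace_diff[OF sN _ va, of "u - a"] subspace_add[OF sN _ va, of "u - vbar"] by auto
    finally show ?thesis .
  qed
  have parN: "parallel_subspace ?S = N" using vS by (intro parallel_subspace_eq sN aff) auto
  have trans: "w = 0" if "w \<in> N" "adjoint (c' xbar) w = 0" for w
    using par that by (auto simp: parN null_space_def nc)
  \<comment> \<open>Half of \<open>e\<close>, because \<open>tilt\<close> admits
    \<open>norm w = \<delta>\<close> while the ball is open.\<close>
  have "composite_problem h c xbar M c' F F' Y g g' R K vbar (e / 2) \<epsilon> \<rho>"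
    if "0 < \<epsilon>" "\<epsilon> \<le> R" "0 \<le> \<rho>"
      and "\<And>z y v t. z \<in> ball (c xbar) \<epsilon> \<Longrightarrow> y \<in> ball (c xbar) \<epsilon> \<Longrightarrow> \<bar>h z - h (c xbar)\<bar> < ereal \<epsilon> \<Longrightarrow>
        v \<in> subdifferential h z \<Longrightarrow> dist v vbar < \<epsilon> \<Longrightarrow> h y \<le> ereal t \<Longrightarrow>
        real_of_ereal (h z) + v \<bullet> (y - z) - \<rho> / 2 * (norm (y - z))\<^sup>2 \<le> t" for \<epsilon> \<rho>
  proof
    show "range (F' ?cb) = Y" using Y(4) nF by simp
    show "z \<in> M \<longleftrightarrow> F z = 0" if "z \<in> ball ?cb R" for z using 4(2)[of z] R that by (auto simp: dist_commute)
    show "h z = ereal (g z)" if "z \<in> ball ?cb R" "z \<in> M" for z using 4(2)[of z] R that by (auto simp: dist_commute)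
    show "\<exists>v. v \<longlonglongrightarrow> w \<and> (\<forall>\<^sub>F k in sequentially. v k \<in> subdifferential h (y k))"
      if "w \<in> ?S" "\<forall>k::nat. y k \<in> M" "y \<longlonglongrightarrow> ?cb" for w y
    proof -
      have "\<forall>\<^sub>F z in nhds ?cb. z \<in> M \<longrightarrow>
        subdifferential h z \<noteq> {} \<and> set_valued_continuous_within (subdifferential h) z M"
        using ps unfolding partly_smooth_def by blast
      then have "set_valued_continuous_within (subdifferential h) ?cb M"
        using cM eventually_nhds_x_imp_x by fastforce
      then show ?thesis using that unfolding set_valued_continuous_within_def by blast
    qed
    show "vbar + w \<in> ?S" if "w \<in> range (adjoint (F' ?cb))" "norm w \<le> e / 2" for w
      using that e hull[of "vbar + w"] by (auto simp: N_def dist_norm)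
    show "?S \<inter> null_space (adjoint (c' xbar)) = {vbar}"
    proof (intro equalityI subsetI)
      fix u assume u: "u \<in> ?S \<inter> null_space (adjoint (c' xbar))"
      then have "u - vbar \<in> N" using hull[of u] by (auto intro: hull_inc)
      then have "u - vbar = 0" using u vbar(2) by (intro trans) (auto simp: adjoint_blinfun_simps null_space_def)
      then show "u \<in> {vbar}" by simp
    qed (use vS vbar(2) in \<open>auto simp: null_space_def\<close>)
    show "w = 0" if "w \<in> range (adjoint (F' ?cb))" "adjoint (c' xbar) w = 0" for w
      using trans that unfolding N_def by blast
    show "0 < e / 2" using e by simp
  qed (use c1 F1 g1 Y cM that in blast)+
  then show ?thesis using that[OF R(1) vS] by blast
qed

text \<open>The small local minimizer is a notion for sequences, so it splits into existence,
  eventual uniqueness, and the conclusions for each such sequence. The bound on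
  \<open>norm d\<close> in the existence argument has a constant that grows like 1/\<eta>; hence the
  lower bound on \<mu> attached to existence in the convex part.\<close>

theorem theorem4p11:
  fixes h :: "real ^ 'm \<Rightarrow> ereal"
    and c :: "real ^ 'n \<Rightarrow> real ^ 'm"
    and xbar :: "real ^ 'n"
    and M :: "(real ^ 'm) set"
  assumes "C2_around c xbar"
    and "prox_regular h (c xbar)"
    and "partly_smooth h (c xbar) M"
    and "parallel_subspace (subdifferential h (c xbar)) \<inter> null_space (adjoint (\<nabla> c xbar)) = {0}"
    and "rel_interior (subdifferential h (c xbar)) \<inter> null_space (adjoint (\<nabla> c xbar)) \<noteq> {}"
  shows "(\<exists>\<mu>hat\<ge>0. \<exists>\<gamma>\<ge>0. \<forall>\<mu> x.
            (\<forall>r. \<mu> r > \<mu>hat) \<longrightarrow> x \<longlonglongrightarrow> xbar \<longrightarrow> (\<lambda>r. \<mu> r * norm (x r - xbar)) \<longlonglongrightarrow> 0 \<longrightarrow>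
              (\<exists>d. small_local_minimizers h c xbar \<mu> x d) \<and>
              (\<forall>d d'. small_local_minimizers h c xbar \<mu> x d \<longrightarrow>
                 small_local_minimizers h c xbar \<mu> x d' \<longrightarrow> (\<forall>\<^sub>F r in sequentially. d r = d' r)) \<and>
              (\<forall>d. small_local_minimizers h c xbar \<mu> x d \<longrightarrow> identifies_manifold h c M \<gamma> x d))
       \<and> ((\<forall>z. h z \<noteq> -\<infinity>) \<and> convex (epi h) \<and> (\<forall>z. lsc_at h z) \<longrightarrow>
          (\<exists>\<gamma>\<ge>0. \<forall>\<mu> x.
            (\<forall>r. \<mu> r > 0) \<longrightarrow> x \<longlonglongrightarrow> xbar \<longrightarrow> (\<lambda>r. \<mu> r * norm (x r - xbar)) \<longlonglongrightarrow> 0 \<longrightarrow>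
              ((\<exists>\<epsilon>>0. \<forall>r. \<mu> r \<ge> \<epsilon>) \<longrightarrow> (\<exists>d. small_local_minimizers h c xbar \<mu> x d)) \<and>
              (\<forall>d d'. small_local_minimizers h c xbar \<mu> x d \<longrightarrow>
                 small_local_minimizers h c xbar \<mu> x d' \<longrightarrow> (\<forall>\<^sub>F r in sequentially. d r = d' r)) \<and>
              (\<forall>d. small_local_minimizers h c xbar \<mu> x d \<longrightarrow> identifies_manifold h c M \<gamma> x d)))"
proof (rule composite_problem_exists[OF assms(1,3-5)])
  fix c' F F' Y g g' R K vbar \<delta>
  assume R: "0 < R" and vbar: "vbar \<in> subdifferential h (c xbar)"
    and problem: "\<And>\<epsilon> \<rho>. 0 < \<epsilon> \<Longrightarrow> \<epsilon> \<le> R \<Longrightarrow> 0 \<le> \<rho> \<Longrightarrow>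
      (\<And>z y v t. z \<in> ball (c xbar) \<epsilon> \<Longrightarrow> y \<in> ball (c xbar) \<epsilon> \<Longrightarrow> \<bar>h z - h (c xbar)\<bar> < ereal \<epsilon> \<Longrightarrow>
        v \<in> subdifferential h z \<Longrightarrow> dist v vbar < \<epsilon> \<Longrightarrow> h y \<le> ereal t \<Longrightarrow>
        real_of_ereal (h z) + v \<bullet> (y - z) - \<rho> / 2 * (norm (y - z))\<^sup>2 \<le> t) \<Longrightarrow>
      composite_problem h c xbar M c' F F' Y g g' R K vbar \<delta> \<epsilon> \<rho>"
  show ?thesis
  proof (intro conjI impI)
    have "prox_regular_for h (c xbar) vbar" using assms(2) vbar unfolding prox_regular_def by blast
    then obtain \<rho> \<epsilon>0 where \<rho>: "0 < \<rho>" and \<epsilon>0: "0 < \<epsilon>0"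
      and prox: "\<And>z y v. dist z (c xbar) < \<epsilon>0 \<Longrightarrow> dist y (c xbar) < \<epsilon>0 \<Longrightarrow> \<bar>h z - h (c xbar)\<bar> < ereal \<epsilon>0 \<Longrightarrow>
        v \<in> subdifferential h z \<Longrightarrow> dist v vbar < \<epsilon>0 \<Longrightarrow>
        h y \<ge> h z + ereal (v \<bullet> (y - z) - \<rho> / 2 * (norm (y - z))\<^sup>2)"
      unfolding prox_regular_for_def by blast
    interpret composite_problem h c xbar M c' F F' Y g g' R K vbar \<delta> "min \<epsilon>0 R" \<rho>
    proof (rule problem)
      fix z y v t
      assume *: "z \<in> ball (c xbar) (min \<epsilon>0 R)" "y \<in> ball (c xbar) (min \<epsilon>0 R)"
        "\<bar>h z - h (c xbar)\<bar> < ereal (min \<epsilon>0 R)" "v \<in> subdifferential h z" "dist v vbar < min \<epsilon>0 R" "h y \<le> ereal t"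
      obtain a where a: "h z = ereal a"
        using *(4) unfolding subdifferential_def by (cases "h z") auto
      have "h z + ereal (v \<bullet> (y - z) - \<rho> / 2 * (norm (y - z))\<^sup>2) \<le> h y"
        using * by (intro prox) (auto simp: dist_commute)
      also have "\<dots> \<le> ereal t" by fact
      finally show "real_of_ereal (h z) + v \<bullet> (y - z) - \<rho> / 2 * (norm (y - z))\<^sup>2 \<le> t"
        by (simp add: a)
    qed (use \<rho> \<epsilon>0 R in auto)
    obtain \<gamma> where \<gamma>: "0 \<le> \<gamma>" "\<And>\<mu> x d. x \<longlonglongrightarrow> xbar \<Longrightarrow> small_local_minimizers h c xbar \<mu> x d \<Longrightarrow> identifies_manifold h c M \<gamma> x d"
      by (rule small_local_minimizers_identify) (rule that; assumption)
    \<comment> \<open>The existence threshold with \<eta> = 1; it also exceeds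
      \<open>\<rho> * K^2\<close>, as uniqueness requires.\<close>
    define \<mu>hat where "\<mu>hat = 4 * \<rho> * K\<^sup>2 + 1"
    have nonneg: "0 \<le> \<rho> * K\<^sup>2" using \<rho> by simp
    then have "0 \<le> \<mu>hat" by (simp add: \<mu>hat_def)
    moreover have "\<exists>d. small_local_minimizers h c xbar \<mu> x d"
      if "\<forall>r. \<mu> r > \<mu>hat" "x \<longlonglongrightarrow> xbar" "(\<lambda>r. \<mu> r * norm (x r - xbar)) \<longlonglongrightarrow> 0" for \<mu> x
      using that by (intro small_local_minimizers_exist[of 1]) (auto simp: \<mu>hat_def less_imp_le)
    moreover have "\<forall>\<^sub>F r in sequentially. d r = d' r"
      if "\<forall>r. \<mu> r > \<mu>hat" "x \<longlonglongrightarrow> xbar" "small_local_minimizers h c xbar \<mu> x d"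
        "small_local_minimizers h c xbar \<mu> x d'" for \<mu> x d d'
    proof (rule small_local_minimizers_unique[OF _ that(2-4)])
      show "\<rho> * K\<^sup>2 < \<mu> r" for r using that(1)[rule_format, of r] nonneg unfolding \<mu>hat_def by linarith
    qed
    ultimately show "\<exists>\<mu>hat\<ge>0. \<exists>\<gamma>\<ge>0. \<forall>\<mu> x.
            (\<forall>r. \<mu> r > \<mu>hat) \<longrightarrow> x \<longlonglongrightarrow> xbar \<longrightarrow> (\<lambda>r. \<mu> r * norm (x r - xbar)) \<longlonglongrightarrow> 0 \<longrightarrow>
              (\<exists>d. small_local_minimizers h c xbar \<mu> x d) \<and>
              (\<forall>d d'. small_local_minimizers h c xbar \<mu> x d \<longrightarrow>
                 small_local_minimizers h c xbar \<mu> x d' \<longrightarrow> (\<forall>\<^sub>F r in sequentially. d r = d' r)) \<and>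
              (\<forall>d. small_local_minimizers h c xbar \<mu> x d \<longrightarrow> identifies_manifold h c M \<gamma> x d)"
      using \<gamma> by - (rule exI[of _ \<mu>hat], rule conjI, assumption, rule exI[of _ \<gamma>], rule conjI, assumption, blast)
  next
    assume convex: "(\<forall>z. h z \<noteq> -\<infinity>) \<and> convex (epi h) \<and> (\<forall>z. lsc_at h z)"
    \<comment> \<open>Convex subgradients satisfy the inequality globally, so the full radius
      \<open>R\<close> and \<rho> = 0 are allowed, which lowers the threshold of uniqueness to
      0.\<close>
    interpret composite_problem h c xbar M c' F F' Y g g' R K vbar \<delta> R 0
    proof (rule problem)
      show "real_of_ereal (h z) + v \<bullet> (y - z) - 0 / 2 * (norm (y - z))\<^sup>2 \<le> t"
        if "v \<in> subdifferential h z" "h y \<le> ereal t" for z y v t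
        using convex_subgradient_inequality[OF _ that] convex by simp
    qed (use R in auto)
    obtain \<gamma> where \<gamma>: "0 \<le> \<gamma>" "\<And>\<mu> x d. x \<longlonglongrightarrow> xbar \<Longrightarrow> small_local_minimizers h c xbar \<mu> x d \<Longrightarrow> identifies_manifold h c M \<gamma> x d"
      by (rule small_local_minimizers_identify) (rule that; assumption)
    \<comment> \<open>The uniform lower bound of \<mu> takes the role of \<eta>.\<close>
    have "\<exists>d. small_local_minimizers h c xbar \<mu> x d"
      if "\<exists>\<epsilon>>0. \<forall>r. \<mu> r \<ge> \<epsilon>" "x \<longlonglongrightarrow> xbar" "(\<lambda>r. \<mu> r * norm (x r - xbar)) \<longlonglongrightarrow> 0" for \<mu> x
      using that small_local_minimizers_exist[of _ \<mu> x] by auto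
    moreover have "\<forall>\<^sub>F r in sequentially. d r = d' r"
      if "\<forall>r. \<mu> r > 0" "x \<longlonglongrightarrow> xbar" "small_local_minimizers h c xbar \<mu> x d"
        "small_local_minimizers h c xbar \<mu> x d'" for \<mu> x d d'
      using that(1) by (intro small_local_minimizers_unique[OF _ that(2-4)]) simp
    ultimately show "\<exists>\<gamma>\<ge>0. \<forall>\<mu> x.
            (\<forall>r. \<mu> r > 0) \<longrightarrow> x \<longlonglongrightarrow> xbar \<longrightarrow> (\<lambda>r. \<mu> r * norm (x r - xbar)) \<longlonglongrightarrow> 0 \<longrightarrow>
              ((\<exists>\<epsilon>>0. \<forall>r. \<mu> r \<ge> \<epsilon>) \<longrightarrow> (\<exists>d. small_local_minimizers h c xbar \<mu> x d)) \<and>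
              (\<forall>d d'. small_local_minimizers h c xbar \<mu> x d \<longrightarrow>
                 small_local_minimizers h c xbar \<mu> x d' \<longrightarrow> (\<forall>\<^sub>F r in sequentially. d r = d' r)) \<and>
              (\<forall>d. small_local_minimizers h c xbar \<mu> x d \<longrightarrow> identifies_manifold h c M \<gamma> x d)"
      using \<gamma> by - (rule exI[of _ \<gamma>], rule conjI, assumption, blast)
  qed
qed

end
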